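(* Let $k$ be a field of characteristic $0$, let $r\ge1$ and let $\omega:\mathbb Z^r\times\mathbb Z^r\to k^\times$ be a normalized $2$-cocycle (for the trivial action of $\mathbb Z^r$ on $k^\times$). Then, in every degree $n\ge0$, $$\mathrm{HH}_n(k_\omega[\mathbb Z^r])\simeq(\Lambda^nV_r)^{(X_\lambda)},\qquad \mathrm{HC}_n(k_\omega[\mathbb Z^r])\simeq\Big(\bigoplus_{i\ge0}\Lambda^{n-2i}V_r\Big)\oplus(\Lambda^nV_{r-1})^{(X_\lambda^* )}.$$
   Context: $k_\omega[\mathbb Z^r]$ is the $k$-algebra with $k$-basis $\{e_g\mid g\in\mathbb Z^r\}$ and multiplication $e_x\cdot e_y=\omega(x,y)e_{x+y}$; $\omega$ normalized means $\omega(0,g)=\omega(g,0)=1$, so $e_0=1$. Define $\lambda:\mathbb Z^r\times\mathbb Z^r\to k^\times$ by $e_ge_xe_g^{-1}=\lambda(g,x)e_x$, i.e. $\lambda(g,x)=\omega(g,x)\omega(x,g)^{-1}$; for each $x$, $\lambda_x:=\lambda(-,x):\mathbb Z^r\to k^\times$ is a group homomorphism. $X_\lambda=\{x\in\mathbb Z^r\mid\lambda_x\text{ is trivial}\}$ and $X_\lambda^*=X_\lambda\setminus\{0\}$. $V_m$ is a $k$-vector space of dimension $m$, $\Lambda^jV_m$ its $j$-th exterior power (zero for $j<0$), and $W^{(X)}$ denotes the direct sum of copies of $W$ indexed by the set $X$. $\mathrm{HH}_*$ and $\mathrm{HC}_*$ are the usual Hochschild homology (with coefficients in the algebra itself) and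 cyclic homology of a $k$-algebra. *)

theory Defs
  imports
    "HOL-Algebra.Module"
    "HOL-Algebra.AbelCoset"
    "HOL-Algebra.Algebraic_Closure_Type"
    "HOL-Library.Poly_Mapping"
    "HOL-Analysis.Finite_Cartesian_Product"
begin

text \<open>
  Vector spaces over a field type \<open>'k\<close> are modules, in the sense of \<open>HOL-Algebra\<close>, over
  the ring \<open>ring_of_type_algebra :: 'k ring\<close>.  An associative unital algebra that need not be
  commutative is represented by the same record type \<open>('k, 'a) module\<close>, whose fields \<open>mult\<close>
  and \<open>one\<close> then hold the product and the unit.  (The locale \<open>algebra\<close> of \<open>HOL-Algebra\<close> is
  about commutative algebras only.)  For a plain vector space these two fields carry no
  meaning and are left \<open>undefined\<close>.
\<close>


section \<open>Linear algebra\<close>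

abbreviation scalars :: "'k::field ring"
  where "scalars \<equiv> ring_of_type_algebra"

definition module_isomorphic ::
    "('k, 'v, 'm) module_scheme \<Rightarrow> ('k, 'w, 'n) module_scheme \<Rightarrow> bool"  (infix \<open>\<simeq>\<^sub>k\<close> 50)
  where "M \<simeq>\<^sub>k N \<longleftrightarrow>
    (\<exists>h. h \<in> iso (add_monoid M) (add_monoid N) \<and>
         (\<forall>c. \<forall>x\<in>carrier M. h (c \<odot>\<^bsub>M\<^esub> x) = c \<odot>\<^bsub>N\<^esub> h x))"

definition submodule_span :: "('k::field, 'v, 'm) module_scheme \<Rightarrow> 'v set \<Rightarrow> 'v set"
  where "submodule_span M S = \<Inter>{H. submodule H scalars M \<and> S \<subseteq> H}"

definition quotient_module ::
    "('k, 'v, 'm) module_scheme \<Rightarrow> 'v set \<Rightarrow> ('k, 'v set) module"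
  where "quotient_module M H =
    \<lparr>carrier = a_rcosets\<^bsub>M\<^esub> H, monoid.mult = undefined, one = undefined,
     ring.zero = H, add = set_add M,
     module.smult = (\<lambda>c u. \<Union>x\<in>u. H +>\<^bsub>M\<^esub> (c \<odot>\<^bsub>M\<^esub> x))\<rparr>"

definition free_module :: "'b set \<Rightarrow> ('k::field, 'b \<Rightarrow>\<^sub>0 'k) module"
  where "free_module B =
    \<lparr>carrier = {f. Poly_Mapping.keys f \<subseteq> B}, monoid.mult = undefined, one = undefined,
     ring.zero = 0, add = (+), module.smult = (\<lambda>c. Poly_Mapping.map ((*) c))\<rparr>"

text \<open>The linear extension of \<open>f\<close> from the basis to the free module.\<close>

definition free_lift ::
    "('k::field, 'v, 'm) module_scheme \<Rightarrow> ('b \<Rightarrow> 'v) \<Rightarrow> ('b \<Rightarrow>\<^sub>0 'k) \<Rightarrow> 'v"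
  where "free_lift N f p = (\<Oplus>\<^bsub>N\<^esub> b\<in>Poly_Mapping.keys p. Poly_Mapping.lookup p b \<odot>\<^bsub>N\<^esub> f b)"

definition direct_sum_module ::
    "'i set \<Rightarrow> ('i \<Rightarrow> ('k, 'v, 'm) module_scheme) \<Rightarrow> ('k, 'i \<Rightarrow> 'v) module"
  where "direct_sum_module I M =
    \<lparr>carrier = {f \<in> (\<Pi>\<^sub>E i\<in>I. carrier (M i)). finite {i \<in> I. f i \<noteq> \<zero>\<^bsub>M i\<^esub>}},
     monoid.mult = undefined, one = undefined,
     ring.zero = (\<lambda>i\<in>I. \<zero>\<^bsub>M i\<^esub>),
     add = (\<lambda>f g. \<lambda>i\<in>I. f i \<oplus>\<^bsub>M i\<^esub> g i),
     module.smult = (\<lambda>c f. \<lambda>i\<in>I. c \<odot>\<^bsub>M i\<^esub> f i)\<rparr>"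

definition direct_sum2_module ::
    "('k, 'v, 'm) module_scheme \<Rightarrow> ('k, 'w, 'n) module_scheme \<Rightarrow> ('k, 'v \<times> 'w) module"
    (infixr \<open>\<oplus>\<^sub>k\<close> 60)
  where "M \<oplus>\<^sub>k N =
    \<lparr>carrier = carrier M \<times> carrier N, monoid.mult = undefined, one = undefined,
     ring.zero = (\<zero>\<^bsub>M\<^esub>, \<zero>\<^bsub>N\<^esub>),
     add = (\<lambda>(x, y) (x', y'). (x \<oplus>\<^bsub>M\<^esub> x', y \<oplus>\<^bsub>N\<^esub> y')),
     module.smult = (\<lambda>c (x, y). (c \<odot>\<^bsub>M\<^esub> x, c \<odot>\<^bsub>N\<^esub> y))\<rparr>"

text \<open>The direct sum \<open>W\<^sup>(\<^sup>I\<^sup>)\<close>.\<close>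

definition copies :: "('k, 'v, 'm) module_scheme \<Rightarrow> 'x set \<Rightarrow> ('k, 'x \<Rightarrow> 'v) module"
  where "copies W I = direct_sum_module I (\<lambda>_. W)"


section \<open>Tensor and exterior powers\<close>

definition tuples :: "('k, 'v, 'm) module_scheme \<Rightarrow> nat \<Rightarrow> 'v list set"
  where "tuples M n = {xs. length xs = n \<and> set xs \<subseteq> carrier M}"

definition tensor_relations ::
    "('k::field, 'v, 'm) module_scheme \<Rightarrow> nat \<Rightarrow> ('v list \<Rightarrow>\<^sub>0 'k) set"
  where "tensor_relations M n =
    {Poly_Mapping.single (xs[i := x \<oplus>\<^bsub>M\<^esub> y]) 1
       - Poly_Mapping.single (xs[i := x]) 1 - Poly_Mapping.single (xs[i := y]) 1
     | xs i x y. xs \<in> tuples M n \<and> i < n \<and> x \<in> carrier M \<and> y \<in> carrier M}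
    \<union> {Poly_Mapping.single (xs[i := c \<odot>\<^bsub>M\<^esub> x]) 1 - Poly_Mapping.single (xs[i := x]) c
     | xs i c x. xs \<in> tuples M n \<and> i < n \<and> x \<in> carrier M}"

definition tensor_null ::
    "('k::field, 'v, 'm) module_scheme \<Rightarrow> nat \<Rightarrow> ('v list \<Rightarrow>\<^sub>0 'k) set"
  where "tensor_null M n = submodule_span (free_module (tuples M n)) (tensor_relations M n)"

definition tensor_power ::
    "('k::field, 'v, 'm) module_scheme \<Rightarrow> nat \<Rightarrow> ('k, ('v list \<Rightarrow>\<^sub>0 'k) set) module"
  where "tensor_power M n = quotient_module (free_module (tuples M n)) (tensor_null M n)"

definition pure_tensor ::
    "('k::field, 'v, 'm) module_scheme \<Rightarrow> 'v list \<Rightarrow> ('v list \<Rightarrow>\<^sub>0 'k) set"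
  where "pure_tensor M xs =
    tensor_null M (length xs) +>\<^bsub>free_module (tuples M (length xs))\<^esub> Poly_Mapping.single xs 1"

text \<open>
  The linear map on a tensor power induced by a multilinear map \<open>f\<close> with values in \<open>N\<close>: its
  linear extension to the free module is constant on each coset, and the induced map takes
  this constant value.
\<close>

definition tensor_lift ::
    "('k::field, 'w, 'n) module_scheme \<Rightarrow> ('v list \<Rightarrow> 'w) \<Rightarrow> ('v list \<Rightarrow>\<^sub>0 'k) set \<Rightarrow> 'w"
  where "tensor_lift N f u = the_elem (free_lift N f ` u)"

definition exterior_power ::
    "('k::field, 'v, 'm) module_scheme \<Rightarrow> nat \<Rightarrow> ('k, ('v list \<Rightarrow>\<^sub>0 'k) set set) module"
  where "exterior_power V n =
    quotient_module (tensor_power V n)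
      (submodule_span (tensor_power V n)
        {pure_tensor V xs | xs. xs \<in> tuples V n \<and> \<not> distinct xs})"

text \<open>Exterior powers with integer exponent; those with negative exponent are zero.\<close>

definition exterior_power_int ::
    "('k::field, 'v, 'm) module_scheme \<Rightarrow> int \<Rightarrow> ('k, ('v list \<Rightarrow>\<^sub>0 'k) set set) module"
  where "exterior_power_int V j =
    (if j < 0 then (exterior_power V 0)\<lparr>carrier := {\<zero>\<^bsub>exterior_power V 0\<^esub>}\<rparr>
     else exterior_power V (nat j))"

text \<open>The standard vector space of dimension \<open>m\<close>.\<close>

definition std_space :: "nat \<Rightarrow> ('k::field, nat \<Rightarrow>\<^sub>0 'k) module"
  where "std_space m = free_module {..<m}"


section \<open>Homology of a chain complex\<close>

text \<open>The differentials are indexed by their target, \<open>d n : C (n + 1) \<rightarrow> C n\<close>.\<close>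

definition cycles ::
    "(nat \<Rightarrow> ('k, 'v, 'm) module_scheme) \<Rightarrow> (nat \<Rightarrow> 'v \<Rightarrow> 'v) \<Rightarrow> nat \<Rightarrow> 'v set"
  where "cycles C d n =
    (case n of 0 \<Rightarrow> carrier (C 0)
     | Suc m \<Rightarrow> {x \<in> carrier (C (Suc m)). d m x = \<zero>\<^bsub>C m\<^esub>})"

definition boundaries ::
    "(nat \<Rightarrow> ('k, 'v, 'm) module_scheme) \<Rightarrow> (nat \<Rightarrow> 'v \<Rightarrow> 'v) \<Rightarrow> nat \<Rightarrow> 'v set"
  where "boundaries C d n = d n ` carrier (C (Suc n))"

definition homology ::
    "(nat \<Rightarrow> ('k, 'v, 'm) module_scheme) \<Rightarrow> (nat \<Rightarrow> 'v \<Rightarrow> 'v) \<Rightarrow> nat \<Rightarrow> ('k, 'v set) module"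
  where "homology C d n =
    quotient_module ((C n)\<lparr>carrier := cycles C d n\<rparr>) (boundaries C d n)"


section \<open>Hochschild and cyclic homology of an algebra\<close>

type_synonym ('k, 'a) tensor = "('a list \<Rightarrow>\<^sub>0 'k) set"

definition hochschild_chains ::
    "('k::field, 'a, 'm) module_scheme \<Rightarrow> nat \<Rightarrow> ('k, ('k, 'a) tensor) module"
  where "hochschild_chains A n = tensor_power A (Suc n)"

text \<open>
  The faces of \<open>[a\<^sub>0, \<dots>, a\<^sub>n]\<close>: for \<open>i < n\<close> the entries \<open>a\<^sub>i\<close> and \<open>a\<^sub>i\<^sub>+\<^sub>1\<close> are replaced by
  their product, and the last face is \<open>[a\<^sub>n a\<^sub>0, a\<^sub>1, \<dots>, a\<^sub>n\<^sub>-\<^sub>1]\<close>.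
\<close>

definition face :: "('k, 'a, 'm) module_scheme \<Rightarrow> nat \<Rightarrow> 'a list \<Rightarrow> 'a list"
  where "face A i xs =
    (if Suc i < length xs
     then take i xs @ (xs ! i \<otimes>\<^bsub>A\<^esub> xs ! Suc i) # drop (i + 2) xs
     else (last xs \<otimes>\<^bsub>A\<^esub> hd xs) # butlast (tl xs))"

text \<open>
  The Hochschild boundary \<open>b\<close> and the bar boundary \<open>b'\<close> (which omits the last face), as maps
  from \<open>A\<^sup>\<otimes>\<^sup>(\<^sup>n\<^sup>+\<^sup>2\<^sup>)\<close> to \<open>A\<^sup>\<otimes>\<^sup>(\<^sup>n\<^sup>+\<^sup>1\<^sup>)\<close>.
\<close>

definition hochschild_b ::
    "('k::field, 'a, 'm) module_scheme \<Rightarrow> nat \<Rightarrow> ('k, 'a) tensor \<Rightarrow> ('k, 'a) tensor"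
  where "hochschild_b A n =
    tensor_lift (hochschild_chains A n)
      (\<lambda>xs. \<Oplus>\<^bsub>hochschild_chains A n\<^esub> i\<in>{..Suc n}.
         (- 1) ^ i \<odot>\<^bsub>hochschild_chains A n\<^esub> pure_tensor A (face A i xs))"

definition bar_b ::
    "('k::field, 'a, 'm) module_scheme \<Rightarrow> nat \<Rightarrow> ('k, 'a) tensor \<Rightarrow> ('k, 'a) tensor"
  where "bar_b A n =
    tensor_lift (hochschild_chains A n)
      (\<lambda>xs. \<Oplus>\<^bsub>hochschild_chains A n\<^esub> i\<in>{..n}.
         (- 1) ^ i \<odot>\<^bsub>hochschild_chains A n\<^esub> pure_tensor A (face A i xs))"

definition HH :: "('k::field, 'a, 'm) module_scheme \<Rightarrow> nat \<Rightarrow> ('k, ('k, 'a) tensor set) module"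
  where "HH A = homology (hochschild_chains A) (hochschild_b A)"

text \<open>The signed cyclic operator \<open>t\<close> and the norm \<open>N = 1 + t + \<dots> + t\<^sup>n\<close> on \<open>A\<^sup>\<otimes>\<^sup>(\<^sup>n\<^sup>+\<^sup>1\<^sup>)\<close>.\<close>

definition cyclic_t ::
    "('k::field, 'a, 'm) module_scheme \<Rightarrow> nat \<Rightarrow> ('k, 'a) tensor \<Rightarrow> ('k, 'a) tensor"
  where "cyclic_t A n =
    tensor_lift (hochschild_chains A n)
      (\<lambda>xs. (- 1) ^ n \<odot>\<^bsub>hochschild_chains A n\<^esub> pure_tensor A (last xs # butlast xs))"

definition cyclic_N ::
    "('k::field, 'a, 'm) module_scheme \<Rightarrow> nat \<Rightarrow> ('k, 'a) tensor \<Rightarrow> ('k, 'a) tensor"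
  where "cyclic_N A n u = (\<Oplus>\<^bsub>hochschild_chains A n\<^esub> i\<in>{..n}. (cyclic_t A n ^^ i) u)"

text \<open>
  Tsygan's cyclic bicomplex \<open>CC\<close>, with \<open>CC\<^sub>p\<^sub>q = A\<^sup>\<otimes>\<^sup>(\<^sup>q\<^sup>+\<^sup>1\<^sup>)\<close> for \<open>p, q \<ge> 0\<close>.  The columns with \<open>p\<close>
  even carry the differential \<open>b\<close>, those with \<open>p\<close> odd carry \<open>- b'\<close>; the horizontal
  differential is \<open>1 - t\<close> when it starts in an odd column and \<open>N\<close> when it starts in an even
  one.  As above, differentials are indexed by their target:
  \<open>CC_vertical A p q : CC\<^sub>p\<^sub>,\<^sub>q\<^sub>+\<^sub>1 \<rightarrow> CC\<^sub>p\<^sub>q\<close> and \<open>CC_horizontal A p q : CC\<^sub>p\<^sub>+\<^sub>1\<^sub>,\<^sub>q \<rightarrow> CC\<^sub>p\<^sub>q\<close>.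
\<close>

definition CC_vertical ::
    "('k::field, 'a, 'm) module_scheme \<Rightarrow> nat \<Rightarrow> nat \<Rightarrow> ('k, 'a) tensor \<Rightarrow> ('k, 'a) tensor"
  where "CC_vertical A p q u =
    (if even p then hochschild_b A q u else \<ominus>\<^bsub>hochschild_chains A q\<^esub> bar_b A q u)"

definition CC_horizontal ::
    "('k::field, 'a, 'm) module_scheme \<Rightarrow> nat \<Rightarrow> nat \<Rightarrow> ('k, 'a) tensor \<Rightarrow> ('k, 'a) tensor"
  where "CC_horizontal A p q u =
    (if even p then u \<ominus>\<^bsub>hochschild_chains A q\<^esub> cyclic_t A q u else cyclic_N A q u)"

text \<open>The total complex; an \<open>n\<close>-chain has components \<open>c p \<in> CC\<^sub>p\<^sub>,\<^sub>n\<^sub>-\<^sub>p\<close> for \<open>p \<le> n\<close>.\<close>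

definition tot_chains ::
    "('k::field, 'a, 'm) module_scheme \<Rightarrow> nat \<Rightarrow> ('k, nat \<Rightarrow> ('k, 'a) tensor) module"
  where "tot_chains A n = direct_sum_module {..n} (\<lambda>p. hochschild_chains A (n - p))"

definition tot_boundary ::
    "('k::field, 'a, 'm) module_scheme \<Rightarrow> nat \<Rightarrow>
       (nat \<Rightarrow> ('k, 'a) tensor) \<Rightarrow> (nat \<Rightarrow> ('k, 'a) tensor)"
  where "tot_boundary A n c =
    (\<lambda>p\<in>{..n}. CC_vertical A p (n - p) (c p)
       \<oplus>\<^bsub>hochschild_chains A (n - p)\<^esub> CC_horizontal A p (n - p) (c (Suc p)))"

definition HC ::
    "('k::field, 'a, 'm) module_scheme \<Rightarrow> nat \<Rightarrow> ('k, (nat \<Rightarrow> ('k, 'a) tensor) set) module"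
  where "HC A = homology (tot_chains A) (tot_boundary A)"


section \<open>Twisted group algebras\<close>

text \<open>Normalized 2-cocycles with values in the units of \<open>'k\<close>, for the trivial action.\<close>

definition normalized_2_cocycle :: "('g::ab_group_add \<Rightarrow> 'g \<Rightarrow> 'k::field) \<Rightarrow> bool"
  where "normalized_2_cocycle \<omega> \<longleftrightarrow>
    (\<forall>x y. \<omega> x y \<noteq> 0) \<and>
    (\<forall>x y z. \<omega> y z * \<omega> x (y + z) = \<omega> x y * \<omega> (x + y) z) \<and>
    (\<forall>g. \<omega> 0 g = 1 \<and> \<omega> g 0 = 1)"

text \<open>The basis element \<open>e\<^sub>g\<close> is \<open>Poly_Mapping.single g 1\<close>.\<close>

definition twisted_group_algebra ::
    "('g::ab_group_add \<Rightarrow> 'g \<Rightarrow> 'k::field) \<Rightarrow> ('k, 'g \<Rightarrow>\<^sub>0 'k) module"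
  where "twisted_group_algebra \<omega> =
    \<lparr>carrier = UNIV,
     monoid.mult = (\<lambda>a b. \<Sum>x\<in>Poly_Mapping.keys a. \<Sum>y\<in>Poly_Mapping.keys b.
               Poly_Mapping.single (x + y) (Poly_Mapping.lookup a x * Poly_Mapping.lookup b y * \<omega> x y)),
     one = Poly_Mapping.single 0 1,
     ring.zero = 0, add = (+), module.smult = (\<lambda>c. Poly_Mapping.map ((*) c))\<rparr>"

definition commutation_factor :: "('g \<Rightarrow> 'g \<Rightarrow> 'k::field) \<Rightarrow> 'g \<Rightarrow> 'g \<Rightarrow> 'k"
  where "commutation_factor \<omega> g x = \<omega> g x * inverse (\<omega> x g)"

definition X_lambda :: "('g \<Rightarrow> 'g \<Rightarrow> 'k::field) \<Rightarrow> 'g set"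
  where "X_lambda \<omega> = {x. \<forall>g. commutation_factor \<omega> g x = 1}"

end

theory Submission
  imports Defs
begin

text \<open>
  Write \<open>m\<close> for the rank of the lattice and \<open>\<Lambda>\<close> for the exterior algebra of the vector space with
  basis \<open>e\<^sub>0, \<dots>, e\<^bsub>m-1\<^esub>\<close>. A tensor \<open>e\<^bsub>g\<^sub>0\<^esub> \<otimes> \<dots> \<otimes> e\<^bsub>g\<^sub>n\<^esub>\<close> has a total degree \<open>x = g\<^sub>0 + \<dots> + g\<^sub>n\<close>,
  and all operators of the cyclic bicomplex preserve it. Divide each such tensor by the scalar
  that relates the product \<open>e\<^bsub>g\<^sub>0\<^esub> \<cdots> e\<^bsub>g\<^sub>n\<^esub>\<close> to \<open>e\<^sub>x\<close>. In the new basis the inner faces just merge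
  neighbours, and the cocycle survives only as the factor \<open>\<lambda>(g\<^sub>n, x)\<close> in the cyclic operator,
  hence in the last face (\<open>cocyc_face\<close>, \<open>cocyc_rotate\<close>). The first entry is determined by the
  others and \<open>x\<close>; forgetting it turns the part of total degree \<open>x\<close> of the Hochschild complex into
  the bar complex of the lattice with coefficients in the character \<open>\<lambda>(-g, x)\<close> (\<open>aug_hoch\<close>).

  The homology of that bar complex is computed by comparing the bar resolution with the Koszul
  complex of the operators \<open>t\<^sub>i - 1\<close>. Both are contractible by explicit formulas: for the Koszul
  complex, integrate the coordinates one after the other (\<open>koszul_contraction\<close>); for the bar
  resolution, insert a zero. These contractions define the comparison maps and the homotopy
  recursively. After passing to a character \<open>\<psi>\<close>, the Koszul complex becomes \<open>\<Lambda>\<close> with the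
  differential \<open>\<Sum>\<^sub>i (\<psi>(t\<^sub>i) - 1) \<iota>\<^sub>i\<close>. It vanishes if \<open>\<psi>\<close> is trivial, and is contractible
  otherwise. So total degrees outside \<open>X\<^sub>\<lambda>\<close> contribute nothing, and every \<open>x\<close> in \<open>X\<^sub>\<lambda>\<close> contributes
  one copy of \<open>\<Lambda>\<close>, which is detected by the map \<open>hkr\<close> sending \<open>(g\<^sub>0, \<dots>, g\<^sub>n)\<close> to
  \<open>g\<^sub>1 \<and> \<dots> \<and> g\<^sub>n / n!\<close>: on cycles it is surjective, and a cycle that it kills is a boundary, even
  of a chain that it kills (\<open>hkr_section\<close>, \<open>hkr_kernel\<close>).

  For cyclic homology, complete \<open>hkr\<close>, on the even columns of the bicomplex, by the map \<open>hkr_d\<close>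
  sending \<open>(g\<^sub>0, \<dots>, g\<^sub>n)\<close> to \<open>g\<^sub>0 \<and> \<dots> \<and> g\<^sub>n / (n + 1)!\<close> on the odd columns. Together they map the
  total complex to the complex of families \<open>(y\<^sub>i)\<close> with \<open>y\<^sub>i \<in> \<Lambda>\<^bsup>n-2i\<^esup>\<close>, in which the differential
  is \<open>y\<^sub>i \<mapsto> x \<and> y\<^sub>i\<close> with a shift of \<open>i\<close> by one (\<open>tot_hkr_tot_d\<close>). The map is surjective and has
  an acyclic kernel (\<open>tot_hkr_surj\<close>, \<open>tot_hkr_kernel\<close>), so only the homology of the target
  matters. For \<open>x = 0\<close> the differential vanishes and the sum of all \<open>\<Lambda>\<^bsup>n-2i\<^esup>\<close> results. For \<open>x \<noteq> 0\<close>
  the product with \<open>x\<close> is exact, and only its cokernel on \<open>\<Lambda>\<^sup>n\<close> remains, which is the \<open>n\<close>-th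
  exterior power of the quotient by the line of \<open>x\<close>, a space of dimension \<open>m - 1\<close>.

  What is left is linear algebra: tensor powers, exterior powers, direct sums and homology groups
  are given coordinates with respect to explicit bases (\<open>tensor_coords\<close>, \<open>exterior_power_coords\<close>,
  \<open>direct_sum_coords\<close>, \<open>quotient_coords\<close>), and two spaces with coordinates in the same basis are
  isomorphic.
\<close>

section \<open>Linear maps between free vector spaces\<close>

abbreviation bas :: "'a \<Rightarrow> 'a \<Rightarrow>\<^sub>0 'k::field"
  where "bas a \<equiv> Poly_Mapping.single a 1"

definition pscale :: "'k::field \<Rightarrow> ('a \<Rightarrow>\<^sub>0 'k) \<Rightarrow> ('a \<Rightarrow>\<^sub>0 'k)"  (infixr \<open>*\<^sub>p\<close> 75)
  where "c *\<^sub>p p = Poly_Mapping.map ((*) c) p"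

lemma lookup_pscale [simp]: "Poly_Mapping.lookup (c *\<^sub>p p) a = c * Poly_Mapping.lookup p a"
  by (simp add: pscale_def Poly_Mapping.map.rep_eq when_def)

lemma pscale_simps [simp]:
  "c *\<^sub>p (0 :: 'a \<Rightarrow>\<^sub>0 'k::field) = 0" "0 *\<^sub>p p = 0" "1 *\<^sub>p p = p" "(- c) *\<^sub>p p = - (c *\<^sub>p p)"
  "c *\<^sub>p (- p) = - (c *\<^sub>p p)" "c *\<^sub>p (d *\<^sub>p p) = (c * d) *\<^sub>p p"
  by (rule poly_mapping_eqI; simp)+

lemma pscale_add_right: "c *\<^sub>p (p + q) = c *\<^sub>p p + c *\<^sub>p q"
  by (rule poly_mapping_eqI) (simp add: lookup_add algebra_simps)

lemma pscale_add_left: "(c + d) *\<^sub>p p = c *\<^sub>p p + d *\<^sub>p p"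
  by (rule poly_mapping_eqI) (simp add: lookup_add algebra_simps)

lemma pscale_diff_right: "c *\<^sub>p (p - q) = c *\<^sub>p p - c *\<^sub>p q"
  by (rule poly_mapping_eqI) (simp add: lookup_minus algebra_simps)

lemma pscale_diff_left: "(c - d) *\<^sub>p p = c *\<^sub>p p - d *\<^sub>p p"
  by (rule poly_mapping_eqI) (simp add: lookup_minus algebra_simps)

lemma pscale_sum_right: "c *\<^sub>p sum f A = (\<Sum>a\<in>A. c *\<^sub>p f a)"
  by (induction A rule: infinite_finite_induct) (simp_all add: pscale_add_right)

lemmas pscale_distribs = pscale_add_right pscale_add_left pscale_diff_right pscale_diff_left

lemma pscale_single [simp]: "c *\<^sub>p Poly_Mapping.single a d = Poly_Mapping.single a (c * d)"
  by (rule poly_mapping_eqI) (simp add: lookup_single when_def)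

lemma single_as_pscale: "Poly_Mapping.single a c = c *\<^sub>p bas a"
  by simp

lemma poly_mapping_decomp:
  "(p :: 'a \<Rightarrow>\<^sub>0 'k::field) = (\<Sum>a\<in>Poly_Mapping.keys p. Poly_Mapping.lookup p a *\<^sub>p bas a)"
proof (rule poly_mapping_eqI)
  fix b
  show "Poly_Mapping.lookup p b
    = Poly_Mapping.lookup (\<Sum>a\<in>Poly_Mapping.keys p. Poly_Mapping.lookup p a *\<^sub>p bas a) b"
    by (cases "b \<in> Poly_Mapping.keys p")
      (simp_all add: lookup_sum lookup_single when_def in_keys_iff)
qed

lemma eq_uminus_imp_0: "(p :: 'a \<Rightarrow>\<^sub>0 'k::field_char_0) = - p \<Longrightarrow> p = 0"
proof (rule poly_mapping_eqI)
  fix a assume "p = - p"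
  then have "Poly_Mapping.lookup p a = - Poly_Mapping.lookup p a" by (metis lookup_uminus)
  then show "Poly_Mapping.lookup p a = Poly_Mapping.lookup 0 a" by (simp add: eq_neg_iff_add_eq_0)
qed

definition klin :: "(('a \<Rightarrow>\<^sub>0 'k::field) \<Rightarrow> ('b \<Rightarrow>\<^sub>0 'k)) \<Rightarrow> bool"
  where "klin f \<longleftrightarrow> (\<forall>x y. f (x + y) = f x + f y) \<and> (\<forall>c x. f (c *\<^sub>p x) = c *\<^sub>p f x)"

lemma klinI:
  "(\<And>x y. f (x + y) = f x + f y) \<Longrightarrow> (\<And>c x. f (c *\<^sub>p x) = c *\<^sub>p f x) \<Longrightarrow> klin f"
  by (simp add: klin_def)

lemma klin_add: "klin f \<Longrightarrow> f (x + y) = f x + f y"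
  and klin_scale: "klin f \<Longrightarrow> f (c *\<^sub>p x) = c *\<^sub>p f x"
  by (simp_all add: klin_def)

lemma klin_zero: "klin f \<Longrightarrow> f 0 = 0"
  using klin_scale[of f 0 0] by simp

lemma klin_minus: "klin f \<Longrightarrow> f (- x) = - f x"
  using klin_scale[of f "-1" x] by simp

lemma klin_diff: "klin f \<Longrightarrow> f (x - y) = f x - f y"
  using klin_add[of f x "- y"] klin_minus[of f y] by simp

lemma klin_sum: "klin f \<Longrightarrow> f (sum g A) = (\<Sum>a\<in>A. f (g a))"
  by (induction A rule: infinite_finite_induct) (simp_all add: klin_zero klin_add)

lemmas klin_simps = klin_add klin_scale klin_zero klin_minus klin_diff klin_sum

named_theorems klin_intros

lemma klin_basic [klin_intros]:
  "klin (\<lambda>x. x)" "klin (\<lambda>x. 0)"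
  "klin f \<Longrightarrow> klin g \<Longrightarrow> klin (\<lambda>x. f x + g x)"
  "klin f \<Longrightarrow> klin g \<Longrightarrow> klin (\<lambda>x. f x - g x)"
  "klin f \<Longrightarrow> klin (\<lambda>x. - f x)"
  "klin f \<Longrightarrow> klin (\<lambda>x. c *\<^sub>p f x)"
  by (simp_all add: klin_def pscale_distribs mult.commute)

lemma klin_sumI [klin_intros]: "(\<And>a. a \<in> A \<Longrightarrow> klin (f a)) \<Longrightarrow> klin (\<lambda>x. \<Sum>a\<in>A. f a x)"
  by (induction A rule: infinite_finite_induct) (simp_all add: klin_basic)

lemma klin_if [klin_intros]: "klin f \<Longrightarrow> klin g \<Longrightarrow> klin (\<lambda>x. if b then f x else g x)"
  by (cases b) simp_all

lemma klin_comp: "klin f \<Longrightarrow> klin g \<Longrightarrow> klin (\<lambda>x. f (g x))"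
  by (simp add: klin_def)

lemma klin_funpow:
  fixes f :: "('a \<Rightarrow>\<^sub>0 'k::field) \<Rightarrow> ('a \<Rightarrow>\<^sub>0 'k)"
  shows "klin f \<Longrightarrow> klin (f ^^ n)"
  by (induction n) (simp_all add: klin_def)

lemma klin_eqI:
  assumes "klin f" "klin g" "\<And>a. a \<in> Poly_Mapping.keys p \<Longrightarrow> f (bas a) = g (bas a)"
  shows "f p = g p"
proof -
  let ?q = "\<Sum>a\<in>Poly_Mapping.keys p. Poly_Mapping.lookup p a *\<^sub>p bas a"
  have "f ?q = g ?q"
    using assms(3) by (simp only: klin_sum[OF assms(1)] klin_sum[OF assms(2)]
        klin_scale[OF assms(1)] klin_scale[OF assms(2)] cong: sum.cong)
  then show ?thesis using poly_mapping_decomp[of p] by metis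
qed

definition ext :: "('a \<Rightarrow> 'b \<Rightarrow>\<^sub>0 'k::field) \<Rightarrow> ('a \<Rightarrow>\<^sub>0 'k) \<Rightarrow> ('b \<Rightarrow>\<^sub>0 'k)"
  where "ext f p = (\<Sum>a\<in>Poly_Mapping.keys p. Poly_Mapping.lookup p a *\<^sub>p f a)"

lemma ext_superset:
  assumes "finite A" "Poly_Mapping.keys p \<subseteq> A"
  shows "ext f p = (\<Sum>a\<in>A. Poly_Mapping.lookup p a *\<^sub>p f a)"
  unfolding ext_def by (rule sum.mono_neutral_left) (use assms in \<open>auto simp: in_keys_iff\<close>)

lemma klin_ext [klin_intros]:
  fixes f :: "'a \<Rightarrow> 'b \<Rightarrow>\<^sub>0 'k::field"
  shows "klin (ext f)"
proof (rule klinI)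
  fix x y :: "'a \<Rightarrow>\<^sub>0 'k"
  let ?A = "Poly_Mapping.keys x \<union> Poly_Mapping.keys y"
  have "Poly_Mapping.keys (x + y) \<subseteq> ?A" by (rule Poly_Mapping.keys_add)
  then show "ext f (x + y) = ext f x + ext f y"
    by (simp add: ext_superset[of ?A] lookup_add pscale_distribs sum.distrib)
next
  fix c and x :: "'a \<Rightarrow>\<^sub>0 'k"
  have "Poly_Mapping.keys (c *\<^sub>p x) \<subseteq> Poly_Mapping.keys x" by (auto simp: in_keys_iff)
  then show "ext f (c *\<^sub>p x) = c *\<^sub>p ext f x"
    by (simp add: ext_superset[of "Poly_Mapping.keys x"] pscale_sum_right)
qed

lemmas ext_simps [simp] = klin_simps[OF klin_ext]

lemma klin_ext_comp [klin_intros]: "klin g \<Longrightarrow> klin (\<lambda>x. ext f (g x))"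
  by (rule klin_comp[OF klin_ext])

lemma ext_bas [simp]: "ext f (bas a) = f a"
  by (simp add: ext_def)

lemma ext_single [simp]: "ext f (Poly_Mapping.single a c) = c *\<^sub>p f a"
  by (subst single_as_pscale) (simp only: ext_simps ext_bas)

lemma ext_eqI:
  assumes "klin g" "\<And>a. a \<in> Poly_Mapping.keys p \<Longrightarrow> f a = g (bas a)"
  shows "ext f p = g p"
  by (rule klin_eqI) (use assms in \<open>auto intro: klin_ext\<close>)

lemma ext_ext: "ext f (ext g p) = ext (\<lambda>a. ext f (g a)) p"
  by (rule klin_eqI) (auto intro!: klin_intros)

definition fsupp :: "'a set \<Rightarrow> ('a \<Rightarrow>\<^sub>0 'k::field) set"
  where "fsupp S = {p. Poly_Mapping.keys p \<subseteq> S}"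

lemma fsupp_simps [simp]:
  "0 \<in> fsupp S" "p \<in> fsupp S \<Longrightarrow> q \<in> fsupp S \<Longrightarrow> p + q \<in> fsupp S"
  "p \<in> fsupp S \<Longrightarrow> - p \<in> fsupp S"
  "p \<in> fsupp S \<Longrightarrow> q \<in> fsupp S \<Longrightarrow> p - q \<in> fsupp S" "p \<in> fsupp S \<Longrightarrow> c *\<^sub>p p \<in> fsupp S"
proof -
  show "p + q \<in> fsupp S" if "p \<in> fsupp S" "q \<in> fsupp S"
    using that Poly_Mapping.keys_add[of p q] unfolding fsupp_def by blast
  show "p - q \<in> fsupp S" if "p \<in> fsupp S" "q \<in> fsupp S"
    using that keys_diff[of p q] unfolding fsupp_def by blast
qed (auto simp: fsupp_def in_keys_iff subset_iff)

lemma fsupp_single [simp]: "a \<in> S \<Longrightarrow> Poly_Mapping.single a c \<in> fsupp S"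
  by (auto simp: fsupp_def in_keys_iff lookup_single when_def split: if_splits)

lemma fsupp_sum: "(\<And>a. a \<in> A \<Longrightarrow> f a \<in> fsupp S) \<Longrightarrow> sum f A \<in> fsupp S"
  by (induction A rule: infinite_finite_induct) auto

lemma fsupp_UNIV [simp]: "p \<in> fsupp UNIV"
  by (simp add: fsupp_def)

lemma fsuppD: "p \<in> fsupp S \<Longrightarrow> a \<in> Poly_Mapping.keys p \<Longrightarrow> a \<in> S"
  by (auto simp: fsupp_def)

lemma fsupp_mono: "p \<in> fsupp S \<Longrightarrow> S \<subseteq> T \<Longrightarrow> p \<in> fsupp T"
  by (auto simp: fsupp_def)

lemma ext_fsupp: "p \<in> fsupp S \<Longrightarrow> (\<And>a. a \<in> S \<Longrightarrow> f a \<in> fsupp T) \<Longrightarrow> ext f p \<in> fsupp T"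
  unfolding ext_def by (intro fsupp_sum fsupp_simps) (auto simp: fsupp_def)

lemma klin_fsupp:
  "klin f \<Longrightarrow> p \<in> fsupp S \<Longrightarrow> (\<And>a. a \<in> S \<Longrightarrow> f (bas a) \<in> fsupp T) \<Longrightarrow> f p \<in> fsupp T"
  using ext_fsupp[of p S "\<lambda>a. f (bas a)" T] ext_eqI[of f p "\<lambda>a. f (bas a)"] by simp

lemma klin_eq_on:
  assumes "klin f" "klin g" "p \<in> fsupp S" "\<And>a. a \<in> S \<Longrightarrow> f (bas a) = g (bas a)"
  shows "f p = g p"
  by (rule klin_eqI) (use assms in \<open>auto dest: fsuppD\<close>)


section \<open>The exterior algebra on basis vectors indexed by natural numbers\<close>

text \<open>
  The basis vector indexed by a set \<open>S = {i\<^sub>1 < \<dots> < i\<^sub>n}\<close> stands for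
  \<open>e\<^bsub>i\<^sub>1\<^esub> \<and> \<dots> \<and> e\<^bsub>i\<^sub>n\<^esub>\<close>; hence \<open>e\<^sub>i\<close> has to pass the elements of \<open>S\<close> below \<open>i\<close>.
\<close>

definition sign_below :: "nat \<Rightarrow> nat set \<Rightarrow> 'k::field"
  where "sign_below i S = (- 1) ^ card {j \<in> S. j < i}"

definition wedge1 :: "nat \<Rightarrow> (nat set \<Rightarrow>\<^sub>0 'k::field) \<Rightarrow> (nat set \<Rightarrow>\<^sub>0 'k)"
  where "wedge1 i = ext (\<lambda>S. if i \<in> S then 0 else sign_below i S *\<^sub>p bas (insert i S))"

definition contr :: "nat \<Rightarrow> (nat set \<Rightarrow>\<^sub>0 'k::field) \<Rightarrow> (nat set \<Rightarrow>\<^sub>0 'k)"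
  where "contr i = ext (\<lambda>S. if i \<in> S then sign_below i S *\<^sub>p bas (S - {i}) else 0)"

lemma klin_wedge1 [klin_intros]: "klin (wedge1 i)"
  and klin_contr [klin_intros]: "klin (contr i)"
  by (simp_all add: wedge1_def contr_def klin_ext)

lemmas [klin_intros] = klin_comp[OF klin_wedge1] klin_comp[OF klin_contr]

lemmas wedge1_simps [simp] = klin_simps[OF klin_wedge1] klin_simps[OF klin_contr]

lemma wedge1_bas:
    "wedge1 i (Poly_Mapping.single S c)
      = (if i \<in> S then 0 else Poly_Mapping.single (insert i S) (sign_below i S * c))"
  and contr_bas:
    "contr i (Poly_Mapping.single S c)
      = (if i \<in> S then Poly_Mapping.single (S - {i}) (sign_below i S * c) else 0)"
  by (simp_all add: wedge1_def contr_def mult.commute)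

lemma sign_below_sq [simp]: "sign_below i S * sign_below i S = (1 :: 'k::field)"
  by (simp add: sign_below_def flip: power_mult_distrib)

lemma sign_below_self [simp]:
  "sign_below i (insert i S) = (sign_below i S :: 'k::field)"
  "sign_below i (S - {i}) = (sign_below i S :: 'k::field)"
  by (auto simp: sign_below_def intro!: arg_cong[where f = "\<lambda>A. (- 1) ^ card A"])

lemma sign_below_insert:
  assumes "j \<notin> S" "i \<noteq> j"
  shows "sign_below i (insert j S) = (if j < i then - sign_below i S else sign_below i S :: 'k::field)"
proof (cases "j < i")
  case True
  then have "{l \<in> insert j S. l < i} = insert j {l \<in> S. l < i}" by auto
  then show ?thesis using assms True by (simp add: sign_below_def)
next
  case False
  then have "{l \<in> insert j S. l < i} = {l \<in> S. l < i}" by auto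
  then show ?thesis using False by (simp add: sign_below_def)
qed

lemma sign_below_remove:
  assumes "j \<in> S" "i \<noteq> j"
  shows "sign_below i (S - {j}) = (if j < i then - sign_below i S else sign_below i S :: 'k::field)"
  using sign_below_insert[of j "S - {j}" i, where 'k = 'k] assms by (auto simp: insert_absorb)

lemma wedge1_wedge1_self [simp]: "wedge1 i (wedge1 i p) = 0"
  by (rule klin_eqI[where p = p and g = "\<lambda>_. 0"]) (auto intro!: klin_intros simp: wedge1_bas)

lemma contr_contr_self [simp]: "contr i (contr i p) = 0"
  by (rule klin_eqI[where p = p and g = "\<lambda>_. 0"]) (auto intro!: klin_intros simp: contr_bas)

lemma wedge1_anticomm: "i \<noteq> j \<Longrightarrow> wedge1 i (wedge1 j p) = - wedge1 j (wedge1 i p)"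
  by (rule klin_eqI[where p = p])
    (auto intro!: klin_intros simp: wedge1_bas sign_below_insert insert_commute algebra_simps single_uminus
      split: if_splits)

lemma contr_anticomm: "i \<noteq> j \<Longrightarrow> contr i (contr j p) = - contr j (contr i p)"
  by (rule klin_eqI[where p = p])
    (auto intro!: klin_intros simp: contr_bas sign_below_remove Diff_insert2[symmetric] insert_commute
      algebra_simps single_uminus split: if_splits)

lemma contr_wedge1_anticomm: "i \<noteq> j \<Longrightarrow> contr i (wedge1 j p) = - wedge1 j (contr i p)"
  by (rule klin_eqI[where p = p])
    (auto intro!: klin_intros
      simp: wedge1_bas contr_bas sign_below_remove sign_below_insert insert_Diff_if algebra_simps single_uminus
      split: if_splits)

lemma contr_wedge1_self: "contr i (wedge1 i p) = p - wedge1 i (contr i p)"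
  by (rule klin_eqI[where p = p])
    (auto intro!: klin_intros simp: wedge1_bas contr_bas insert_absorb)

lemma wedge1_anticomm': "wedge1 i (wedge1 j p) + wedge1 j (wedge1 i p) = 0"
  by (cases "i = j") (simp_all add: wedge1_anticomm[of i j])

lemma contr_anticomm': "contr i (contr j p) + contr j (contr i p) = 0"
  by (cases "i = j") (simp_all add: contr_anticomm[of i j])

text \<open>The degree-\<open>n\<close> part of the exterior algebra of the span of \<open>e\<^sub>0, \<dots>, e\<^bsub>m-1\<^esub>\<close>.\<close>

definition nsets :: "nat \<Rightarrow> nat \<Rightarrow> nat set set"
  where "nsets m n = {S. S \<subseteq> {..<m} \<and> card S = n}"

lemma nsets_finite: "S \<in> nsets m n \<Longrightarrow> finite S"
  by (auto simp: nsets_def intro: finite_subset)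

lemma wedge1_nsets: "i < m \<Longrightarrow> p \<in> fsupp (nsets m n) \<Longrightarrow> wedge1 i p \<in> fsupp (nsets m (Suc n))"
  by (erule klin_fsupp[OF klin_wedge1, of _ "nsets m n"])
    (auto simp: wedge1_bas nsets_def intro!: fsupp_single dest: finite_subset[OF _ finite_lessThan])

lemma contr_nsets: "p \<in> fsupp (nsets m (Suc n)) \<Longrightarrow> contr i p \<in> fsupp (nsets m n)"
  by (erule klin_fsupp[OF klin_contr, of _ "nsets m (Suc n)"])
    (auto simp: contr_bas nsets_def intro!: fsupp_single dest: finite_subset[OF _ finite_lessThan])

lemma contr_nsets_0: "p \<in> fsupp (nsets m 0) \<Longrightarrow> contr i p = 0"
  by (rule klin_eq_on[where g = "\<lambda>_. 0" and S = "nsets m 0"])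
    (auto intro!: klin_intros simp: contr_bas nsets_def dest: finite_subset[OF _ finite_lessThan])

lemma number_operator:
  assumes "p \<in> fsupp (nsets m n)"
  shows "(\<Sum>i<m. wedge1 i (contr i p)) = of_nat n *\<^sub>p (p :: nat set \<Rightarrow>\<^sub>0 'k::field)"
proof (rule klin_eq_on[OF _ _ assms])
  fix S assume "S \<in> nsets m n"
  then have S: "S \<subseteq> {..<m}" "card S = n" by (auto simp: nsets_def)
  have "(\<Sum>i<m. wedge1 i (contr i (bas S))) = (\<Sum>i<m. if i \<in> S then bas S else (0 :: nat set \<Rightarrow>\<^sub>0 'k))"
    by (rule sum.cong) (auto simp: contr_bas wedge1_bas insert_absorb)
  also have "\<dots> = (\<Sum>i\<in>S. bas S)"
    using S by (simp add: sum.If_cases Int_absorb1)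
  also have "\<dots> = of_nat n *\<^sub>p bas S"
    using S by (intro poly_mapping_eqI) (simp add: lookup_sum lookup_single when_def)
  finally show "(\<Sum>i<m. wedge1 i (contr i (bas S))) = of_nat n *\<^sub>p (bas S :: nat set \<Rightarrow>\<^sub>0 'k)" .
qed (auto intro!: klin_intros)


section \<open>The Koszul complex of a free abelian group\<close>

text \<open>
  The product of two bases is a basis of the tensor product, and \<open>act_fst A\<close> and \<open>act_snd B\<close> are
  the operators \<open>A \<otimes> 1\<close> and \<open>1 \<otimes> B\<close>. Here \<open>A\<close> is given by its values on basis vectors, and \<open>B\<close> as
  a linear map.
\<close>

definition act_fst :: "('a \<Rightarrow> 'a \<Rightarrow>\<^sub>0 'k::field) \<Rightarrow> ('a \<times> 'b \<Rightarrow>\<^sub>0 'k) \<Rightarrow> ('a \<times> 'b \<Rightarrow>\<^sub>0 'k)"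
  where "act_fst A = ext (\<lambda>(g, S). ext (\<lambda>h. bas (h, S)) (A g))"

definition act_snd :: "(('b \<Rightarrow>\<^sub>0 'k) \<Rightarrow> 'b \<Rightarrow>\<^sub>0 'k::field) \<Rightarrow> ('a \<times> 'b \<Rightarrow>\<^sub>0 'k) \<Rightarrow> ('a \<times> 'b \<Rightarrow>\<^sub>0 'k)"
  where "act_snd B = ext (\<lambda>(g, S). ext (\<lambda>U. bas (g, U)) (B (bas S)))"

lemma klin_act [klin_intros]: "klin (act_fst A)" "klin (act_snd B)"
  by (simp_all add: act_fst_def act_snd_def klin_ext)

lemmas [klin_intros] = klin_comp[OF klin_act(1)] klin_comp[OF klin_act(2)]

lemmas act_simps [simp] = klin_simps[OF klin_act(1)] klin_simps[OF klin_act(2)]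

lemma act_bas:
  "act_fst A (bas (g, S)) = ext (\<lambda>h. bas (h, S)) (A g)"
  "act_snd B (bas (g, S)) = ext (\<lambda>U. bas (g, U)) (B (bas S))"
  by (simp_all add: act_fst_def act_snd_def)

lemma act_fst_ext: "act_fst A (ext (\<lambda>h. bas (h, S)) p) = ext (\<lambda>h. bas (h, S)) (ext A p)"
  by (rule klin_eqI[where p = p]) (auto intro!: klin_intros simp: act_bas)

lemma act_snd_ext: "klin B \<Longrightarrow> act_snd B (ext (\<lambda>U. bas (g, U)) p) = ext (\<lambda>U. bas (g, U)) (B p)"
  by (rule klin_eqI[where p = p]) (auto intro!: klin_intros simp: act_bas)

lemma ext_swap: "ext (\<lambda>x. ext (f x) q) p = ext (\<lambda>y. ext (\<lambda>x. f x y) p) q"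
  unfolding ext_def by (subst pscale_sum_right, subst pscale_sum_right, subst sum.swap)
    (simp add: mult.commute)

lemma act_commute: "act_fst A (act_snd B p) = act_snd B (act_fst A p)"
  by (rule klin_eqI[where p = p])
    (auto intro!: klin_intros simp: act_fst_def act_snd_def ext_ext ext_swap[of _ _ "A _"])

lemma act_fst_act_fst: "act_fst A (act_fst B p) = act_fst (\<lambda>g. ext A (B g)) p"
  by (rule klin_eqI[where p = p]) (auto intro!: klin_intros simp: act_bas act_fst_ext case_prod_beta)

lemma act_snd_act_snd: "klin A \<Longrightarrow> act_snd A (act_snd B p) = act_snd (\<lambda>x. A (B x)) p"
  by (rule klin_eqI[where p = p]) (auto intro!: klin_intros simp: act_bas act_snd_ext)

lemma act_trivial [simp]:
  "act_fst (\<lambda>_. 0) p = 0" "act_fst bas p = p" "act_snd (\<lambda>_. 0) p = 0" "act_snd (\<lambda>x. x) p = p"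
proof -
  show "act_fst (\<lambda>_. 0) p = 0" "act_snd (\<lambda>_. 0) p = 0"
    by (rule klin_eqI[where p = p and g = "\<lambda>_. 0"]; auto intro!: klin_intros simp: act_bas)+
  show "act_fst bas p = p" "act_snd (\<lambda>x. x) p = p"
    by (rule klin_eqI[where p = p and g = "\<lambda>x. x"]; auto intro!: klin_intros simp: act_bas)+
qed

lemma act_linear:
  "act_fst (\<lambda>g. A g + B g) p = act_fst A p + act_fst B p"
  "act_fst (\<lambda>g. A g - B g) p = act_fst A p - act_fst B p"
  "act_snd (\<lambda>x. C x + D x) p = act_snd C p + act_snd D p"
  "act_snd (\<lambda>x. C x - D x) p = act_snd C p - act_snd D p"
  "act_snd (\<lambda>x. - C x) p = - act_snd C p"
  by (rule klin_eqI[where p = p]; auto intro!: klin_intros simp: act_bas)+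

primrec nmul :: "nat \<Rightarrow> 'g::ab_group_add \<Rightarrow> 'g"
  where "nmul 0 g = 0" | "nmul (Suc n) g = g + nmul n g"


text \<open>
  A free abelian group of rank \<open>m\<close>, presented by a basis \<open>t\<close> and the coordinates \<open>\<phi>\<close> with
  respect to it.
\<close>

locale lattice =
  fixes m :: nat and \<phi> :: "nat \<Rightarrow> 'g::ab_group_add \<Rightarrow> int" and t :: "nat \<Rightarrow> 'g"
  assumes coord_add [simp]: "\<phi> i (g + h) = \<phi> i g + \<phi> i h"
    and coord_basis: "i < m \<Longrightarrow> j < m \<Longrightarrow> \<phi> i (t j) = (if i = j then 1 else 0)"
    and coords_eq_0: "(\<And>i. i < m \<Longrightarrow> \<phi> i g = 0) \<Longrightarrow> g = 0"
begin

lemma coord_zero [simp]: "\<phi> i 0 = 0"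
  using coord_add[of i 0 0] by simp

lemma coord_minus [simp]: "\<phi> i (- g) = - \<phi> i g"
  using coord_add[of i g "- g"] by simp

lemma coord_diff [simp]: "\<phi> i (g - h) = \<phi> i g - \<phi> i h"
  using coord_add[of i g "- h"] by simp

lemma coord_nmul [simp]: "\<phi> i (nmul n g) = int n * \<phi> i g"
  by (induction n) (simp_all add: algebra_simps)

definition clear_coord :: "nat \<Rightarrow> 'g \<Rightarrow> 'g"
  where "clear_coord i g =
    (if \<phi> i g \<ge> 0 then g - nmul (nat (\<phi> i g)) (t i) else g + nmul (nat (- \<phi> i g)) (t i))"

text \<open>
  Multiplication by \<open>t\<^sub>i - 1\<close> on the group algebra, and its primitive: the geometric sum
  \<open>(t\<^sub>i\<^sup>a - 1) / (t\<^sub>i - 1)\<close> times \<open>clear_coord i g\<close>, where \<open>a\<close> is the \<open>i\<close>-th coordinate of \<open>g\<close>.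
\<close>

definition differ :: "nat \<Rightarrow> 'g \<Rightarrow> 'g \<Rightarrow>\<^sub>0 'k::field"
  where "differ i g = bas (g + t i) - bas g"

definition primit :: "nat \<Rightarrow> 'g \<Rightarrow> 'g \<Rightarrow>\<^sub>0 'k::field"
  where "primit i g =
    (if \<phi> i g \<ge> 0 then \<Sum>a<nat (\<phi> i g). bas (g - nmul (Suc a) (t i))
     else - (\<Sum>a<nat (- \<phi> i g). bas (g + nmul a (t i))))"

lemma telescope_up: "(\<Sum>a<n. bas (g - nmul a (t i)) - bas (g - nmul (Suc a) (t i)))
    = (bas g - bas (g - nmul n (t i)) :: 'g \<Rightarrow>\<^sub>0 'k::field)"
  by (induction n) simp_all

lemma telescope_down: "(\<Sum>a<n. bas (g + nmul (Suc a) (t i)) - bas (g + nmul a (t i)))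
    = (bas (g + nmul n (t i)) - bas g :: 'g \<Rightarrow>\<^sub>0 'k::field)"
  by (induction n) simp_all

lemma differ_primit: "ext (differ i) (primit i g) = (bas g - bas (clear_coord i g) :: 'g \<Rightarrow>\<^sub>0 'k::field)"
proof (cases "\<phi> i g \<ge> 0")
  case True
  have *: "g - (t i + x) + t i = g - x" for x by simp
  show ?thesis
    using True telescope_up[of g i "nat (\<phi> i g)", where 'k = 'k]
    by (simp add: primit_def clear_coord_def differ_def *)
next
  case False
  have *: "g + x + t i = g + (t i + x)" for x by (simp add: algebra_simps)
  show ?thesis
    using False telescope_down[of g i "nat (- \<phi> i g)", where 'k = 'k]
    by (simp add: primit_def clear_coord_def differ_def *)
qed

lemma primit_differ:
  assumes "i < m"
  shows "ext (primit i) (differ i g) = (bas g :: 'g \<Rightarrow>\<^sub>0 'k::field)"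
proof -
  consider "\<phi> i g \<ge> 0" | "\<phi> i g < 0" by linarith
  then have "primit i (g + t i) = (primit i g + bas g :: 'g \<Rightarrow>\<^sub>0 'k)"
  proof cases
    case 1
    then have "nat (\<phi> i g + 1) = Suc (nat (\<phi> i g))" by simp
    with 1 show ?thesis
      using assms
      by (simp add: primit_def coord_basis sum.lessThan_Suc_shift algebra_simps del: sum.lessThan_Suc)
  next
    case 2
    then obtain n where n: "nat (- \<phi> i g) = Suc n"
      by (metis neg_0_less_iff_less not0_implies_Suc zero_less_nat_eq less_not_refl)
    then have "nat (- 1 - \<phi> i g) = n" "nat (- \<phi> i g - 1) = n" and "\<phi> i g + 1 \<ge> 0 \<longrightarrow> n = 0" by linarith+
    moreover have "t i + (g + nmul a (t i)) = g + (t i + nmul a (t i))" for a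
      by (simp add: algebra_simps)
    ultimately show ?thesis
      using assms n 2
      by (auto simp: primit_def coord_basis sum.lessThan_Suc_shift add.assoc
          simp del: sum.lessThan_Suc)
  qed
  then show ?thesis by (simp add: differ_def)
qed

lemma clear_coord_coord: "i < m \<Longrightarrow> j < m \<Longrightarrow> \<phi> j (clear_coord i g) = (if i = j then 0 else \<phi> j g)"
  by (auto simp: clear_coord_def coord_basis)

lemma eq_if_coords: "(\<And>i. i < m \<Longrightarrow> \<phi> i g = \<phi> i h) \<Longrightarrow> g = h"
  using coords_eq_0[of "g - h"] by simp

lemma clear_coord_shift: "i < m \<Longrightarrow> clear_coord i (g + t i) = clear_coord i g"
  by (rule eq_if_coords) (auto simp: clear_coord_coord coord_basis)

lemma clear_coord_shift': "i < m \<Longrightarrow> j < m \<Longrightarrow> i \<noteq> j \<Longrightarrow> clear_coord i (g + t j) = clear_coord i g + t j"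
  by (rule eq_if_coords) (auto simp: clear_coord_coord coord_basis)

definition kdiff :: "nat \<Rightarrow> ('g \<times> nat set \<Rightarrow>\<^sub>0 'k::field) \<Rightarrow> ('g \<times> nat set \<Rightarrow>\<^sub>0 'k)"
  where "kdiff i p = act_fst (differ i) (act_snd (contr i) p)"

definition kprim :: "nat \<Rightarrow> ('g \<times> nat set \<Rightarrow>\<^sub>0 'k::field) \<Rightarrow> ('g \<times> nat set \<Rightarrow>\<^sub>0 'k)"
  where "kprim i p = act_fst (primit i) (act_snd (wedge1 i) p)"

definition kclear :: "nat \<Rightarrow> ('g \<times> nat set \<Rightarrow>\<^sub>0 'k::field) \<Rightarrow> ('g \<times> nat set \<Rightarrow>\<^sub>0 'k)"
  where "kclear i p = act_fst (\<lambda>g. bas (clear_coord i g)) (act_snd (\<lambda>y. contr i (wedge1 i y)) p)"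

lemma klin_k [klin_intros]: "klin (kdiff i)" "klin (kprim i)" "klin (kclear i)"
  unfolding kdiff_def[abs_def] kprim_def[abs_def] kclear_def[abs_def] by (intro klin_intros)+

lemmas [klin_intros] = klin_k[THEN klin_comp]
lemmas k_simps [simp] = klin_k[THEN klin_zero] klin_k[THEN klin_add] klin_k[THEN klin_minus]
  klin_k[THEN klin_diff]

lemma act_pair_comp:
  assumes "klin B"
  shows "act_fst A (act_snd B (act_fst A' (act_snd B' p)))
    = act_fst (\<lambda>g. ext A (A' g)) (act_snd (\<lambda>x. B (B' x)) p)"
  using assms by (simp add: act_fst_act_fst act_snd_act_snd flip: act_commute[of A'])

text \<open>
  In one coordinate the Koszul complex has two terms, and integration contracts it onto its
  homology, which is spanned by the group elements with coordinate \<open>0\<close> and no factor \<open>e\<^sub>i\<close>; the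
  projection to it is \<open>kclear i\<close>.
\<close>

lemma kdiff_kprim:
  fixes p :: "'g \<times> nat set \<Rightarrow>\<^sub>0 'k::field"
  assumes "i < m"
  shows "kdiff i (kprim i p) + kprim i (kdiff i p) = p - kclear i p"
proof -
  have 1: "kdiff i (kprim i p) = act_fst (\<lambda>g. bas g - bas (clear_coord i g))
      (act_snd (\<lambda>x. contr i (wedge1 i x)) p)"
    unfolding kdiff_def kprim_def by (simp add: act_pair_comp klin_contr differ_primit)
  have "(\<lambda>x :: nat set \<Rightarrow>\<^sub>0 'k. wedge1 i (contr i x)) = (\<lambda>x. x - contr i (wedge1 i x))"
    by (simp add: contr_wedge1_self)
  then have 2: "kprim i (kdiff i p) = p - act_snd (\<lambda>x. contr i (wedge1 i x)) p"
    unfolding kdiff_def kprim_def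
    by (simp only: act_pair_comp klin_wedge1 primit_differ[OF assms] act_trivial
        act_linear(4)[of "\<lambda>x. x"])
  show ?thesis unfolding 1 2 kclear_def by (simp add: act_linear)
qed

lemma primit_shift: "i < m \<Longrightarrow> j < m \<Longrightarrow> i \<noteq> j \<Longrightarrow>
    ext (primit j) (differ i g) = (ext (differ i) (primit j g) :: 'g \<Rightarrow>\<^sub>0 'k::field)"
  by (auto simp: primit_def differ_def coord_basis sum_subtractf algebra_simps sum_negf)

lemma clear_coord_nmul:
  assumes "i < m" "j < m" "i \<noteq> j"
  shows "clear_coord i (g + nmul n (t j)) = clear_coord i g + nmul n (t j)"
    "clear_coord i (g - nmul n (t j)) = clear_coord i g - nmul n (t j)"
  using assms by (auto intro!: eq_if_coords simp: clear_coord_coord coord_basis)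

lemma primit_clear_commute: "i < m \<Longrightarrow> j < m \<Longrightarrow> i \<noteq> j \<Longrightarrow>
    ext (\<lambda>g. bas (clear_coord i g)) (primit j g) = (primit j (clear_coord i g) :: 'g \<Rightarrow>\<^sub>0 'k::field)"
  by (auto simp: primit_def clear_coord_coord clear_coord_nmul simp del: nmul.simps)

lemma contr_contr_wedge1_commute:
  assumes "i \<noteq> j"
  shows "contr i (wedge1 i (contr j p)) = contr j (contr i (wedge1 i p))"
    "contr i (wedge1 i (wedge1 j p)) = wedge1 j (contr i (wedge1 i p))"
proof -
  have "wedge1 i (contr j p) = - contr j (wedge1 i p)"
    using assms by (simp add: contr_wedge1_anticomm[of j i])
  then show "contr i (wedge1 i (contr j p)) = contr j (contr i (wedge1 i p))"
    using assms by (simp add: contr_anticomm[of i j])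
  show "contr i (wedge1 i (wedge1 j p)) = wedge1 j (contr i (wedge1 i p))"
    using assms by (simp add: wedge1_anticomm[of i j] contr_wedge1_anticomm[of i j])
qed

lemma kdiff_kprim_anticomm:
  assumes "i < m" "j < m" "i \<noteq> j"
  shows "kdiff i (kprim j p) = - kprim j (kdiff i p)"
  using assms unfolding kdiff_def kprim_def
  by (simp add: act_pair_comp klin_contr klin_wedge1 primit_shift contr_wedge1_anticomm act_linear)

lemma kclear_commute:
  assumes "i < m" "j < m" "i \<noteq> j"
  shows "kclear i (kdiff j p) = kdiff j (kclear i p)" "kclear i (kprim j p) = kprim j (kclear i p)"
proof -
  have k: "klin (\<lambda>y. contr i (wedge1 i y))" by (intro klin_intros)
  show "kclear i (kdiff j p) = kdiff j (kclear i p)" "kclear i (kprim j p) = kprim j (kclear i p)"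
    using assms unfolding kdiff_def kclear_def kprim_def
    by (simp_all add: act_pair_comp k klin_contr klin_wedge1 primit_clear_commute
        contr_contr_wedge1_commute differ_def clear_coord_shift')
qed

lemma kdiff_kclear: "kdiff i (kclear i p) = 0" "i < m \<Longrightarrow> kclear i (kdiff i p) = 0"
proof -
  have k: "klin (\<lambda>y. contr i (wedge1 i y))" by (intro klin_intros)
  show "kdiff i (kclear i p) = 0" "i < m \<Longrightarrow> kclear i (kdiff i p) = 0"
    unfolding kdiff_def kclear_def
    by (simp_all add: act_pair_comp k klin_contr differ_def clear_coord_shift)
qed

text \<open>
  The Koszul complex \<open>K\<close> of the commuting operators \<open>t\<^sub>i - 1\<close> on the group algebra, truncated to
  the first \<open>n\<close> coordinates, and the contraction that integrates the first coordinate that has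
  not been cleared yet.
\<close>

definition koszul_d :: "nat \<Rightarrow> ('g \<times> nat set \<Rightarrow>\<^sub>0 'k::field) \<Rightarrow> ('g \<times> nat set \<Rightarrow>\<^sub>0 'k)"
  where "koszul_d n p = (\<Sum>i<n. kdiff i p)"

primrec kclear_upto :: "nat \<Rightarrow> ('g \<times> nat set \<Rightarrow>\<^sub>0 'k::field) \<Rightarrow> ('g \<times> nat set \<Rightarrow>\<^sub>0 'k)"
  where "kclear_upto 0 p = p" | "kclear_upto (Suc n) p = kclear n (kclear_upto n p)"

definition koszul_s :: "nat \<Rightarrow> ('g \<times> nat set \<Rightarrow>\<^sub>0 'k::field) \<Rightarrow> ('g \<times> nat set \<Rightarrow>\<^sub>0 'k)"
  where "koszul_s n p = (\<Sum>i<n. kclear_upto i (kprim i p))"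

lemma klin_kclear_upto [klin_intros]: "klin (kclear_upto n)"
proof (induction n)
  case (Suc n)
  have *: "kclear_upto (Suc n) = (\<lambda>p. kclear n (kclear_upto n p))" by (simp add: fun_eq_iff)
  show ?case unfolding * by (rule klin_comp[OF klin_k(3) Suc])
qed (simp add: klin_def)

lemma klin_koszul [klin_intros]: "klin (koszul_d n)" "klin (koszul_s n)"
  unfolding koszul_d_def[abs_def] koszul_s_def[abs_def]
  by (auto intro!: klin_intros klin_comp[OF klin_kclear_upto])

lemmas [klin_intros] = klin_koszul[THEN klin_comp] klin_comp[OF klin_kclear_upto]

lemma kclear_upto_commute:
  assumes "n \<le> j" "j < m"
  shows "kclear_upto n (kdiff j p) = kdiff j (kclear_upto n p)"
    "kclear_upto n (kprim j p) = kprim j (kclear_upto n p)"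
  using assms by (induction n) (simp_all add: kclear_commute)

lemma kclear_kclear_commute: "i < m \<Longrightarrow> j < m \<Longrightarrow> kclear i (kclear j p) = kclear j (kclear i p)"
proof (cases "i = j")
  case False
  assume *: "i < m" "j < m"
  have "kclear j q = q - kdiff j (kprim j q) - kprim j (kdiff j q)" for q
    using kdiff_kprim[OF *(2), of q] by (simp add: algebra_simps)
  from this[of p] this[of "kclear i p"] show ?thesis
    using * False by (simp add: kclear_commute)
qed simp

lemma kclear_upto_kdiff:
  assumes "j < n" "n \<le> m"
  shows "kclear_upto n (kdiff j p) = 0" "kdiff j (kclear_upto n p) = 0"
  using assms
proof (induction n)
  case (Suc n)
  { case 1
    then show ?case
      using Suc kclear_upto_commute(1)[of j j p]
      by (cases "j = n") (simp_all add: kclear_upto_commute kdiff_kclear klin_zero[OF klin_k(3)])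
  next
    case 2
    then show ?case
      using Suc kclear_commute(1)[of n j "kclear_upto n p"]
      by (cases "j = n") (simp_all add: kdiff_kclear) }
qed simp_all

text \<open>
  The homotopies of the single coordinates are composed as for a tensor product of complexes, so
  the sum telescopes from the identity to the projection that clears \<open>n\<close> coordinates.
\<close>

lemma koszul_contraction:
  assumes "n \<le> m"
  shows "koszul_d m (koszul_s n p) + koszul_s n (koszul_d m p) = p - kclear_upto n p"
  using assms
proof (induction n)
  case 0
  then show ?case by (simp add: koszul_s_def koszul_d_def klin_zero[OF klin_k(1)])
next
  case (Suc n)
  \<comment> \<open>The summand of \<open>koszul_s\<close> for coordinate \<open>n\<close> interacts with \<open>kdiff i\<close> only for \<open>i = n\<close>: smaller
     coordinates have been cleared, and for larger ones the two operators anticommute.\<close>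
  let ?K = "\<lambda>i. kdiff i (kclear_upto n (kprim n p)) + kclear_upto n (kprim n (kdiff i p))"
  have "?K i = (if i = n then kclear_upto n p - kclear_upto (Suc n) p else 0)" if "i < m" for i
  proof (cases "i < n")
    case True
    then have "kclear_upto n (kprim n (kdiff i p)) = - kclear_upto n (kdiff i (kprim n p))"
      using Suc.prems that by (simp add: kdiff_kprim_anticomm klin_minus[OF klin_kclear_upto])
    then show ?thesis using True Suc.prems by (simp add: kclear_upto_kdiff)
  next
    case False
    then have "?K i = kclear_upto n (kdiff i (kprim n p) + kprim n (kdiff i p))"
      using that by (simp add: kclear_upto_commute klin_add[OF klin_kclear_upto])
    also have "\<dots> = kclear_upto n (if i = n then p - kclear n p else 0)"
      using that Suc.prems by (auto simp: kdiff_kprim kdiff_kprim_anticomm)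
    also have "kclear_upto n (kclear n p) = kclear n (kclear_upto n p)"
    proof -
      have "k \<le> n \<Longrightarrow> kclear_upto k (kclear n p) = kclear n (kclear_upto k p)" for k
        using Suc.prems by (induction k) (simp_all add: kclear_kclear_commute)
      then show ?thesis by simp
    qed
    then have "kclear_upto n (if i = n then p - kclear n p else 0)
        = (if i = n then kclear_upto n p - kclear_upto (Suc n) p else 0)"
      by (simp add: klin_diff[OF klin_kclear_upto] klin_zero[OF klin_kclear_upto])
    finally show ?thesis .
  qed
  then have "(\<Sum>i<m. ?K i) = (\<Sum>i<m. if i = n then kclear_upto n p - kclear_upto (Suc n) p else 0)"
    by (intro sum.cong) auto
  also have "\<dots> = kclear_upto n p - kclear_upto (Suc n) p"
    using Suc.prems by simp
  finally have K: "(\<Sum>i<m. ?K i) = kclear_upto n p - kclear_upto (Suc n) p" .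
  have "koszul_d m (koszul_s (Suc n) p) + koszul_s (Suc n) (koszul_d m p)
    = (koszul_d m (koszul_s n p) + koszul_s n (koszul_d m p))
      + (koszul_d m (kclear_upto n (kprim n p)) + kclear_upto n (kprim n (koszul_d m p)))"
    by (simp add: koszul_s_def klin_add[OF klin_koszul(1)])
  also have "koszul_d m (kclear_upto n (kprim n p)) + kclear_upto n (kprim n (koszul_d m p)) = (\<Sum>i<m. ?K i)"
    by (simp add: koszul_d_def klin_sum[OF klin_k(2)] klin_sum[OF klin_kclear_upto] sum.distrib)
  finally show ?case using Suc K by simp
qed

end


text \<open>
  From here on multiples of basis vectors are kept in the form \<open>c *\<^sub>p bas a\<close>, so that linearity of
  the operators applies to them.
\<close>

declare pscale_single [simp del] single_one [simp del]

section \<open>The bar complex of an abelian group\<close>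

definition cns :: "'g \<Rightarrow> ('g list \<Rightarrow>\<^sub>0 'k::field) \<Rightarrow> ('g list \<Rightarrow>\<^sub>0 'k)"
  where "cns a = ext (\<lambda>l. bas (a # l))"

fun add_hd :: "'g::ab_group_add \<Rightarrow> 'g list \<Rightarrow> 'g list"
  where "add_hd a [] = []" | "add_hd a (b # r) = (a + b) # r"

definition shift_hd :: "'g::ab_group_add \<Rightarrow> ('g list \<Rightarrow>\<^sub>0 'k::field) \<Rightarrow> ('g list \<Rightarrow>\<^sub>0 'k)"
  where "shift_hd a = ext (\<lambda>l. bas (add_hd a l))"

lemma klin_cns: "klin (cns a)"
  by (simp add: cns_def klin_ext)

lemma cns_bas: "cns a (Poly_Mapping.single l c) = Poly_Mapping.single (a # l) c"
  by (simp add: cns_def pscale_single)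

lemmas [klin_intros] = klin_cns klin_comp[OF klin_cns]

text \<open>
  The list \<open>g # l\<close> stands for the element \<open>g \<otimes> l\<close> of the bar resolution, and the empty list for the
  generator of its augmentation, so that one recursion covers all degrees: the face operators merge
  neighbours, and the last one drops the last entry.
\<close>

fun bar0 :: "'g::ab_group_add list \<Rightarrow> ('g list \<Rightarrow>\<^sub>0 'k::field)"
  where "bar0 [] = 0" | "bar0 (a # l) = bas (add_hd a l) - cns a (bar0 l)"

definition bar :: "('g::ab_group_add list \<Rightarrow>\<^sub>0 'k::field) \<Rightarrow> ('g list \<Rightarrow>\<^sub>0 'k)"
  where "bar = ext bar0"

lemma klin_bar_ops [klin_intros]: "klin (cns a)" "klin (shift_hd a)" "klin bar"
  by (simp_all add: cns_def shift_hd_def bar_def klin_ext)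

lemmas [klin_intros] = klin_bar_ops[THEN klin_comp]
lemmas bar_ops_simps [simp] = klin_simps[OF klin_bar_ops(1)] klin_simps[OF klin_bar_ops(2)]
  klin_simps[OF klin_bar_ops(3)]

lemma bar_ops_bas [simp]:
  "cns a (Poly_Mapping.single l c) = Poly_Mapping.single (a # l) c"
  "shift_hd a (Poly_Mapping.single l c) = Poly_Mapping.single (add_hd a l) c"
  "bar (bas l) = bar0 l"
  by (simp_all add: cns_def shift_hd_def bar_def pscale_single)

lemma add_hd_add [simp]: "add_hd a (add_hd b l) = add_hd (a + b) l" "add_hd 0 l = l"
  by (cases l; simp add: add.assoc)+

lemma shift_hd_shift_hd [simp]: "shift_hd a (shift_hd b p) = shift_hd (a + b) p"
  by (rule klin_eqI[where p = p]) (auto intro!: klin_intros)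

lemma shift_hd_0 [simp]: "shift_hd 0 p = p"
  by (rule klin_eqI[where p = p]) (auto intro!: klin_intros)

lemma shift_hd_cns [simp]: "shift_hd a (cns b p) = cns (a + b) p"
  by (rule klin_eqI[where p = p]) (auto intro!: klin_intros)

lemma bar_cns [simp]: "bar (cns a p) = shift_hd a p - cns a (bar p)"
  by (rule klin_eqI[where p = p]) (auto intro!: klin_intros)

lemma bar0_add_hd: "bar0 (add_hd a l) = shift_hd a (bar0 l)"
  by (cases l) simp_all

lemma bar_shift_hd [simp]: "bar (shift_hd a p) = shift_hd a (bar p)"
  by (rule klin_eqI[where p = p]) (auto intro!: klin_intros simp: bar0_add_hd)

lemma bar_bar0: "bar (bar0 l) = 0"
  by (induction l) (simp_all add: bar0_add_hd)

lemma bar_bar [simp]: "bar (bar p) = 0"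
  by (rule klin_eqI[where p = p and g = "\<lambda>_. 0"]) (auto intro!: klin_intros simp: bar_bar0)

definition len :: "nat \<Rightarrow> 'g list set"
  where "len n = {l. length l = n}"

lemma len_iff [simp]: "l \<in> len n \<longleftrightarrow> length l = n"
  by (simp add: len_def)

lemma cns_len: "p \<in> fsupp (len n) \<Longrightarrow> cns a p \<in> fsupp (len (Suc n))"
  unfolding cns_def by (erule ext_fsupp) (simp add: len_iff)

lemma length_add_hd [simp]: "length (add_hd a l) = length l"
  by (cases l) simp_all

lemma shift_hd_len: "p \<in> fsupp (len n) \<Longrightarrow> shift_hd a p \<in> fsupp (len n)"
  unfolding shift_hd_def by (erule ext_fsupp) (simp add: len_iff)

lemma bar0_len: "length l = Suc n \<Longrightarrow> bar0 l \<in> fsupp (len n)"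
proof (induction l arbitrary: n)
  case (Cons a l)
  show ?case
  proof (cases n)
    case 0
    with Cons show ?thesis by (simp add: len_iff)
  next
    case (Suc n')
    with Cons show ?thesis by (simp add: cns_len)
  qed
qed simp

lemma bar_len: "p \<in> fsupp (len (Suc n)) \<Longrightarrow> bar p \<in> fsupp (len n)"
  unfolding bar_def by (erule ext_fsupp) (simp add: len_iff bar0_len)

text \<open>
  For a character \<open>\<psi>\<close>, the map \<open>aug \<psi>\<close> replaces the free left action on the bar resolution by the
  action through \<open>\<psi>\<close>; \<open>tbar \<psi>\<close> is the resulting differential, up to a sign.
\<close>

definition aug :: "('g \<Rightarrow> 'k::field) \<Rightarrow> ('g list \<Rightarrow>\<^sub>0 'k) \<Rightarrow> ('g list \<Rightarrow>\<^sub>0 'k)"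
  where "aug \<psi> = ext (\<lambda>l. case l of [] \<Rightarrow> 0 | g # r \<Rightarrow> (\<psi> g *\<^sub>p bas r))"

definition tbar :: "('g::ab_group_add \<Rightarrow> 'k::field) \<Rightarrow> ('g list \<Rightarrow>\<^sub>0 'k) \<Rightarrow> ('g list \<Rightarrow>\<^sub>0 'k)"
  where "tbar \<psi> p = bar p - aug \<psi> p"

lemma klin_aug [klin_intros]: "klin (aug \<psi>)" "klin (tbar \<psi>)"
proof -
  show 1: "klin (aug \<psi>)" by (simp add: aug_def klin_ext)
  show "klin (tbar \<psi>)" unfolding tbar_def[abs_def] by (intro klin_intros 1)
qed

lemmas [klin_intros] = klin_aug[THEN klin_comp]
lemmas aug_simps [simp] = klin_simps[OF klin_aug(1)] klin_simps[OF klin_aug(2)]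

lemma aug_bas [simp]: "aug \<psi> (bas []) = 0" "aug \<psi> (bas (g # r)) = \<psi> g *\<^sub>p bas r"
  by (simp_all add: aug_def)

lemma aug_cns [simp]:
  fixes \<psi> :: "'g::ab_group_add \<Rightarrow> 'k::field"
  shows "aug \<psi> (cns g p) = \<psi> g *\<^sub>p p"
  by (rule klin_eqI[where p = p]) (auto intro!: klin_intros)

lemma aug_len: "p \<in> fsupp (len (Suc n)) \<Longrightarrow> aug \<psi> p \<in> fsupp (len n)"
  unfolding aug_def by (erule ext_fsupp) (auto simp: len_iff length_Suc_conv)

lemma tbar_len: "p \<in> fsupp (len (Suc n)) \<Longrightarrow> tbar \<psi> p \<in> fsupp (len n)"
  by (simp add: tbar_def bar_len aug_len)

definition gchar :: "('g::ab_group_add \<Rightarrow> 'k::field) \<Rightarrow> bool"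
  where "gchar \<psi> \<longleftrightarrow> \<psi> 0 = 1 \<and> (\<forall>g h. \<psi> (g + h) = \<psi> g * \<psi> h)"

lemma aug_shift_hd: "gchar \<psi> \<Longrightarrow> aug \<psi> (shift_hd g p) = \<psi> g *\<^sub>p aug \<psi> p"
proof (rule klin_eqI[where p = p])
  fix l assume "gchar \<psi>"
  then show "aug \<psi> (shift_hd g (bas l)) = \<psi> g *\<^sub>p aug \<psi> (bas l)"
    by (cases l) (auto simp: gchar_def)
qed (intro klin_intros)+

text \<open>
  The bar differential is equivariant, so it descends along \<open>aug \<psi>\<close>; the sign is that of the
  boundary of the tail in the recursion for \<open>bar0\<close>.
\<close>

lemma aug_bar: 
  assumes "gchar \<psi>"
  shows "aug \<psi> (bar p) = - tbar \<psi> (aug \<psi> p)"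
proof (rule klin_eqI[where p = p])
  fix l
  show "aug \<psi> (bar (bas l)) = - tbar \<psi> (aug \<psi> (bas l))"
  proof (cases l)
    case (Cons g r)
    have "aug \<psi> (bar (shift_hd g (cns 0 (bas r)))) = - \<psi> g *\<^sub>p tbar \<psi> (bas r)"
      using assms by (simp only: bar_shift_hd aug_shift_hd bar_cns)
        (simp add: tbar_def gchar_def pscale_distribs)
    then show ?thesis using Cons by simp
  qed simp
qed (intro klin_intros)+

lemma tbar_tbar [simp]:
  assumes "gchar \<psi>"
  shows "tbar \<psi> (tbar \<psi> p) = 0"
proof -
  have "tbar \<psi> p = tbar \<psi> (aug \<psi> (cns 0 p))" using assms by (simp add: gchar_def)
  then have "tbar \<psi> p = - aug \<psi> (bar (cns 0 p))" using aug_bar[OF assms, of "cns 0 p"] by simp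
  then have "tbar \<psi> (tbar \<psi> p) = - tbar \<psi> (aug \<psi> (bar (cns 0 p)))" by (simp only: aug_simps)
  also have "\<dots> = aug \<psi> (bar (bar (cns 0 p)))" using aug_bar[OF assms, of "bar (cns 0 p)"] by simp
  finally show ?thesis by (simp only: bar_bar aug_simps)
qed


section \<open>Comparison of the bar and Koszul resolutions\<close>

context lattice
begin

definition ktrans :: "'g \<Rightarrow> ('g \<times> nat set \<Rightarrow>\<^sub>0 'k::field) \<Rightarrow> ('g \<times> nat set \<Rightarrow>\<^sub>0 'k)"
  where "ktrans a = act_fst (\<lambda>g. bas (a + g))"

lemma klin_ktrans [klin_intros]: "klin (ktrans a)"
  by (simp add: ktrans_def klin_act)

lemmas [klin_intros] = klin_comp[OF klin_ktrans]
lemmas ktrans_simps [simp] = klin_simps[OF klin_ktrans]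

lemma ktrans_bas [simp]: "ktrans a (Poly_Mapping.single (g, S) c) = Poly_Mapping.single (a + g, S) c"
  by (simp add: ktrans_def act_fst_def pscale_single)

lemma ktrans_ktrans [simp]: "ktrans a (ktrans b p) = ktrans (a + b) p" "ktrans 0 p = p"
  unfolding ktrans_def by (simp_all add: act_fst_act_fst add.assoc)

lemma ktrans_koszul_d: "koszul_d n (ktrans a p) = ktrans a (koszul_d n p)"
proof -
  have "kdiff i (ktrans a p) = ktrans a (kdiff i p)" for i
    unfolding kdiff_def ktrans_def
    by (simp add: act_fst_act_fst differ_def add.assoc flip: act_commute[of "\<lambda>g. bas (a + g)"])
  then show ?thesis by (simp add: koszul_d_def)
qed

definition kdeg :: "nat \<Rightarrow> ('g \<times> nat set) set"
  where "kdeg n = UNIV \<times> nsets m n"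

lemma act_kdeg: "p \<in> fsupp (kdeg n) \<Longrightarrow> act_fst A p \<in> fsupp (kdeg n)"
  "klin B \<Longrightarrow> (\<And>y. y \<in> fsupp (nsets m n) \<Longrightarrow> B y \<in> fsupp (nsets m k))
    \<Longrightarrow> p \<in> fsupp (kdeg n) \<Longrightarrow> act_snd B p \<in> fsupp (kdeg k)"
  unfolding act_fst_def act_snd_def
  by (erule ext_fsupp; auto simp: kdeg_def intro!: ext_fsupp[of _ UNIV] ext_fsupp[of _ "nsets m k"])+

lemma kclear_upto_bas:
  "kclear_upto n (bas (g, S)) = (if S \<inter> {..<n} = {}
     then bas (foldr clear_coord (rev [0..<n]) g, S) else (0 :: 'g \<times> nat set \<Rightarrow>\<^sub>0 'k::field))"
proof (induction n)
  case (Suc n)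
  have *: "S \<inter> {..<Suc n} = {} \<longleftrightarrow> S \<inter> {..<n} = {} \<and> n \<notin> S" by (auto simp: less_Suc_eq)
  show ?case
    unfolding kclear_upto.simps Suc * kclear_def
    by (auto simp: act_bas wedge1_bas contr_bas)
qed simp

lemma foldr_clear_coord: "n \<le> m \<Longrightarrow> i < m \<Longrightarrow>
    \<phi> i (foldr clear_coord (rev [0..<n]) g) = (if i < n then 0 else \<phi> i g)"
  by (induction n) (auto simp: clear_coord_coord)

lemma kclear_all_0:
  fixes p :: "'g \<times> nat set \<Rightarrow>\<^sub>0 'k::field"
  shows "p \<in> fsupp (kdeg 0) \<Longrightarrow> kclear_upto m p = act_fst (\<lambda>_. bas 0) p"
proof (rule klin_eq_on[where f = "kclear_upto m" and p = p and S = "kdeg 0"])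
  fix x :: "'g \<times> nat set" assume "x \<in> kdeg 0"
  moreover obtain g S where x: "x = (g, S)" by (cases x)
  ultimately have "S = {}" by (auto simp: kdeg_def nsets_def dest: finite_subset[OF _ finite_lessThan])
  moreover have "foldr clear_coord (rev [0..<m]) g = 0"
    by (rule coords_eq_0) (simp add: foldr_clear_coord)
  ultimately show "kclear_upto m (bas x) = act_fst (\<lambda>_. bas 0) (bas x :: 'g \<times> nat set \<Rightarrow>\<^sub>0 'k)"
    by (simp add: x kclear_upto_bas act_bas)
qed (auto intro!: klin_intros)

lemma kclear_all_Suc:
  fixes p :: "'g \<times> nat set \<Rightarrow>\<^sub>0 'k::field"
  shows "p \<in> fsupp (kdeg (Suc n)) \<Longrightarrow> kclear_upto m p = 0"
proof (rule klin_eq_on[where f = "kclear_upto m" and S = "kdeg (Suc n)" and p = p and g = "\<lambda>_. 0"])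
  fix x :: "'g \<times> nat set" assume "x \<in> kdeg (Suc n)"
  moreover obtain g S where x: "x = (g, S)" by (cases x)
  ultimately have "S \<inter> {..<m} \<noteq> {}" by (auto simp: kdeg_def nsets_def Int_absorb2)
  then show "kclear_upto m (bas x) = (0 :: 'g \<times> nat set \<Rightarrow>\<^sub>0 'k)"
    by (simp add: x kclear_upto_bas)
qed (auto intro!: klin_intros)

lemma koszul_s_kdeg: "p \<in> fsupp (kdeg n) \<Longrightarrow> koszul_s m p \<in> fsupp (kdeg (Suc n))"
proof -
  assume p: "p \<in> fsupp (kdeg n)"
  have 1: "kprim i p \<in> fsupp (kdeg (Suc n))" if "i < m" for i
    unfolding kprim_def using p that by (intro act_kdeg wedge1_nsets klin_wedge1) auto
  have "kclear_upto i q \<in> fsupp (kdeg k)" if "q \<in> fsupp (kdeg k)" for i q k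
    using that
    by (erule_tac klin_fsupp[OF klin_kclear_upto]) (auto simp: kdeg_def kclear_upto_bas)
  with 1 show ?thesis unfolding koszul_s_def by (intro fsupp_sum) auto
qed

text \<open>
  The comparison map from the bar resolution. It is equivariant, and \<open>bar_to_koszul0 l\<close> is the
  image of the generator \<open>0 # l\<close>, obtained from the contraction of the Koszul complex.
\<close>

primrec bar_to_koszul0 :: "'g list \<Rightarrow> ('g \<times> nat set \<Rightarrow>\<^sub>0 'k::field)"
  where "bar_to_koszul0 [] = bas (0, {})"
  | "bar_to_koszul0 (g # l) = koszul_s m (ktrans g (bar_to_koszul0 l))"

definition bar_to_koszul :: "('g list \<Rightarrow>\<^sub>0 'k::field) \<Rightarrow> ('g \<times> nat set \<Rightarrow>\<^sub>0 'k)"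
  where "bar_to_koszul = ext (\<lambda>l. case l of [] \<Rightarrow> 0 | g # r \<Rightarrow> ktrans g (bar_to_koszul0 r))"

lemma klin_bar_to_koszul [klin_intros]: "klin bar_to_koszul"
  by (simp add: bar_to_koszul_def klin_ext)

lemmas [klin_intros] = klin_comp[OF klin_bar_to_koszul]
lemmas bar_to_koszul_simps [simp] = klin_simps[OF klin_bar_to_koszul]

lemma bar_to_koszul_bas [simp]:
  "bar_to_koszul (bas []) = 0" "bar_to_koszul (bas (g # r)) = ktrans g (bar_to_koszul0 r)"
  by (simp_all add: bar_to_koszul_def)

lemma bar_to_koszul_cns0: "bar_to_koszul (cns g p) = ktrans g (ext bar_to_koszul0 p)"
  by (rule klin_eqI[where p = p]) (auto intro!: klin_intros)

lemma bar_to_koszul_shift_hd [simp]: "bar_to_koszul (shift_hd g p) = ktrans g (bar_to_koszul p)"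
proof (rule klin_eqI[where p = p])
  fix l :: "'g list"
  show "bar_to_koszul (shift_hd g (bas l)) = ktrans g (bar_to_koszul (bas l))"
    by (cases l) simp_all
qed (intro klin_intros)+

lemma bar_to_koszul0_deg: "bar_to_koszul0 l \<in> fsupp (kdeg (length l))"
  by (induction l) (auto intro!: koszul_s_kdeg act_kdeg simp: ktrans_def, simp add: kdeg_def nsets_def)

lemma bar_to_koszul0_eq: "p \<in> fsupp (len (Suc n)) \<Longrightarrow>
    ext bar_to_koszul0 p = koszul_s m (bar_to_koszul p)"
  by (rule klin_eq_on[where S = "len (Suc n)"]) (auto intro!: klin_intros simp: len_iff length_Suc_conv)

text \<open>
  The comparison map commutes with the differentials. On generators this follows by induction from
  the contraction formula: the boundary of a chain is a cycle, so contracting its image recovers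
  the image, apart from the cleared part, which lives in degree \<open>0\<close>.
\<close>

lemma koszul_d_bar_to_koszul0:
  "koszul_d m (bar_to_koszul0 l :: 'g \<times> nat set \<Rightarrow>\<^sub>0 'k::field) = bar_to_koszul (bar (cns 0 (bas l)))"
proof (induction l)
  case Nil
  have "kdiff i (bas (0 :: 'g, {})) = (0 :: 'g \<times> nat set \<Rightarrow>\<^sub>0 'k)" for i
    by (simp add: kdiff_def act_bas contr_bas)
  then show ?case by (simp add: koszul_d_def)
next
  case (Cons g l)
  let ?h = "ktrans g (bar_to_koszul0 l) :: 'g \<times> nat set \<Rightarrow>\<^sub>0 'k"
  let ?y = "bar (bas (g # l)) :: 'g list \<Rightarrow>\<^sub>0 'k"
  have dh: "koszul_d m ?h = bar_to_koszul ?y"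
  proof -
    have "koszul_d m ?h = bar_to_koszul (shift_hd g (bar (cns 0 (bas l))))"
      by (simp only: ktrans_koszul_d Cons bar_to_koszul_shift_hd)
    then show ?thesis by (simp only: flip: bar_shift_hd) simp
  qed
  have *: "koszul_s m (bar_to_koszul ?y) + kclear_upto m ?h = ext bar_to_koszul0 ?y"
  proof (cases l)
    case Nil
    then show ?thesis
      using kclear_all_0[of ?h] by (simp add: act_bas klin_zero[OF klin_koszul(2)] kdeg_def nsets_def)
  next
    case (Cons b r)
    have "?h \<in> fsupp (kdeg (Suc (length r)))"
      unfolding ktrans_def using bar_to_koszul0_deg[of l] Cons by (intro act_kdeg) simp
    moreover have "?y \<in> fsupp (len (Suc (length r)))"
      by (rule bar_len) (use Cons in \<open>simp add: len_iff\<close>)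
    ultimately show ?thesis by (simp only: kclear_all_Suc bar_to_koszul0_eq) simp
  qed
  have "koszul_d m (bar_to_koszul0 (g # l)) = ?h - (kclear_upto m ?h + koszul_s m (koszul_d m ?h))"
    using koszul_contraction[of m ?h] by (simp add: algebra_simps)
  also have "\<dots> = ?h - ext bar_to_koszul0 ?y"
    using * by (simp add: dh algebra_simps)
  also have "\<dots> = bar_to_koszul (bar (cns 0 (bas (g # l))))"
    by (simp only: bar_cns bar_to_koszul_simps bar_to_koszul_cns0) simp
  finally show ?case .
qed

text \<open>
  The comparison map in the other direction. Contracting with each \<open>e\<^sub>i\<close> and prepending \<open>t\<^sub>i\<close>
  produces the signed sum over all orders of the factors of a wedge product.
\<close>

primrec antisymmetrize :: "nat \<Rightarrow> (nat set \<Rightarrow>\<^sub>0 'k::field) \<Rightarrow> ('g list \<Rightarrow>\<^sub>0 'k)"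
  where "antisymmetrize 0 y = ext (\<lambda>S. if S = {} then bas [] else 0) y"
  | "antisymmetrize (Suc n) y = (\<Sum>i<m. cns (t i) (antisymmetrize n (contr i y)))"

lemma klin_antisym [klin_intros]: "klin (antisymmetrize n)"
proof (induction n)
  case 0
  have "antisymmetrize 0 = ext (\<lambda>S. if S = {} then bas [] else 0)" by (simp add: fun_eq_iff)
  then show ?case by (simp add: klin_ext)
next
  case (Suc n)
  have *: "antisymmetrize (Suc n) = (\<lambda>y. \<Sum>i<m. cns (t i) (antisymmetrize n (contr i y)))" by (simp add: fun_eq_iff)
  show ?case unfolding * by (intro klin_intros klin_comp[OF Suc])
qed

lemmas [klin_intros] = klin_comp[OF klin_antisym]

lemma antisym_len: "antisymmetrize n y \<in> fsupp (len n)"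
  by (induction n arbitrary: y)
    (auto intro!: fsupp_sum cns_len ext_fsupp[of _ UNIV])

definition contr_all :: "(nat set \<Rightarrow>\<^sub>0 'k::field) \<Rightarrow> (nat set \<Rightarrow>\<^sub>0 'k)"
  where "contr_all y = (\<Sum>i<m. contr i y)"

lemma sum_antisymmetric:
  fixes f :: "nat \<Rightarrow> nat \<Rightarrow> 'a \<Rightarrow>\<^sub>0 'k::field_char_0"
  assumes "\<And>i j. f i j + f j i = 0"
  shows "(\<Sum>i<m. \<Sum>j<m. f i j) = 0"
proof -
  have "(\<Sum>i<m. \<Sum>j<m. f i j) + (\<Sum>i<m. \<Sum>j<m. f i j) = (\<Sum>i<m. \<Sum>j<m. f i j) + (\<Sum>i<m. \<Sum>j<m. f j i)"
    by (subst (2) sum.swap) simp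
  also have "\<dots> = 0" by (simp add: assms flip: sum.distrib)
  finally have "2 *\<^sub>p (\<Sum>i<m. \<Sum>j<m. f i j) = 0"
    using pscale_add_left[of 1 1 "\<Sum>i<m. \<Sum>j<m. f i j"] by simp
  then have "(1 / 2) *\<^sub>p 2 *\<^sub>p (\<Sum>i<m. \<Sum>j<m. f i j) = 0" by (simp only: pscale_simps)
  then show ?thesis by simp
qed

text \<open>
  Faces that merge two neighbours cancel in pairs, since \<open>t i + t j\<close> is symmetric and
  \<open>contr j (contr i y)\<close> is antisymmetric in \<open>i\<close> and \<open>j\<close>. Only the face that drops the last entry
  survives.
\<close>

lemma bar_antisym: "bar (antisymmetrize (Suc n) y) = (antisymmetrize n (contr_all y) :: 'g list \<Rightarrow>\<^sub>0 'k::field_char_0)"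
proof (induction n arbitrary: y)
  case 0
  have "shift_hd a (antisymmetrize 0 y) = antisymmetrize 0 y" for a and y :: "nat set \<Rightarrow>\<^sub>0 'k"
    by (rule klin_eqI[where p = y]) (intro klin_intros, intro klin_intros, simp)
  moreover have "bar (antisymmetrize 0 y) = 0" for y :: "nat set \<Rightarrow>\<^sub>0 'k"
    by (rule klin_eqI[where p = y and g = "\<lambda>_. 0"]) (intro klin_intros, intro klin_intros, simp)
  ultimately show ?case
    unfolding contr_all_def klin_sum[OF klin_antisym]
    by (simp del: antisymmetrize.simps(1) add: antisymmetrize.simps(2))
next
  case (Suc n)
  have a: "cns (t i + t j) (antisymmetrize n (contr j (contr i y))) + cns (t j + t i) (antisymmetrize n (contr i (contr j y))) = 0" for i j
    using contr_anticomm'[of i j y]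
    by (simp add: add.commute eq_neg_iff_add_eq_0[symmetric] klin_simps[OF klin_antisym])
  have "bar (antisymmetrize (Suc (Suc n)) y)
    = (\<Sum>i<m. \<Sum>j<m. cns (t i + t j) (antisymmetrize n (contr j (contr i y))))
      - (\<Sum>i<m. cns (t i) (antisymmetrize n (contr_all (contr i y))))"
    by (subst antisymmetrize.simps(2)) (simp only: bar_ops_simps bar_cns Suc, simp add: sum_subtractf)
  also have "(\<Sum>i<m. \<Sum>j<m. cns (t i + t j) (antisymmetrize n (contr j (contr i y)))) = 0"
    by (rule sum_antisymmetric) (rule a)
  also have "(\<Sum>i<m. cns (t i) (antisymmetrize n (contr_all (contr i y))))
      = - (\<Sum>i<m. cns (t i) (antisymmetrize n (contr i (contr_all y))))"
  proof -
    have "contr_all (contr i y) = - contr i (contr_all y)" for i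
      unfolding contr_all_def using contr_anticomm'[of _ i y]
      by (simp add: eq_neg_iff_add_eq_0 flip: sum.distrib)
    then show ?thesis by (simp add: klin_simps[OF klin_antisym] sum_negf)
  qed
  finally show ?case by simp
qed

definition koszul_to_bar :: "('g \<times> nat set \<Rightarrow>\<^sub>0 'k::field) \<Rightarrow> ('g list \<Rightarrow>\<^sub>0 'k)"
  where "koszul_to_bar = ext (\<lambda>(g, S). cns g (antisymmetrize (card S) (bas S)))"

lemma klin_koszul_to_bar [klin_intros]: "klin koszul_to_bar"
  by (simp add: koszul_to_bar_def klin_ext)

lemmas [klin_intros] = klin_comp[OF klin_koszul_to_bar]
lemmas koszul_to_bar_simps [simp] = klin_simps[OF klin_koszul_to_bar]

lemma koszul_to_bar_act:
  assumes "y \<in> fsupp (nsets m n)"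
  shows "koszul_to_bar (ext (\<lambda>U. bas (g, U)) y) = cns g (antisymmetrize n y)"
  by (rule klin_eq_on[OF _ _ assms])
    (auto intro!: klin_intros simp: koszul_to_bar_def nsets_def)

lemma koszul_to_bar_ktrans: "koszul_to_bar (ktrans a p) = shift_hd a (koszul_to_bar p)"
  by (rule klin_eqI[where p = p]) (auto intro!: klin_intros simp: koszul_to_bar_def)

lemma koszul_to_bar_d:
  fixes y :: "nat set \<Rightarrow>\<^sub>0 'k::field"
  assumes "y \<in> fsupp (nsets m (Suc n))"
  shows "koszul_to_bar (koszul_d m (ext (\<lambda>U. bas (g, U)) y))
    = (\<Sum>i<m. cns (g + t i) (antisymmetrize n (contr i y))) - cns g (antisymmetrize n (contr_all y))"
proof -
  have "koszul_to_bar (kdiff i (ext (\<lambda>U. bas (g, U)) y))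
      = cns (g + t i) (antisymmetrize n (contr i y)) - cns g (antisymmetrize n (contr i y))" for i
  proof -
    have "kdiff i (ext (\<lambda>U. bas (g, U)) y) = ext (\<lambda>U. bas (g + t i, U) - bas (g, U)) (contr i y)"
      unfolding kdiff_def act_snd_ext[OF klin_contr]
      by (rule klin_eqI[where p = "contr i y"]) (auto intro!: klin_intros simp: act_bas differ_def)
    also have "\<dots> = ext (\<lambda>U. bas (g + t i, U)) (contr i y) - ext (\<lambda>U. bas (g, U)) (contr i y)"
      by (rule klin_eqI[where p = "contr i y"]) (auto intro!: klin_intros)
    finally show ?thesis using contr_nsets[OF assms, of i] by (simp add: koszul_to_bar_act)
  qed
  then show ?thesis
    by (simp add: koszul_d_def contr_all_def sum_subtractf klin_sum[OF klin_antisym])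
qed

lemma bar_koszul_to_bar:
  fixes p :: "'g \<times> nat set \<Rightarrow>\<^sub>0 'k::field_char_0"
  assumes "p \<in> fsupp (kdeg n)"
  shows "bar (koszul_to_bar p) = koszul_to_bar (koszul_d m p) + (if n = 0 then ext (\<lambda>_. bas []) p else 0)"
proof (rule klin_eq_on[OF _ _ assms])
  show "klin (\<lambda>p :: 'g \<times> nat set \<Rightarrow>\<^sub>0 'k. koszul_to_bar (koszul_d m p) + (if n = 0 then ext (\<lambda>_. bas []) p else 0))"
    by (cases "n = 0") (simp; intro klin_intros)+
  fix x :: "'g \<times> nat set" assume x: "x \<in> kdeg n"
  obtain g S where gS: "x = (g, S)" by (cases x)
  with x have S: "S \<in> nsets m n" by (simp add: kdeg_def)
  have sup: "bas S \<in> (fsupp (nsets m n) :: (nat set \<Rightarrow>\<^sub>0 'k) set)" using S by simp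
  show "bar (koszul_to_bar (bas x)) = koszul_to_bar (koszul_d m (bas x))
      + (if n = 0 then ext (\<lambda>_. bas []) (bas x) else (0 :: 'g list \<Rightarrow>\<^sub>0 'k))"
  proof (cases n)
    case 0
    then have "S = {}" using S by (auto simp: nsets_def dest: finite_subset[OF _ finite_lessThan])
    moreover have "kdiff i (bas (g, {})) = (0 :: 'g \<times> nat set \<Rightarrow>\<^sub>0 'k)" for i
      by (simp add: kdiff_def act_bas contr_bas)
    ultimately show ?thesis using 0 by (simp add: gS koszul_to_bar_def koszul_d_def)
  next
    case (Suc k)
    have c: "card S = Suc k" using S Suc by (simp add: nsets_def)
    have *: "koszul_to_bar (koszul_d m (bas x)) = (\<Sum>i<m. cns (g + t i) (antisymmetrize k (contr i (bas S))))
        - cns g (antisymmetrize k (contr_all (bas S :: nat set \<Rightarrow>\<^sub>0 'k)))"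
      using koszul_to_bar_d[of "bas S :: nat set \<Rightarrow>\<^sub>0 'k" k g] sup Suc by (simp add: gS)
    have "bar (koszul_to_bar (bas x)) = shift_hd g (antisymmetrize (Suc k) (bas S))
        - cns g (bar (antisymmetrize (Suc k) (bas S :: nat set \<Rightarrow>\<^sub>0 'k)))"
      by (simp add: gS koszul_to_bar_def c del: antisymmetrize.simps)
    also have "\<dots> = koszul_to_bar (koszul_d m (bas x))"
      by (simp only: bar_antisym *) simp
    finally show ?thesis using Suc by simp
  qed
qed (intro klin_intros)

text \<open>
  The deviation of the round trip from the identity, and the chain homotopy that it yields by
  contracting the bar resolution.  The latter is equivariant, hence determined by its values on
  lists with leading entry \<open>0\<close>.
\<close>

definition deviation :: "('g list \<Rightarrow>\<^sub>0 'k::field) \<Rightarrow> ('g list \<Rightarrow>\<^sub>0 'k)"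
  where "deviation = ext (\<lambda>l. if l = [] then 0 else bas l - koszul_to_bar (bar_to_koszul (bas l)))"

primrec bar_htpy0 :: "'g list \<Rightarrow> ('g list \<Rightarrow>\<^sub>0 'k::field)"
  where "bar_htpy0 [] = 0"
  | "bar_htpy0 (g # l) = cns 0 (deviation (bas (0 # g # l)) - shift_hd g (bar_htpy0 l))"

definition bar_htpy :: "('g list \<Rightarrow>\<^sub>0 'k::field) \<Rightarrow> ('g list \<Rightarrow>\<^sub>0 'k)"
  where "bar_htpy = ext (\<lambda>l. case l of [] \<Rightarrow> 0 | g # r \<Rightarrow> shift_hd g (bar_htpy0 r))"

lemma klin_htpy [klin_intros]: "klin deviation" "klin bar_htpy"
  by (simp_all add: deviation_def bar_htpy_def klin_ext)

lemmas [klin_intros] = klin_htpy[THEN klin_comp]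
lemmas htpy_simps [simp] = klin_simps[OF klin_htpy(1)] klin_simps[OF klin_htpy(2)]

lemma htpy_bas [simp]:
  "deviation (bas []) = 0" "bar_htpy (bas []) = 0"
  "bar_htpy (bas (g # r)) = shift_hd g (bar_htpy0 r)"
  by (simp_all add: deviation_def bar_htpy_def)

lemma deviation_bas: "l \<noteq> [] \<Longrightarrow> deviation (bas l) = bas l - koszul_to_bar (bar_to_koszul (bas l))"
  by (simp add: deviation_def)

lemma deviation_eq: "p \<in> fsupp (len (Suc n)) \<Longrightarrow> deviation p = p - koszul_to_bar (bar_to_koszul p)"
  by (rule klin_eq_on[where S = "len (Suc n)"]) (auto intro!: klin_intros deviation_bas simp: len_iff)

lemma deviation_shift_hd: "deviation (shift_hd a p) = shift_hd a (deviation p)"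
proof (rule klin_eqI[where p = p])
  fix l :: "'g list"
  show "deviation (shift_hd a (bas l)) = shift_hd a (deviation (bas l))"
    by (cases l) (simp_all add: deviation_bas flip: koszul_to_bar_ktrans)
qed (intro klin_intros)+

lemma bar_htpy_shift_hd: "bar_htpy (shift_hd a p) = shift_hd a (bar_htpy p)"
proof (rule klin_eqI[where p = p])
  fix l :: "'g list"
  show "bar_htpy (shift_hd a (bas l)) = shift_hd a (bar_htpy (bas l))"
    by (cases l) simp_all
qed (intro klin_intros)+

lemma bar_to_koszul_bas_deg: "bar_to_koszul (bas (g # r)) \<in> fsupp (kdeg (length r))"
  by (simp add: ktrans_def) (intro act_kdeg bar_to_koszul0_deg)

lemma koszul_d_bar_to_koszul:
  fixes p :: "'g list \<Rightarrow>\<^sub>0 'k::field"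
  shows "koszul_d m (bar_to_koszul p) = bar_to_koszul (bar p)"
proof (rule klin_eqI[where p = p])
  fix l :: "'g list"
  show "koszul_d m (bar_to_koszul (bas l)) = bar_to_koszul (bar (bas l :: 'g list \<Rightarrow>\<^sub>0 'k))"
  proof (cases l)
    case Nil
    then show ?thesis by (simp add: klin_zero[OF klin_koszul(1)])
  next
    case (Cons g r)
    have "koszul_d m (bar_to_koszul (bas l)) = bar_to_koszul (shift_hd g (bar (cns 0 (bas r :: 'g list \<Rightarrow>\<^sub>0 'k))))"
      by (simp only: Cons bar_to_koszul_bas ktrans_koszul_d koszul_d_bar_to_koszul0 bar_to_koszul_shift_hd)
    then show ?thesis using Cons by (simp only: flip: bar_shift_hd) simp
  qed
qed (intro klin_intros)+

lemma bar_deviation: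
  fixes p :: "'g list \<Rightarrow>\<^sub>0 'k::field_char_0"
  shows "bar (deviation p) = deviation (bar p)"
proof (rule klin_eqI[where p = p])
  fix l :: "'g list"
  show "bar (deviation (bas l)) = deviation (bar (bas l :: 'g list \<Rightarrow>\<^sub>0 'k))"
  proof (cases l)
    case Nil
    then show ?thesis by simp
  next
    case (Cons g r)
    let ?h = "bar_to_koszul (bas l) :: 'g \<times> nat set \<Rightarrow>\<^sub>0 'k"
    have ne: "l \<noteq> []" using Cons by simp
    have 1: "bar (deviation (bas l)) = bar (bas l) - koszul_to_bar (bar_to_koszul (bar (bas l)))
        - (if r = [] then ext (\<lambda>_. bas []) ?h else 0)"
      unfolding deviation_bas[OF ne] bar_ops_simps koszul_d_bar_to_koszul
        bar_koszul_to_bar[OF bar_to_koszul_bas_deg[of g r], folded Cons]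
      by (simp only: diff_diff_eq length_0_conv)
    show ?thesis
    proof (cases r)
      case Nil
      then show ?thesis using Cons unfolding 1 by simp
    next
      case (Cons b u)
      then have "bar (bas l :: 'g list \<Rightarrow>\<^sub>0 'k) \<in> fsupp (len (Suc (length u)))"
        using \<open>l = g # r\<close> by (intro bar_len) (simp add: len_iff)
      then show ?thesis using Cons unfolding 1 by (simp add: deviation_eq)
    qed
  qed
qed (intro klin_intros)+

lemma bar_htpy0_eq:
  fixes p :: "'g list \<Rightarrow>\<^sub>0 'k::field"
  shows "ext bar_htpy0 p = cns 0 (deviation (cns 0 p) - bar_htpy p)"
proof (rule klin_eqI[where p = p])
  fix l :: "'g list"
  show "ext bar_htpy0 (bas l) = cns 0 (deviation (cns 0 (bas l)) - bar_htpy (bas l :: 'g list \<Rightarrow>\<^sub>0 'k))"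
    by (cases l) (simp_all add: deviation_bas koszul_to_bar_def)
qed (intro klin_intros)+

lemma bar_htpy_cns: "bar_htpy (cns g p) = shift_hd g (ext bar_htpy0 p)"
  by (rule klin_eqI[where p = p]) (auto intro!: klin_intros)

text \<open>
  By induction on the length, as for the comparison map. The deviation commutes with the
  differential, so the boundary of \<open>?V\<close> is known from shorter lists, and inserting a zero
  contracts the bar resolution.
\<close>

lemma bar_bar_htpy0:
  "bar (bar_htpy0 l :: 'g list \<Rightarrow>\<^sub>0 'k::field_char_0)
    = deviation (cns 0 (bas l)) - bar_htpy (bar (cns 0 (bas l)))"
proof (induction l)
  case Nil
  then show ?case by (simp add: deviation_bas koszul_to_bar_def)
next
  case (Cons g l)
  let ?b = "bas (g # l) :: 'g list \<Rightarrow>\<^sub>0 'k"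
  let ?V = "deviation (cns 0 ?b) - bar_htpy ?b"
  have H: "bar (bar_htpy ?b) = deviation ?b - bar_htpy (bar ?b)"
  proof -
    have "bar (bar_htpy ?b) = shift_hd g (deviation (cns 0 (bas l)) - bar_htpy (bar (cns 0 (bas l))))"
      by (simp only: htpy_bas bar_shift_hd Cons)
    also have "\<dots> = deviation (shift_hd g (cns 0 (bas l))) - bar_htpy (bar (shift_hd g (cns 0 (bas l))))"
      by (simp only: bar_ops_simps deviation_shift_hd bar_htpy_shift_hd bar_shift_hd)
    finally show ?thesis by simp
  qed
  have V: "bar ?V = - (deviation (cns 0 (bar ?b)) - bar_htpy (bar ?b))"
    by (simp only: bar_ops_simps bar_deviation H bar_cns htpy_simps shift_hd_0) simp
  have "bar_htpy0 (g # l) = cns 0 ?V" by simp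
  then have "bar (bar_htpy0 (g # l)) = ?V - cns 0 (bar ?V)" by (simp only: bar_cns shift_hd_0)
  also have "cns 0 (bar ?V) = - ext bar_htpy0 (bar ?b)"
    unfolding V bar_htpy0_eq by (simp only: bar_ops_simps)
  also have "?V - - ext bar_htpy0 (bar ?b) = ?V + ext bar_htpy0 (bar ?b)" by simp
  also have "\<dots> = deviation (cns 0 ?b) - bar_htpy (bar (cns 0 ?b))"
    by (simp only: bar_cns htpy_simps bar_htpy_cns shift_hd_0 diff_diff_eq2 diff_add_eq)
  finally show ?case .
qed


section \<open>Homology of a free abelian group with coefficients in a character\<close>

text \<open>
  The images of the comparison maps and of the homotopy under \<open>aug \<psi>\<close>: the Koszul complex becomes
  the exterior algebra with the differential \<open>contr_chi \<psi>\<close>.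
\<close>

definition kaug :: "('g \<Rightarrow> 'k::field) \<Rightarrow> ('g \<times> nat set \<Rightarrow>\<^sub>0 'k) \<Rightarrow> (nat set \<Rightarrow>\<^sub>0 'k)"
  where "kaug \<psi> = ext (\<lambda>(g, S). \<psi> g *\<^sub>p bas S)"

definition to_ext :: "('g \<Rightarrow> 'k::field) \<Rightarrow> ('g list \<Rightarrow>\<^sub>0 'k) \<Rightarrow> (nat set \<Rightarrow>\<^sub>0 'k)"
  where "to_ext \<psi> = ext (\<lambda>l. kaug \<psi> (bar_to_koszul0 l))"

definition htpy :: "('g \<Rightarrow> 'k::field) \<Rightarrow> ('g list \<Rightarrow>\<^sub>0 'k) \<Rightarrow> ('g list \<Rightarrow>\<^sub>0 'k)"
  where "htpy \<psi> = ext (\<lambda>l. aug \<psi> (bar_htpy0 l))"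

definition from_ext :: "(nat set \<Rightarrow>\<^sub>0 'k::field) \<Rightarrow> ('g list \<Rightarrow>\<^sub>0 'k)"
  where "from_ext = ext (\<lambda>S. antisymmetrize (card S) (bas S))"

definition contr_chi :: "('g \<Rightarrow> 'k::field) \<Rightarrow> (nat set \<Rightarrow>\<^sub>0 'k) \<Rightarrow> (nat set \<Rightarrow>\<^sub>0 'k)"
  where "contr_chi \<psi> y = (\<Sum>i<m. (\<psi> (t i) - 1) *\<^sub>p contr i y)"

lemma klin_ext_ops [klin_intros]:
  "klin (kaug \<psi>)" "klin (to_ext \<psi>)" "klin (htpy \<psi>)" "klin from_ext" "klin (contr_chi \<psi>)"
  by (simp_all add: kaug_def to_ext_def htpy_def from_ext_def klin_ext)
    (auto simp: contr_chi_def[abs_def] intro!: klin_intros)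

lemmas [klin_intros] = klin_ext_ops[THEN klin_comp]
lemmas ext_ops_simps [simp] = klin_simps[OF klin_ext_ops(1)] klin_simps[OF klin_ext_ops(2)]
  klin_simps[OF klin_ext_ops(3)] klin_simps[OF klin_ext_ops(4)] klin_simps[OF klin_ext_ops(5)]

lemma to_ext_nsets: "p \<in> fsupp (len n) \<Longrightarrow> to_ext \<psi> p \<in> fsupp (nsets m n)"
  unfolding to_ext_def kaug_def
  by (erule ext_fsupp) (auto intro!: ext_fsupp[OF bar_to_koszul0_deg] simp: kdeg_def len_iff)

lemma from_ext_len: "y \<in> fsupp (nsets m n) \<Longrightarrow> from_ext y \<in> fsupp (len n)"
  unfolding from_ext_def by (erule ext_fsupp) (auto simp: nsets_def antisym_len)

lemma from_ext_eq: "y \<in> fsupp (nsets m n) \<Longrightarrow> from_ext y = antisymmetrize n y"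
  unfolding from_ext_def by (erule klin_eq_on[rotated 2]) (auto intro!: klin_intros simp: nsets_def)

lemma kaug_ktrans: "gchar \<psi> \<Longrightarrow> kaug \<psi> (ktrans g p) = \<psi> g *\<^sub>p kaug \<psi> p"
  by (rule klin_eqI[where p = p]) (auto intro!: klin_intros simp: kaug_def gchar_def)

lemma kaug_koszul_d:
  assumes "gchar \<psi>"
  shows "kaug \<psi> (koszul_d m p) = contr_chi \<psi> (kaug \<psi> p)"
proof -
  have "kaug \<psi> (kdiff i p) = (\<psi> (t i) - 1) *\<^sub>p contr i (kaug \<psi> p)" for i
  proof (rule klin_eqI[where p = p])
    fix x :: "'g \<times> nat set"
    obtain g S where x: "x = (g, S)" by (cases x)
    have "kaug \<psi> (kdiff i (bas x)) = ext (\<lambda>U. kaug \<psi> (bas (g + t i, U) - bas (g, U))) (contr i (bas S))"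
      unfolding kdiff_def x
      by (simp add: act_bas, rule klin_eqI[where p = "contr i (bas S)"])
        (auto intro!: klin_intros simp: act_bas differ_def)
    also have "\<dots> = (\<psi> g * (\<psi> (t i) - 1)) *\<^sub>p contr i (bas S)"
      using assms
      by (intro ext_eqI klin_intros) (simp add: kaug_def gchar_def pscale_distribs algebra_simps)
    finally show "kaug \<psi> (kdiff i (bas x)) = (\<psi> (t i) - 1) *\<^sub>p contr i (kaug \<psi> (bas x))"
      by (simp add: x kaug_def mult.commute)
  qed (intro klin_intros)+
  then show ?thesis by (simp add: koszul_d_def contr_chi_def)
qed

lemma aug_koszul_to_bar: "p \<in> fsupp (kdeg n) \<Longrightarrow> aug \<psi> (koszul_to_bar p) = from_ext (kaug \<psi> p)"
  by (rule klin_eq_on[where S = "kdeg n"])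
    (auto intro!: klin_intros simp: koszul_to_bar_def from_ext_def kaug_def)

lemma kaug_bar_to_koszul:
  assumes "gchar \<psi>"
  shows "kaug \<psi> (bar_to_koszul p) = to_ext \<psi> (aug \<psi> p)"
proof (rule klin_eqI[where p = p])
  fix l :: "'g list"
  show "kaug \<psi> (bar_to_koszul (bas l)) = to_ext \<psi> (aug \<psi> (bas l))"
    by (cases l) (simp_all add: kaug_ktrans[OF assms] to_ext_def)
qed (intro klin_intros)+

lemma aug_bar_htpy:
  assumes "gchar \<psi>"
  shows "aug \<psi> (bar_htpy p) = htpy \<psi> (aug \<psi> p)"
proof (rule klin_eqI[where p = p])
  fix l :: "'g list"
  show "aug \<psi> (bar_htpy (bas l)) = htpy \<psi> (aug \<psi> (bas l))"
    by (cases l) (simp_all add: aug_shift_hd[OF assms] htpy_def)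
qed (intro klin_intros)+

lemma aug_bar_cns0:
  assumes "gchar \<psi>"
  shows "aug \<psi> (bar (cns 0 p)) = - tbar \<psi> p"
  using aug_bar[OF assms, of "cns 0 p"] assms by (simp add: gchar_def)

text \<open>
  The homotopy formula on the bar resolution, applied to the generator \<open>0 # l\<close> and pushed forward
  along \<open>aug \<psi>\<close>; everything in it is equivariant, hence descends.
\<close>

theorem tbar_htpy:
  fixes p :: "'g list \<Rightarrow>\<^sub>0 'k::field_char_0"
  assumes \<psi>: "gchar \<psi>"
  shows "p - from_ext (to_ext \<psi> p) = - (tbar \<psi> (htpy \<psi> p) + htpy \<psi> (tbar \<psi> p))"
proof (rule klin_eqI[where p = p])
  fix l :: "'g list"
  let ?l = "bas l :: 'g list \<Rightarrow>\<^sub>0 'k"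
  have "aug \<psi> (bar (bar_htpy0 l)) = aug \<psi> (deviation (cns 0 ?l)) - aug \<psi> (bar_htpy (bar (cns 0 ?l)))"
    by (simp only: bar_bar_htpy0 aug_simps)
  then have "- tbar \<psi> (htpy \<psi> ?l) = aug \<psi> (deviation (cns 0 ?l)) + htpy \<psi> (tbar \<psi> ?l)"
    by (simp only: aug_bar[OF \<psi>] aug_bar_htpy[OF \<psi>] aug_bar_cns0[OF \<psi>]) (simp add: htpy_def \<psi>[unfolded gchar_def])
  moreover have "aug \<psi> (deviation (cns 0 ?l)) = ?l - from_ext (to_ext \<psi> ?l)"
  proof -
    have "aug \<psi> (koszul_to_bar (bar_to_koszul (bas (0 # l)))) = from_ext (to_ext \<psi> ?l)"
      using aug_koszul_to_bar[OF bar_to_koszul_bas_deg[of 0 l], of \<psi>] kaug_bar_to_koszul[OF \<psi>, of "bas (0 # l)"] \<psi>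
      by (simp add: gchar_def)
    then show ?thesis using \<psi> by (simp add: deviation_bas gchar_def)
  qed
  ultimately show "?l - from_ext (to_ext \<psi> ?l) = - (tbar \<psi> (htpy \<psi> ?l) + htpy \<psi> (tbar \<psi> ?l))"
    by (simp add: algebra_simps)
qed (intro klin_intros)+

lemma to_ext_tbar:
  assumes \<psi>: "gchar \<psi>"
  shows "to_ext \<psi> (tbar \<psi> p) = - contr_chi \<psi> (to_ext \<psi> p)"
proof (rule klin_eqI[where p = p])
  fix l :: "'g list"
  have "contr_chi \<psi> (to_ext \<psi> (bas l)) = kaug \<psi> (koszul_d m (bar_to_koszul0 l))"
    by (simp add: to_ext_def kaug_koszul_d[OF \<psi>])
  also have "\<dots> = to_ext \<psi> (aug \<psi> (bar (cns 0 (bas l))))"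
    by (simp only: koszul_d_bar_to_koszul0 kaug_bar_to_koszul[OF \<psi>])
  also have "\<dots> = - to_ext \<psi> (tbar \<psi> (bas l))" by (simp only: aug_bar_cns0[OF \<psi>] ext_ops_simps)
  finally show "to_ext \<psi> (tbar \<psi> (bas l)) = - contr_chi \<psi> (to_ext \<psi> (bas l))" by simp
qed (intro klin_intros)+

lemma tbar_from_ext:
  fixes y :: "nat set \<Rightarrow>\<^sub>0 'k::field_char_0"
  assumes \<psi>: "gchar \<psi>" and y: "y \<in> fsupp (nsets m n)"
  shows "tbar \<psi> (from_ext y) = - from_ext (contr_chi \<psi> y)"
proof (rule klin_eq_on[OF _ _ y])
  fix S assume S: "S \<in> nsets m n"
  let ?p = "bas (0, S) :: 'g \<times> nat set \<Rightarrow>\<^sub>0 'k"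
  have p: "?p \<in> fsupp (kdeg n)" using S by (simp add: kdeg_def)
  have d: "koszul_d m ?p \<in> fsupp (kdeg (n - 1))"
  proof (cases n)
    case 0
    then have "S = {}" using S by (auto simp: nsets_def dest: finite_subset[OF _ finite_lessThan])
    moreover have "kdiff i (bas (0 :: 'g, {})) = (0 :: 'g \<times> nat set \<Rightarrow>\<^sub>0 'k)" for i
      by (simp add: kdiff_def act_bas contr_bas)
    ultimately show ?thesis by (simp add: koszul_d_def)
  next
    case (Suc k)
    then show ?thesis unfolding koszul_d_def kdiff_def
      by (intro fsupp_sum act_kdeg(1) act_kdeg(2)[OF klin_contr _ p]) (simp add: contr_nsets)
  qed
  have k: "kaug \<psi> ?p = bas S" using \<psi> by (simp add: kaug_def gchar_def)
  have "- tbar \<psi> (from_ext (bas S)) = aug \<psi> (bar (koszul_to_bar ?p))"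
    by (simp only: aug_bar[OF \<psi>] aug_koszul_to_bar[OF p] k)
  also have "\<dots> = aug \<psi> (koszul_to_bar (koszul_d m ?p))"
    by (simp add: bar_koszul_to_bar[OF p])
  also have "\<dots> = from_ext (contr_chi \<psi> (bas S))"
    by (simp only: aug_koszul_to_bar[OF d] kaug_koszul_d[OF \<psi>] k)
  finally show "tbar \<psi> (from_ext (bas S)) = - from_ext (contr_chi \<psi> (bas S))"
    by (metis minus_minus)
qed (intro klin_intros)+

lemma htpy_len:
  fixes p :: "'g list \<Rightarrow>\<^sub>0 'k::field"
  shows "p \<in> fsupp (len n) \<Longrightarrow> htpy \<psi> p \<in> fsupp (len (Suc n))"
proof -
  have dev: "deviation (bas l :: 'g list \<Rightarrow>\<^sub>0 'k) \<in> fsupp (len (length l))" for l :: "'g list"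
  proof (cases l)
    case (Cons g r)
    have "koszul_to_bar (bar_to_koszul (bas l :: 'g list \<Rightarrow>\<^sub>0 'k)) \<in> fsupp (len (Suc (length r)))"
      unfolding koszul_to_bar_def Cons
      by (rule ext_fsupp[OF bar_to_koszul_bas_deg])
        (auto simp: kdeg_def nsets_def intro!: cns_len antisym_len)
    then show ?thesis using Cons by (simp add: deviation_bas)
  qed simp
  have "(bar_htpy0 l :: 'g list \<Rightarrow>\<^sub>0 'k) \<in> fsupp (len (Suc (Suc (length l))))" for l :: "'g list"
  proof (induction l)
    case (Cons g l)
    then show ?case using dev[of "0 # g # l"] by (simp add: cns_len shift_hd_len)
  qed simp
  then show "p \<in> fsupp (len n) \<Longrightarrow> htpy \<psi> p \<in> fsupp (len (Suc n))"
    unfolding htpy_def by (elim ext_fsupp) (auto simp: len_iff intro!: aug_len)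
qed

end


section \<open>The Hochschild complex of a twisted group algebra in a monomial basis\<close>

text \<open>
  The list \<open>[g\<^sub>0, \<dots>, g\<^sub>n]\<close> stands for the multiple of \<open>e\<^bsub>g\<^sub>0\<^esub> \<otimes> \<dots> \<otimes> e\<^bsub>g\<^sub>n\<^esub>\<close> that makes the inner faces
  free of cocycle factors.  The only trace of the cocycle is then the factor \<open>lam g\<^sub>n x\<close> of the last
  face and of the cyclic operator, where \<open>x = g\<^sub>0 + \<dots> + g\<^sub>n\<close>.
\<close>

locale twisted_lattice = lattice m \<phi> t
  for m :: nat and \<phi> :: "nat \<Rightarrow> 'g::ab_group_add \<Rightarrow> int" and t :: "nat \<Rightarrow> 'g" +
  fixes lam :: "'g \<Rightarrow> 'g \<Rightarrow> 'k::field_char_0"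
  assumes lam_add: "lam (g + h) x = lam g x * lam h x"
    and lam_zero [simp]: "lam 0 x = 1"
    and lam_zero_right [simp]: "lam g 0 = 1"
    and lam_self [simp]: "lam x x = 1"
begin

definition central :: "'g set"
  where "central = {x. \<forall>g. lam g x = 1}"

lemma lam_central [simp]: "x \<in> central \<Longrightarrow> lam g x = 1"
  by (simp add: central_def)

text \<open>
  The cyclic operator \<open>cyc\<close> includes the sign, so that the last Hochschild face, which multiplies
  the last entry into the first, is the first face after a rotation.
\<close>

definition hd_face :: "('g list \<Rightarrow>\<^sub>0 'k) \<Rightarrow> ('g list \<Rightarrow>\<^sub>0 'k)"
  where "hd_face = ext (\<lambda>l. case l of a # b # r \<Rightarrow> bas ((a + b) # r) | _ \<Rightarrow> 0)"

fun bprime0 :: "'g list \<Rightarrow> ('g list \<Rightarrow>\<^sub>0 'k)"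
  where "bprime0 [] = 0" | "bprime0 [a] = 0"
  | "bprime0 (a # b # r) = bas ((a + b) # r) - cns a (bprime0 (b # r))"

definition bprime :: "('g list \<Rightarrow>\<^sub>0 'k) \<Rightarrow> ('g list \<Rightarrow>\<^sub>0 'k)"
  where "bprime = ext bprime0"

definition cyc :: "('g list \<Rightarrow>\<^sub>0 'k) \<Rightarrow> ('g list \<Rightarrow>\<^sub>0 'k)"
  where "cyc = ext (\<lambda>l. if l = [] then 0
    else ((- 1) ^ (length l - 1) * lam (last l) (sum_list l)) *\<^sub>p bas (last l # butlast l))"

definition hoch :: "('g list \<Rightarrow>\<^sub>0 'k) \<Rightarrow> ('g list \<Rightarrow>\<^sub>0 'k)"
  where "hoch p = bprime p + hd_face (cyc p)"

lemma klin_hoch_ops [klin_intros]: "klin hd_face" "klin bprime" "klin cyc" "klin hoch"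
proof -
  show 1: "klin hd_face" "klin bprime" "klin cyc"
    by (simp_all add: hd_face_def bprime_def cyc_def klin_ext)
  show "klin hoch" unfolding hoch_def[abs_def] by (intro klin_intros 1 klin_comp[OF 1(1)])
qed

lemmas [klin_intros] = klin_hoch_ops[THEN klin_comp]
lemmas hoch_ops_simps [simp] = klin_simps[OF klin_hoch_ops(1)] klin_simps[OF klin_hoch_ops(2)]
  klin_simps[OF klin_hoch_ops(3)] klin_simps[OF klin_hoch_ops(4)]

lemma bprime_bas [simp]: "bprime (bas l) = bprime0 l"
  by (simp add: bprime_def)

lemma hd_face_bas [simp]:
  "hd_face (bas []) = 0" "hd_face (bas [a]) = 0" "hd_face (bas (a # b # r)) = bas ((a + b) # r)"
  by (simp_all add: hd_face_def)

lemma cyc_bas_Nil [simp]: "cyc (bas []) = 0"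
  by (simp add: cyc_def)

lemma cyc_bas_snoc: "cyc (bas (u @ [g])) = ((- 1) ^ length u * lam g (sum_list u + g)) *\<^sub>p bas (g # u)"
  by (simp add: cyc_def)

lemma cyc_bas_ne: "l \<noteq> [] \<Longrightarrow>
    cyc (bas l) = ((- 1) ^ (length l - 1) * lam (last l) (sum_list l)) *\<^sub>p bas (last l # butlast l)"
  by (simp add: cyc_def)

definition merge_at :: "nat \<Rightarrow> 'g list \<Rightarrow> 'g list"
  where "merge_at i l = take i l @ (l ! i + l ! Suc i) # drop (i + 2) l"

lemma merge_at_Cons [simp]: "merge_at 0 (a # b # r) = (a + b) # r" "merge_at (Suc i) (a # l) = a # merge_at i l"
  by (simp_all add: merge_at_def)

lemma bprime0_faces: "bprime0 l = (\<Sum>i<length l - 1. (- 1) ^ i *\<^sub>p bas (merge_at i l))"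
proof (induction l rule: bprime0.induct)
  case (3 a b r)
  show ?case
    by (simp add: 3 sum.lessThan_Suc_shift flip: sum_negf del: sum.lessThan_Suc)
qed simp_all

lemma cyc_funpow_append:
  "(cyc ^^ length v) (bas (u @ v))
    = (((- 1) ^ (length u + length v - 1)) ^ length v * lam (sum_list v) (sum_list (u @ v))) *\<^sub>p bas (v @ u)"
proof (induction v arbitrary: u rule: rev_induct)
  case (snoc g w)
  have k: "klin (cyc ^^ length w)" by (rule klin_funpow[OF klin_hoch_ops(3)])
  have "(cyc ^^ length (w @ [g])) (bas (u @ w @ [g])) = (cyc ^^ length w) (cyc (bas ((u @ w) @ [g])))"
    by (simp add: funpow_Suc_right del: funpow.simps)
  also have "\<dots> = ((- 1) ^ (length u + length w) * lam g (sum_list u + sum_list w + g))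
      *\<^sub>p (cyc ^^ length w) (bas ((g # u) @ w))"
    by (simp only: cyc_bas_snoc klin_scale[OF k]) simp
  also have "\<dots> = (((- 1) ^ (length u + length (w @ [g]) - 1)) ^ length (w @ [g])
      * lam (sum_list (w @ [g])) (sum_list (u @ w @ [g]))) *\<^sub>p bas ((w @ [g]) @ u)"
    by (simp only: snoc) (simp add: lam_add algebra_simps)
  finally show ?case by simp
qed simp

lemma cyc_funpow_length: "p \<in> fsupp (len n) \<Longrightarrow> (cyc ^^ n) p = p"
proof (rule klin_eq_on[where f = "cyc ^^ n" and g = "\<lambda>x. x" and S = "len n"])
  fix l :: "'g list" assume "l \<in> len n"
  then have "(cyc ^^ n) (bas l) = (((- 1) ^ (n - 1)) ^ n) *\<^sub>p bas l"
    using cyc_funpow_append[of l "[]"] by simp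
  also have "((- 1) ^ (n - 1)) ^ n = (1 :: 'k)"
    by (cases "even n") (auto elim!: oddE simp: power_mult[symmetric] uminus_power_if)
  finally show "(cyc ^^ n) (bas l) = bas l" by simp
qed (auto intro: klin_intros klin_funpow)

lemma cyc_len: "p \<in> fsupp (len n) \<Longrightarrow> cyc p \<in> fsupp (len n)"
  unfolding cyc_def by (erule ext_fsupp) auto

lemma cyc_funpow_len: "p \<in> fsupp (len n) \<Longrightarrow> (cyc ^^ i) p \<in> fsupp (len n)"
  by (induction i) (simp_all add: cyc_len)

lemma hd_face_len: "p \<in> fsupp (len (Suc n)) \<Longrightarrow> hd_face p \<in> fsupp (len n)"
  unfolding hd_face_def by (erule ext_fsupp) (auto split: list.split)

lemma bprime_len: "p \<in> fsupp (len (Suc n)) \<Longrightarrow> bprime p \<in> fsupp (len n)"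
  unfolding bprime_def
  by (erule ext_fsupp) (auto simp: bprime0_faces merge_at_def intro!: fsupp_sum fsupp_simps fsupp_single)

lemma hoch_len: "p \<in> fsupp (len (Suc n)) \<Longrightarrow> hoch p \<in> fsupp (len n)"
  by (simp add: hoch_def bprime_len hd_face_len cyc_len)

text \<open>
  All inner faces are cyclic conjugates of the first one: rotate the two entries to the front,
  merge them and rotate back. The two factors \<open>lam\<close> cancel because the total degree \<open>x\<close> has
  \<open>lam x x = 1\<close>.
\<close>

lemma cyc_face:
  assumes "length l = Suc n" "i < n"
  shows "(cyc ^^ i) (hd_face ((cyc ^^ (Suc n - i)) (bas l))) = (- 1) ^ i *\<^sub>p bas (merge_at i l)"
proof -
  define u v where "u = take i l" and "v = drop i l"
  have l: "l = u @ v" by (simp add: u_def v_def)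
  have lu: "length u = i" and lv: "length v = Suc n - i" using assms by (simp_all add: u_def v_def)
  then obtain a b r where v: "v = a # b # r"
    using assms by (metis Suc_diff_le length_Suc_conv less_imp_Suc_add less_imp_le_nat diff_add_inverse
        Suc_diff_Suc)
  have n: "n = i + Suc (length r)" using lv v assms by simp
  have k: "klin (cyc ^^ i)" by (rule klin_funpow[OF klin_hoch_ops(3)])
  let ?c = "((- 1) ^ n) ^ (Suc n - i) * lam (sum_list v) (sum_list l)"
  have "(cyc ^^ (Suc n - i)) (bas l) = ?c *\<^sub>p bas (v @ u)"
    using cyc_funpow_append[of v u] lu lv n v by (simp add: l)
  then have "(cyc ^^ i) (hd_face ((cyc ^^ (Suc n - i)) (bas l)))
      = ?c *\<^sub>p (cyc ^^ length u) (bas (((a + b) # r) @ u))"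
    by (simp add: v klin_scale[OF k] lu)
  also have "\<dots> = (?c * (((- 1) ^ (n - 1)) ^ i * lam (sum_list u) (sum_list l))) *\<^sub>p bas (u @ (a + b) # r)"
    by (subst cyc_funpow_append) (simp add: lu n l v add.assoc add.left_commute add.commute)
  also have "?c * (((- 1) ^ (n - 1)) ^ i * lam (sum_list u) (sum_list l)) = (- 1) ^ i"
  proof -
    have "lam (sum_list v) (sum_list l) * lam (sum_list u) (sum_list l) = 1"
      using lam_add[of "sum_list v" "sum_list u" "sum_list l"] by (simp add: l add.commute)
    moreover have "((- 1) ^ n) ^ (Suc n - i) * ((- 1) ^ (n - 1)) ^ i = ((- 1) ^ i :: 'k)"
    proof (cases "even n")
      case True
      then have "odd (n - 1)" using assms by (cases n) auto
      with True show ?thesis by simp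
    next
      case False
      then have "even (n - 1)" by simp
      moreover have "even (Suc n - i) \<longleftrightarrow> even i" using False assms by auto
      ultimately show ?thesis using False by (simp add: uminus_power_if)
    qed
    ultimately show ?thesis by (simp add: ac_simps)
  qed
  also have "u @ (a + b) # r = merge_at i l" by (simp add: l v merge_at_def lu[symmetric] nth_append)
  finally show ?thesis .
qed

lemma bprime_cyc:
  assumes "p \<in> fsupp (len (Suc n))"
  shows "bprime p = (\<Sum>i<n. (cyc ^^ i) (hd_face ((cyc ^^ (Suc n - i)) p)))"
proof (rule klin_eq_on[OF _ _ assms])
  show "klin (\<lambda>p. \<Sum>i<n. (cyc ^^ i) (hd_face ((cyc ^^ (Suc n - i)) p)))"
    by (intro klin_intros klin_comp[OF klin_funpow] klin_funpow)
qed (auto intro: klin_intros simp: bprime0_faces cyc_face)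

definition norm_op :: "nat \<Rightarrow> ('g list \<Rightarrow>\<^sub>0 'k) \<Rightarrow> ('g list \<Rightarrow>\<^sub>0 'k)"
  where "norm_op n p = (\<Sum>i<n. (cyc ^^ i) p)"

lemma klin_norm_op [klin_intros]: "klin (norm_op n)"
  unfolding norm_op_def[abs_def] by (intro klin_intros klin_funpow)

lemmas [klin_intros] = klin_comp[OF klin_norm_op]
lemmas norm_op_simps [simp] = klin_simps[OF klin_norm_op]

lemma norm_op_len: "p \<in> fsupp (len n) \<Longrightarrow> norm_op k p \<in> fsupp (len n)"
  unfolding norm_op_def by (intro fsupp_sum cyc_funpow_len)

lemma cyc_norm_op:
  assumes "p \<in> fsupp (len n)"
  shows "cyc (norm_op n p) = norm_op n p" "norm_op n (cyc p) = norm_op n p"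
proof -
  have "cyc (norm_op n p) = (\<Sum>i<n. (cyc ^^ Suc i) p)"
    by (simp add: norm_op_def)
  also have "\<dots> = norm_op n p"
    using sum.lessThan_Suc_shift[of "\<lambda>i. (cyc ^^ i) p" n] cyc_funpow_length[OF assms]
    by (simp add: norm_op_def)
  finally show 1: "cyc (norm_op n p) = norm_op n p" .
  then show "norm_op n (cyc p) = norm_op n p"
    by (simp add: norm_op_def funpow_swap1)
qed

lemma cyc_funpow_norm_op:
  assumes "p \<in> fsupp (len n)"
  shows "(cyc ^^ i) (norm_op n p) = norm_op n p" "norm_op n ((cyc ^^ i) p) = norm_op n p"
  using assms by (induction i) (simp_all add: cyc_norm_op cyc_funpow_len)

text \<open>Both sides are equal to the composite of the norm, the first face and the norm.\<close>

lemma bprime_norm_op: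
  assumes p: "p \<in> fsupp (len (Suc n))"
  shows "bprime (norm_op (Suc n) p) = norm_op n (hoch p)"
proof -
  have hN: "hd_face ((cyc ^^ j) p) \<in> fsupp (len n)" for j
    by (intro hd_face_len cyc_funpow_len p)
  have "bprime (norm_op (Suc n) p) = (\<Sum>i<n. (cyc ^^ i) (hd_face (norm_op (Suc n) p)))"
    by (subst bprime_cyc) (simp_all add: norm_op_len p cyc_funpow_norm_op)
  also have "\<dots> = norm_op n (hd_face (norm_op (Suc n) p))"
    by (simp add: norm_op_def)
  also have "\<dots> = norm_op n (hd_face ((\<Sum>i<n. (cyc ^^ (Suc n - i)) p) + cyc p))"
  proof (intro arg_cong[where f = "norm_op n"] arg_cong[where f = hd_face])
    have "(\<Sum>i<Suc n. (cyc ^^ Suc i) p) = norm_op (Suc n) p"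
      using cyc_norm_op(1)[OF p] by (simp add: norm_op_def)
    then have "norm_op (Suc n) p = (\<Sum>i<Suc n. (cyc ^^ Suc (Suc n - Suc i)) p)"
      using sum.nat_diff_reindex[of "\<lambda>i. (cyc ^^ Suc i) p" "Suc n"] by simp
    also have "\<dots> = (\<Sum>i<Suc n. (cyc ^^ (Suc n - i)) p)"
      by (intro sum.cong refl) (simp add: Suc_diff_le)
    finally show "norm_op (Suc n) p = (\<Sum>i<n. (cyc ^^ (Suc n - i)) p) + cyc p" by simp
  qed
  also have "\<dots> = (\<Sum>i<n. norm_op n ((cyc ^^ i) (hd_face ((cyc ^^ (Suc n - i)) p)))) + norm_op n (hd_face (cyc p))"
    by (simp add: cyc_funpow_norm_op hN)
  also have "\<dots> = norm_op n (hoch p)"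
    by (simp add: hoch_def bprime_cyc[OF p])
  finally show ?thesis .
qed

text \<open>
  By the conjugation formula for faces, \<open>bprime (cyc p)\<close> and \<open>cyc (bprime p)\<close> are sums over the
  same family \<open>f\<close> with indices shifted by one. They differ by its two extreme members, which are
  the last faces of \<open>p\<close> and of \<open>cyc p\<close>.
\<close>

lemma hoch_one_minus_cyc:
  assumes p: "p \<in> fsupp (len (Suc n))"
  shows "hoch (p - cyc p) = bprime p - cyc (bprime p)"
proof -
  have L: "(cyc ^^ Suc n) p = p" by (rule cyc_funpow_length[OF p])
  define f where "f i = (cyc ^^ i) (hd_face ((cyc ^^ (Suc (Suc n) - i)) p))" for i
  have 1: "cyc (bprime p) = (\<Sum>i<n. f (Suc i))"
    by (simp add: bprime_cyc[OF p] f_def del: funpow.simps(2)) simp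
  have "bprime (cyc p) = (\<Sum>i<n. f i)"
    unfolding bprime_cyc[OF cyc_len[OF p]] f_def
  proof (intro sum.cong refl)
    fix i assume "i \<in> {..<n}"
    then have "Suc (Suc n) - i = Suc (Suc n - i)" by simp
    then show "(cyc ^^ i) (hd_face ((cyc ^^ (Suc n - i)) (cyc p)))
        = (cyc ^^ i) (hd_face ((cyc ^^ (Suc (Suc n) - i)) p))"
      by (simp only: funpow_Suc_right o_apply)
  qed
  then have "cyc (bprime p) - bprime (cyc p) = f n - f 0"
    using 1 sum.lessThan_Suc_shift[of f n] by (simp add: algebra_simps)
  moreover have "f 0 = hd_face (cyc p)"
    using L by (simp add: f_def)
  moreover have "f n = hd_face (cyc (cyc p))"
  proof -
    have "hd_face ((cyc ^^ 2) p) \<in> fsupp (len n)" by (intro hd_face_len cyc_funpow_len p)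
    moreover have "Suc (Suc n) - n = 2" by simp
    ultimately show ?thesis using cyc_funpow_length unfolding f_def by (simp add: numeral_2_eq_2)
  qed
  ultimately show ?thesis by (simp add: hoch_def algebra_simps)
qed

text \<open>Inserting a unit contracts the odd columns.\<close>

lemma bprime_cns0:
  assumes "p \<in> fsupp (len (Suc n))"
  shows "bprime (cns 0 p) = p - cns 0 (bprime p)"
  by (rule klin_eq_on[OF _ _ assms]) (auto intro!: klin_intros simp: length_Suc_conv)

lemma bar0_bprime0: "l \<noteq> [] \<Longrightarrow> bar0 l = bprime0 l - (- 1) ^ length l *\<^sub>p bas (butlast l)"
  by (induction l rule: bprime0.induct) simp_all

lemma bprime_cns:
  assumes "p \<in> fsupp (len (Suc n))"
  shows "bprime (cns a p) = shift_hd a p - cns a (bprime p)"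
  by (rule klin_eq_on[OF _ _ assms]) (auto intro!: klin_intros simp: length_Suc_conv)

lemma bprime_shift_hd: "bprime (shift_hd a p) = shift_hd a (bprime p)"
proof (rule klin_eqI[where p = p])
  fix l show "bprime (shift_hd a (bas l)) = shift_hd a (bprime (bas l))"
    by (cases l rule: bprime0.cases) (simp_all add: add.assoc)
qed (intro klin_intros)+

lemma bprime_bprime0: "bprime (bprime0 l) = 0"
proof (induction l rule: bprime0.induct)
  case (3 a b r)
  show ?case
  proof (cases r)
    case (Cons c u)
    have "bprime0 (b # r) \<in> fsupp (len (Suc (length u)))"
      using bprime_len[of "bas (b # r)"] Cons by simp
    then have "bprime (cns a (bprime0 (b # r))) = shift_hd a (bprime0 (b # r)) - cns a (bprime (bprime0 (b # r)))"
      by (rule bprime_cns)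
    moreover have "bprime (bas ((a + b) # r)) = shift_hd a (bprime0 (b # r))"
      using bprime_shift_hd[of a "bas (b # r)"] by simp
    ultimately show ?thesis using 3 by simp
  qed simp
qed simp_all

lemma bprime_bprime [simp]: "bprime (bprime p) = 0"
  by (rule klin_eqI[where p = p and g = "\<lambda>_. 0"]) (auto intro!: klin_intros simp: bprime_bprime0)

text \<open>
  Forgetting the first entry identifies the part of total degree \<open>x\<close> with the bar complex with
  coefficients in the character \<open>g \<mapsto> lam (- g) x\<close>.
\<close>

definition psi :: "'g \<Rightarrow> 'g \<Rightarrow> 'k"
  where "psi x g = lam (- g) x"

definition fib :: "'g \<Rightarrow> 'g list set"
  where "fib x = {l. l \<noteq> [] \<and> sum_list l = x}"

definition unaug :: "'g \<Rightarrow> ('g list \<Rightarrow>\<^sub>0 'k) \<Rightarrow> ('g list \<Rightarrow>\<^sub>0 'k)"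
  where "unaug x = ext (\<lambda>l. lam (x - sum_list l) x *\<^sub>p bas ((x - sum_list l) # l))"

lemma klin_unaug [klin_intros]: "klin (unaug x)"
  by (simp add: unaug_def klin_ext)

lemmas [klin_intros] = klin_comp[OF klin_unaug]
lemmas unaug_simps [simp] = klin_simps[OF klin_unaug]

lemma lam_inverse: "lam g x * lam (- g) x = 1"
  using lam_add[of g "- g" x] by simp

lemma psi_add: "psi x (g + h) = psi x g * psi x h"
  using lam_add[of "- g" "- h" x] by (simp add: psi_def)

lemma lam_psi: "lam g x * psi x g = 1" "psi x g * lam g x = 1"
  using lam_inverse[of g x] by (simp_all add: psi_def mult.commute)

lemma gchar_psi: "gchar (psi x)"
  by (simp add: gchar_def psi_add) (simp add: psi_def)

lemma unaug_fib: "unaug x p \<in> fsupp (fib x)"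
  unfolding unaug_def by (rule ext_fsupp[of _ UNIV]) (auto simp: fib_def)

lemma unaug_len: "p \<in> fsupp (len n) \<Longrightarrow> unaug x p \<in> fsupp (len (Suc n))"
  unfolding unaug_def by (erule ext_fsupp) auto

lemma aug_unaug [simp]: "aug (psi x) (unaug x p) = p"
  by (rule klin_eqI[where p = p])
    (auto intro!: klin_intros simp: unaug_def lam_psi)

lemma unaug_aug: "p \<in> fsupp (fib x) \<Longrightarrow> unaug x (aug (psi x) p) = p"
  by (rule klin_eq_on[where f = "\<lambda>p. unaug x (aug (psi x) p)" and S = "fib x"])
    (auto intro!: klin_intros simp: fib_def neq_Nil_conv unaug_def lam_psi)

lemma bprime0_sum: "bprime0 l \<in> fsupp {l'. sum_list l' = sum_list l}"
proof (induction l rule: bprime0.induct)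
  case (3 a b r)
  then have "cns a (bprime0 (b # r)) \<in> fsupp {l'. sum_list l' = sum_list (a # b # r)}"
    unfolding cns_def by (rule ext_fsupp) auto
  then show ?case by (simp add: add.assoc)
qed simp_all

lemma cyc_fib: "cyc (bas l) \<in> fsupp {l'. sum_list l' = sum_list l}"
  by (cases l rule: rev_cases) (auto simp: cyc_def add.commute)

lemma hoch_sum: "hoch (bas l) \<in> fsupp {l'. sum_list l' = sum_list l}"
proof -
  have "hd_face (cyc (bas l)) \<in> fsupp {l'. sum_list l' = sum_list l}"
    unfolding hd_face_def
    by (rule ext_fsupp[OF cyc_fib]) (auto simp: add.assoc split: list.split)
  then show ?thesis by (simp add: hoch_def bprime0_sum)
qed

text \<open>
  The first face contributes \<open>psi x a * psi x b\<close>, and in the last face the factor \<open>lam\<close> cancels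
  the character value of the rotated entry, so that the remaining coefficient is that of the face
  dropping the last entry in the bar complex.
\<close>

lemma aug_hoch:
  assumes "p \<in> fsupp (fib x)"
  shows "aug (psi x) (hoch p) = - tbar (psi x) (aug (psi x) p)"
proof (rule klin_eq_on[OF _ _ assms])
  fix l assume "l \<in> fib x"
  then obtain a r where l: "l = a # r" and x: "x = a + sum_list r" by (auto simp: fib_def neq_Nil_conv)
  show "aug (psi x) (hoch (bas l)) = - tbar (psi x) (aug (psi x) (bas l))"
  proof (cases r)
    case Nil
    then show ?thesis by (simp add: l hoch_def cyc_bas_ne tbar_def)
  next
    case (Cons b u)
    have 1: "aug (psi x) (bprime0 l) = (psi x a * psi x b) *\<^sub>p bas u - psi x a *\<^sub>p bprime0 r"
      by (simp add: l Cons psi_add)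
    have 2: "aug (psi x) (hd_face (cyc (bas l)))
        = (- 1) ^ length r *\<^sub>p psi x a *\<^sub>p bas (butlast r)"
    proof -
      have "cyc (bas l) = ((- 1) ^ length r * lam (last r) x) *\<^sub>p bas (last r # a # butlast r)"
        by (simp add: cyc_bas_ne l Cons x)
      moreover have "lam (last r) x * psi x (last r + a) = psi x a"
        by (simp add: psi_add lam_psi flip: mult.assoc)
      ultimately show ?thesis by (simp add: mult.assoc)
    qed
    have "aug (psi x) (hoch (bas l)) = psi x a *\<^sub>p (psi x b *\<^sub>p bas u
        - (bprime0 r - (- 1) ^ length r *\<^sub>p bas (butlast r)))"
      by (simp add: hoch_def 1 2 pscale_distribs mult.commute)
    also have "\<dots> = psi x a *\<^sub>p (psi x b *\<^sub>p bas u - bar0 r)"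
      using bar0_bprime0[of r] Cons by simp
    also have "\<dots> = - tbar (psi x) (aug (psi x) (bas l))"
      by (simp add: l Cons tbar_def pscale_distribs)
    finally show ?thesis .
  qed
qed (intro klin_intros)+

lemma hoch_unaug:
  assumes "p \<in> fsupp (len n)"
  shows "hoch (unaug x p) = - unaug x (tbar (psi x) p)"
proof -
  have 1: "aug (psi x) (hoch (unaug x p)) = aug (psi x) (- unaug x (tbar (psi x) p))"
    by (simp add: aug_hoch[OF unaug_fib])
  have "hoch (unaug x p) \<in> fsupp (fib x)"
  proof (cases n)
    case 0
    have "hoch (unaug x p) = 0"
    proof (rule klin_eq_on[where f = "\<lambda>p. hoch (unaug x p)" and g = "\<lambda>_. 0" and S = "len n"])
      show "hoch (unaug x (bas l)) = 0" if "l \<in> len n" for l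
        using that 0 by (simp add: unaug_def hoch_def cyc_bas_ne)
    qed (use assms in \<open>auto intro!: klin_intros\<close>)
    then show ?thesis by simp
  next
    case (Suc k)
    have "hoch (unaug x p) \<in> fsupp (len (Suc k))"
      using hoch_len[OF unaug_len[OF assms]] Suc by simp
    moreover have "hoch (unaug x p) \<in> fsupp {l. sum_list l = x}"
      by (rule klin_fsupp[OF klin_hoch_ops(4) unaug_fib[of x p]])
        (use hoch_sum in \<open>auto simp: fib_def\<close>)
    ultimately show ?thesis by (auto simp: fsupp_def fib_def subset_iff)
  qed
  then have "hoch (unaug x p) = unaug x (aug (psi x) (hoch (unaug x p)))" by (simp add: unaug_aug)
  also have "\<dots> = - unaug x (tbar (psi x) p)" by (simp only: 1) simp
  finally show ?thesis .
qed

definition total_part :: "'g \<Rightarrow> ('g list \<Rightarrow>\<^sub>0 'k) \<Rightarrow> ('g list \<Rightarrow>\<^sub>0 'k)"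
  where "total_part x = ext (\<lambda>l. if sum_list l = x then bas l else 0)"

lemma klin_total_part [klin_intros]: "klin (total_part x)"
  by (simp add: total_part_def klin_ext)

lemmas [klin_intros] = klin_comp[OF klin_total_part]
lemmas total_part_simps [simp] = klin_simps[OF klin_total_part]

lemma total_part_commute:
  assumes "klin f" "\<And>l. f (bas l) \<in> fsupp {l'. sum_list l' = sum_list l}"
  shows "total_part x (f p) = f (total_part x p)"
proof (rule klin_eqI[where p = p])
  fix l
  have "total_part x (f (bas l)) = (if sum_list l = x then f (bas l) else 0)"
    by (rule klin_eq_on[where f = "total_part x" and g = "\<lambda>p. if sum_list l = x then p else 0", OF _ _ assms(2)])
      (auto intro!: klin_intros simp: total_part_def klin_def)
  then show "total_part x (f (bas l)) = f (total_part x (bas l))" by (simp add: total_part_def klin_zero[OF assms(1)])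
qed (intro klin_intros klin_comp[OF assms(1)] klin_comp[OF klin_total_part assms(1)])+

lemma total_part_sum: "p = (\<Sum>x\<in>sum_list ` Poly_Mapping.keys p. total_part x p)"
proof -
  define A where "A = sum_list ` Poly_Mapping.keys p"
  have "p = (\<Sum>x\<in>A. total_part x p)"
  proof (rule klin_eqI[where p = p and f = "\<lambda>p. p" and g = "\<lambda>p. \<Sum>x\<in>A. total_part x p"])
    fix l assume "l \<in> Poly_Mapping.keys p"
    then have "sum_list l \<in> A" "finite A" by (auto simp: A_def)
    moreover have "(\<Sum>x\<in>A. total_part x (bas l)) = (\<Sum>x\<in>A. if x = sum_list l then bas l else 0)"
      by (intro sum.cong) (auto simp: total_part_def)
    ultimately show "bas l = (\<Sum>x\<in>A. total_part x (bas l))" by simp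
  qed (intro klin_intros)+
  then show ?thesis by (simp add: A_def)
qed

lemma total_part_len: "p \<in> fsupp (len n) \<Longrightarrow> total_part x p \<in> fsupp (len n)"
  unfolding total_part_def by (erule ext_fsupp) auto

lemma total_part_fib: "p \<in> fsupp (len (Suc n)) \<Longrightarrow> total_part x p \<in> fsupp (fib x)"
  unfolding total_part_def by (erule ext_fsupp) (auto simp: fib_def intro!: fsupp_single)

end


section \<open>Antisymmetrization and Hochschild homology\<close>

context lattice
begin

definition wedge_vec :: "'g \<Rightarrow> (nat set \<Rightarrow>\<^sub>0 'k::field) \<Rightarrow> (nat set \<Rightarrow>\<^sub>0 'k)"
  where "wedge_vec g y = (\<Sum>i<m. of_int (\<phi> i g) *\<^sub>p wedge1 i y)"

primrec wedge_list :: "'g list \<Rightarrow> (nat set \<Rightarrow>\<^sub>0 'k::field)"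
  where "wedge_list [] = bas {}" | "wedge_list (g # r) = wedge_vec g (wedge_list r)"

lemma klin_wedge_vec [klin_intros]: "klin (wedge_vec g)"
  unfolding wedge_vec_def[abs_def] by (intro klin_intros)

lemmas [klin_intros] = klin_comp[OF klin_wedge_vec]
lemmas wedge_vec_simps [simp] = klin_simps[OF klin_wedge_vec]

lemma wedge_vec_add: "wedge_vec (g + h) y = wedge_vec g y + wedge_vec h y"
  by (simp add: wedge_vec_def pscale_distribs sum.distrib)

lemma wedge_vec_0 [simp]: "wedge_vec 0 y = 0"
  by (simp add: wedge_vec_def)

lemma wedge_vec_basis: "i < m \<Longrightarrow> wedge_vec (t i) y = wedge1 i y"
  by (simp add: wedge_vec_def coord_basis if_distrib if_distribR sum.delta cong: if_cong)

lemma wedge_vec_anticomm: "wedge_vec g (wedge_vec h y) = - wedge_vec h (wedge_vec g y)"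
proof -
  have e: "wedge_vec g (wedge_vec h y)
      = (\<Sum>i<m. \<Sum>j<m. (of_int (\<phi> i g) * of_int (\<phi> j h)) *\<^sub>p wedge1 i (wedge1 j y))" for g h
    by (simp add: wedge_vec_def pscale_sum_right)
  have "wedge_vec h (wedge_vec g y)
      = (\<Sum>i<m. \<Sum>j<m. (of_int (\<phi> i g) * of_int (\<phi> j h)) *\<^sub>p wedge1 j (wedge1 i y))"
    unfolding e by (subst sum.swap) (simp add: mult.commute)
  then have "wedge_vec g (wedge_vec h y) + wedge_vec h (wedge_vec g y) = 0"
    by (simp add: e wedge1_anticomm' flip: sum.distrib pscale_add_right)
  then show ?thesis by (simp add: eq_neg_iff_add_eq_0)
qed

lemma wedge_vec_self [simp]: "wedge_vec g (wedge_vec g y) = (0 :: nat set \<Rightarrow>\<^sub>0 'k::field_char_0)"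
  by (rule eq_uminus_imp_0) (rule wedge_vec_anticomm)

lemma wedge_vec_nsets: "y \<in> fsupp (nsets m n) \<Longrightarrow> wedge_vec g y \<in> fsupp (nsets m (Suc n))"
  unfolding wedge_vec_def by (intro fsupp_sum fsupp_simps wedge1_nsets) auto

lemma wedge_list_nsets: "wedge_list l \<in> fsupp (nsets m (length l))"
  by (induction l) (simp_all add: wedge_vec_nsets, simp add: nsets_def)

lemma contr_wedge_vec: "j < m \<Longrightarrow> contr j (wedge_vec g y) = of_int (\<phi> j g) *\<^sub>p y - wedge_vec g (contr j y)"
proof -
  assume j: "j < m"
  have "contr j (of_int (\<phi> i g) *\<^sub>p wedge1 i y)
      = (if i = j then of_int (\<phi> j g) *\<^sub>p y else 0) - of_int (\<phi> i g) *\<^sub>p wedge1 i (contr j y)" for i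
    by (simp add: contr_wedge1_self contr_wedge1_anticomm pscale_distribs)
  then show ?thesis using j by (simp add: wedge_vec_def sum_subtractf)
qed

text \<open>With the sign in \<open>cyc\<close>, this makes the wedge product of all entries invariant under rotation.\<close>

lemma wedge_list_snoc:
  "wedge_list (u @ [g]) = (- 1) ^ length u *\<^sub>p (wedge_list (g # u) :: nat set \<Rightarrow>\<^sub>0 'k::field)"
proof (induction u)
  case (Cons a u)
  have "wedge_list ((a # u) @ [g])
      = (- 1) ^ length u *\<^sub>p wedge_vec a (wedge_vec g (wedge_list u) :: nat set \<Rightarrow>\<^sub>0 'k)"
    using Cons by simp
  then show ?case by (simp add: wedge_vec_anticomm[of a g])
qed simp

lemma wedge_list_mem: "g \<in> set l \<Longrightarrow> wedge_vec g (wedge_list l) = (0 :: nat set \<Rightarrow>\<^sub>0 'k::field_char_0)"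
proof (induction l)
  case (Cons a l)
  show ?case
  proof (cases "g = a")
    case False
    with Cons show ?thesis by (simp add: wedge_vec_anticomm[of g a])
  qed simp
qed simp

lemma wedge_list_sum: "wedge_vec (sum_list l) (wedge_list l) = (0 :: nat set \<Rightarrow>\<^sub>0 'k::field_char_0)"
proof -
  have "set u \<subseteq> set l \<Longrightarrow> wedge_vec (sum_list u) (wedge_list l) = (0 :: nat set \<Rightarrow>\<^sub>0 'k)" for u
    by (induction u) (simp_all add: wedge_vec_add wedge_list_mem)
  then show ?thesis by simp
qed

lemma wedge_cns: "ext wedge_list (cns g p) = wedge_vec g (ext wedge_list p)"
  by (rule klin_eqI[where p = p]) (auto intro!: klin_intros)

lemma wedge_antisymmetrize:
  "y \<in> fsupp (nsets m n) \<Longrightarrow> ext wedge_list (antisymmetrize n y) = of_nat (fact n) *\<^sub>p y"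
proof (induction n arbitrary: y)
  case 0
  show ?case
    by (rule klin_eq_on[OF _ _ 0])
      (auto intro!: klin_intros simp: nsets_def dest: finite_subset[OF _ finite_lessThan])
next
  case (Suc n)
  have "ext wedge_list (antisymmetrize (Suc n) y) = (\<Sum>i<m. wedge1 i (of_nat (fact n) *\<^sub>p contr i y))"
    by (simp add: wedge_cns wedge_vec_basis contr_nsets[OF Suc.prems] Suc.IH)
  also have "\<dots> = of_nat (fact n) *\<^sub>p (\<Sum>i<m. wedge1 i (contr i y))" by (simp add: pscale_sum_right)
  also have "\<dots> = of_nat (fact (Suc n)) *\<^sub>p y"
    by (simp add: number_operator[OF Suc.prems] algebra_simps)
  finally show ?case .
qed

text \<open>The faces telescope because \<open>(g + h) \<and> \<dots> = g \<and> \<dots> + h \<and> \<dots>\<close>.\<close>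

lemma wedge_bar0: "ext wedge_list (bar0 (g # r)) = (wedge_list r :: nat set \<Rightarrow>\<^sub>0 'k::field)"
proof (induction r arbitrary: g)
  case (Cons b u)
  have "ext wedge_list (bar0 (g # b # u)) = wedge_vec (g + b) (wedge_list u)
      - wedge_vec g (ext wedge_list (bar0 (b # u)) :: nat set \<Rightarrow>\<^sub>0 'k)"
    by (subst bar0.simps(2)) (simp only: ext_simps wedge_cns, simp)
  then show ?case by (simp only: Cons) (simp add: wedge_vec_add)
qed simp

definition nwedge :: "('g list \<Rightarrow>\<^sub>0 'k::field_char_0) \<Rightarrow> (nat set \<Rightarrow>\<^sub>0 'k)"
  where "nwedge = ext (\<lambda>l. (1 / fact (length l)) *\<^sub>p wedge_list l)"

lemma klin_nwedge [klin_intros]: "klin nwedge"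
  by (simp add: nwedge_def klin_ext)

lemmas [klin_intros] = klin_comp[OF klin_nwedge]
lemmas nwedge_simps [simp] = klin_simps[OF klin_nwedge]

lemma nwedge_bas: "nwedge (bas l) = (1 / fact (length l)) *\<^sub>p wedge_list l"
  by (simp add: nwedge_def)

lemma nwedge_len: "p \<in> fsupp (len n) \<Longrightarrow> nwedge p = (1 / fact n) *\<^sub>p ext wedge_list p"
  by (erule klin_eq_on[rotated 2]) (auto intro!: klin_intros simp: nwedge_bas)

lemma nwedge_nsets: "p \<in> fsupp (len n) \<Longrightarrow> nwedge p \<in> fsupp (nsets m n)"
  unfolding nwedge_def by (erule ext_fsupp) (auto simp: wedge_list_nsets)

lemma nwedge_from_ext: "y \<in> fsupp (nsets m n) \<Longrightarrow> nwedge (from_ext y) = y"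
  by (simp add: from_ext_eq nwedge_len[OF antisym_len] wedge_antisymmetrize)

lemma nwedge_tbar: "nwedge (tbar (\<lambda>_. 1) p) = 0"
proof (rule klin_eqI[where p = p and f = "\<lambda>p. nwedge (tbar (\<lambda>_. 1) p)" and g = "\<lambda>_. 0"])
  fix l :: "'g list"
  show "nwedge (tbar (\<lambda>_. 1) (bas l)) = 0"
  proof (cases l)
    case (Cons g r)
    have "nwedge (bar0 l) = (1 / fact (length r)) *\<^sub>p wedge_list r"
      using nwedge_len[OF bar0_len, of l "length r"] Cons by (simp only: wedge_bar0) simp
    then show ?thesis using Cons by (simp add: tbar_def nwedge_bas del: bar0.simps)
  qed (simp add: tbar_def)
qed (intro klin_intros)+

text \<open>A nontrivial character is thus nontrivial on some \<open>t i\<close>, which makes \<open>contr_chi \<psi>\<close> contractible.\<close>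

lemma char_trivial:
  assumes "gchar \<psi>" "\<And>i. i < m \<Longrightarrow> \<psi> (t i) = 1"
  shows "\<psi> g = 1"
proof -
  have add: "\<psi> (g + h) = \<psi> g * \<psi> h" and zero: "\<psi> 0 = 1" for g h
    using assms(1) by (auto simp: gchar_def)
  have nm: "\<psi> (nmul n (t i)) = 1" if "i < m" for i n
    using assms(2)[OF that] by (induction n) (simp_all add: add zero)
  have "\<psi> (clear_coord i g) = \<psi> g" if "i < m" for i g
  proof -
    have "\<psi> (g - nmul n (t i)) * \<psi> (nmul n (t i)) = \<psi> g" for n
      by (simp flip: add)
    then show ?thesis by (simp add: clear_coord_def add nm[OF that])
  qed
  then have "n \<le> m \<Longrightarrow> \<psi> (foldr clear_coord (rev [0..<n]) g) = \<psi> g" for n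
    by (induction n) auto
  moreover have "foldr clear_coord (rev [0..<m]) g = 0"
    by (rule coords_eq_0) (simp add: foldr_clear_coord)
  ultimately show ?thesis using zero by (metis order_refl)
qed

end

context twisted_lattice
begin

definition emb :: "'g \<Rightarrow> (nat set \<Rightarrow>\<^sub>0 'k) \<Rightarrow> ('g \<times> nat set \<Rightarrow>\<^sub>0 'k)"
  where "emb x = ext (\<lambda>S. bas (x, S))"

lemma klin_emb [klin_intros]: "klin (emb x)"
  by (simp add: emb_def klin_ext)

lemmas [klin_intros] = klin_comp[OF klin_emb]
lemmas emb_simps [simp] = klin_simps[OF klin_emb]

lemma emb_bas: "emb x (bas S) = bas (x, S)"
  by (simp add: emb_def)

lemma emb_inj: "emb x y = 0 \<Longrightarrow> y = 0"
proof -
  have "ext (\<lambda>(z, S). if z = x then bas S else 0) (emb x y) = y"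
    by (rule klin_eqI[where p = y]) (auto intro!: klin_intros simp: emb_bas)
  moreover assume "emb x y = 0"
  ultimately show ?thesis by simp
qed

lemma emb_fsupp: "x \<in> A \<Longrightarrow> y \<in> fsupp S \<Longrightarrow> emb x y \<in> fsupp (A \<times> S)"
  unfolding emb_def by (erule ext_fsupp) auto

text \<open>
  In terms of differential forms, \<open>hkr\<close> sends \<open>a\<^sub>0 \<otimes> \<dots> \<otimes> a\<^sub>n\<close> to \<open>a\<^sub>0 da\<^sub>1 \<dots> da\<^sub>n / n!\<close>, and
  \<open>hkr_d\<close> sends it to \<open>da\<^sub>0 da\<^sub>1 \<dots> da\<^sub>n / (n + 1)!\<close>, on a torus whose coordinate functions have the
  logarithmic differentials \<open>e\<^sub>i\<close>.
\<close>

definition hkr :: "('g list \<Rightarrow>\<^sub>0 'k) \<Rightarrow> ('g \<times> nat set \<Rightarrow>\<^sub>0 'k)"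
  where "hkr = ext (\<lambda>l. if l \<noteq> [] \<and> sum_list l \<in> central
    then emb (sum_list l) (nwedge (bas (tl l))) else 0)"

definition hkr_d :: "('g list \<Rightarrow>\<^sub>0 'k) \<Rightarrow> ('g \<times> nat set \<Rightarrow>\<^sub>0 'k)"
  where "hkr_d = ext (\<lambda>l. if l \<noteq> [] \<and> sum_list l \<in> central
    then emb (sum_list l) (nwedge (bas l)) else 0)"

definition wedge_total :: "('g \<times> nat set \<Rightarrow>\<^sub>0 'k) \<Rightarrow> ('g \<times> nat set \<Rightarrow>\<^sub>0 'k)"
  where "wedge_total = ext (\<lambda>(x, S). emb x (wedge_vec x (bas S)))"

lemma klin_hkr [klin_intros]: "klin hkr" "klin hkr_d" "klin wedge_total"
  by (simp_all add: hkr_def hkr_d_def wedge_total_def klin_ext)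

lemmas [klin_intros] = klin_hkr[THEN klin_comp]
lemmas hkr_simps [simp] = klin_simps[OF klin_hkr(1)] klin_simps[OF klin_hkr(2)]
  klin_simps[OF klin_hkr(3)]

lemma hkr_bas: "hkr (bas l) = (if l \<noteq> [] \<and> sum_list l \<in> central
    then emb (sum_list l) (nwedge (bas (tl l))) else 0)"
  and hkr_d_bas: "hkr_d (bas l) = (if l \<noteq> [] \<and> sum_list l \<in> central
    then emb (sum_list l) (nwedge (bas l)) else 0)"
  by (simp_all add: hkr_def hkr_d_def)

lemma wedge_total_emb: "wedge_total (emb x y) = emb x (wedge_vec x y)"
  by (rule klin_eqI[where p = y]) (auto intro!: klin_intros simp: wedge_total_def emb_bas)

lemma psi_central: "x \<in> central \<Longrightarrow> psi x = (\<lambda>_. 1)"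
  by (simp add: psi_def fun_eq_iff)

lemma hkr_fib: "p \<in> fsupp (fib x) \<Longrightarrow>
    hkr p = (if x \<in> central then emb x (nwedge (aug (psi x) p)) else 0)"
proof (rule klin_eq_on[where f = hkr and S = "fib x" and p = p])
  show "klin (\<lambda>p. if x \<in> central then emb x (nwedge (aug (psi x) p)) else 0)"
    by (cases "x \<in> central") (simp; intro klin_intros)+
  fix l assume "l \<in> fib x"
  then show "hkr (bas l) = (if x \<in> central then emb x (nwedge (aug (psi x) (bas l))) else 0)"
    by (auto simp: hkr_bas fib_def neq_Nil_conv psi_central)
qed (auto intro: klin_intros)

lemma hkr_fsupp: "p \<in> fsupp (len (Suc n)) \<Longrightarrow> hkr p \<in> fsupp (central \<times> nsets m n)"
  unfolding hkr_def by (erule ext_fsupp) (auto intro!: emb_fsupp nwedge_nsets)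

lemma hoch_fib: "p \<in> fsupp (fib x) \<Longrightarrow> p \<in> fsupp (len (Suc (Suc n))) \<Longrightarrow> hoch p \<in> fsupp (fib x)"
proof -
  assume p: "p \<in> fsupp (fib x)" "p \<in> fsupp (len (Suc (Suc n)))"
  have "hoch p \<in> fsupp {l. sum_list l = x}"
    by (rule klin_fsupp[OF klin_hoch_ops(4) p(1)]) (use hoch_sum in \<open>auto simp: fib_def\<close>)
  with hoch_len[OF p(2)] show ?thesis by (auto simp: fsupp_def fib_def subset_iff)
qed

lemma hkr_hoch:
  assumes p: "p \<in> fsupp (len (Suc (Suc n)))"
  shows "hkr (hoch p) = 0"
proof (rule klin_eq_on[where f = "\<lambda>p. hkr (hoch p)" and g = "\<lambda>_. 0", OF _ _ p])
  fix l :: "'g list" assume l: "l \<in> len (Suc (Suc n))"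
  then have f: "bas l \<in> (fsupp (fib (sum_list l)) :: ('g list \<Rightarrow>\<^sub>0 'k) set)" by (auto simp: fib_def intro!: fsupp_single)
  have "hoch (bas l) \<in> fsupp (fib (sum_list l))" using hoch_fib[OF f, of n] l by simp
  then show "hkr (hoch (bas l)) = 0"
    by (simp only: hkr_fib aug_hoch[OF f]) (simp add: psi_central nwedge_tbar)
qed (intro klin_intros)+

text \<open>For a central total degree the character is trivial, so antisymmetrized elements are cycles.\<close>

lemma hkr_section:
  assumes "v \<in> fsupp (central \<times> nsets m n)"
  shows "\<exists>z \<in> fsupp (len (Suc n)). hoch z = 0 \<and> hkr z = v"
proof -
  define z where "z = ext (\<lambda>(x, S). unaug x (from_ext (bas S))) v"
  have "z \<in> fsupp (len (Suc n))"
    unfolding z_def by (rule ext_fsupp[OF assms]) (auto intro!: unaug_len from_ext_len)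
  moreover have "hoch z = 0" unfolding z_def
  proof (rule klin_eq_on[where f = "\<lambda>v. hoch (ext (\<lambda>(x, S). unaug x (from_ext (bas S))) v)" and g = "\<lambda>_. 0", OF _ _ assms])
    fix xS assume "xS \<in> central \<times> nsets m n"
    then obtain x S where x: "xS = (x, S)" "x \<in> central" and S: "bas S \<in> (fsupp (nsets m n) :: (nat set \<Rightarrow>\<^sub>0 'k) set)"
      by (auto intro: fsupp_single)
    have "contr_chi (\<lambda>_. 1 :: 'k) (bas S) = 0" by (simp add: contr_chi_def)
    then show "hoch (ext (\<lambda>(x, S). unaug x (from_ext (bas S))) (bas xS)) = 0"
      using tbar_from_ext[OF gchar_psi[of x] S] x
      by (simp add: hoch_unaug[OF from_ext_len[OF S]] psi_central)
  qed (intro klin_intros)+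
  moreover have "hkr z = v" unfolding z_def
  proof (rule klin_eq_on[where g = "\<lambda>v. v", OF _ _ assms])
    fix xS assume "xS \<in> central \<times> nsets m n"
    then obtain x S where x: "xS = (x, S)" "x \<in> central" and S: "bas S \<in> (fsupp (nsets m n) :: (nat set \<Rightarrow>\<^sub>0 'k) set)"
      by (auto intro: fsupp_single)
    then show "hkr (ext (\<lambda>(x, S). unaug x (from_ext (bas S))) (bas xS)) = bas xS"
      by (simp add: hkr_fib[OF unaug_fib] nwedge_from_ext[OF S] emb_bas)
  qed (intro klin_intros)+
  ultimately show ?thesis by blast
qed

text \<open>
  In the degree of \<open>z\<close>, the chain homotopy writes \<open>z\<close> as a boundary plus an antisymmetrized class.
  If \<open>x\<close> is central, this class vanishes because \<open>hkr\<close> detects it; otherwise it is itself a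
  boundary by contractibility of \<open>contr_chi (psi x)\<close>.
\<close>

lemma hkr_kernel_fib:
  assumes zf: "z \<in> fsupp (fib x)" and zl: "z \<in> fsupp (len (Suc n))" and "hoch z = 0" "hkr z = 0"
  shows "\<exists>y \<in> fsupp (len (Suc (Suc n))). hoch y = z \<and> hkr y = 0"
proof -
  define q where "q = aug (psi x) z"
  have q: "q \<in> fsupp (len n)" unfolding q_def by (rule aug_len[OF zl])
  have tq: "tbar (psi x) q = 0" using aug_hoch[OF zf] assms(3) by (simp add: q_def)
  have z: "unaug x q = z" unfolding q_def by (rule unaug_aug[OF zf])
  have h: "q - from_ext (to_ext (psi x) q) = - tbar (psi x) (htpy (psi x) q)"
    using tbar_htpy[OF gchar_psi, of q x] by (simp add: tq)
  have te: "to_ext (psi x) q \<in> fsupp (nsets m n)" by (rule to_ext_nsets[OF q])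
  have hl: "htpy (psi x) q \<in> fsupp (len (Suc n))" by (rule htpy_len[OF q])
  show ?thesis
  proof (cases "x \<in> central")
    case True
    have "emb x (nwedge q) = 0" using assms(4) True by (simp add: hkr_fib[OF zf] q_def)
    then have "nwedge q = 0" by (rule emb_inj)
    moreover have "nwedge (q - from_ext (to_ext (psi x) q)) = 0"
      unfolding h unfolding psi_central[OF True] by (simp add: nwedge_tbar)
    ultimately have te0: "to_ext (psi x) q = 0"
      by (simp add: nwedge_from_ext[OF te])
    have qh: "q = - tbar (psi x) (htpy (psi x) q)"
      unfolding h[symmetric] te0 by simp
    define y0 where "y0 = htpy (psi x) q"
    have y0: "nwedge y0 \<in> fsupp (nsets m (Suc n))" unfolding y0_def by (rule nwedge_nsets[OF hl])
    \<comment> \<open>Subtracting an antisymmetrized element, which is a cycle, moves the bounding chain into the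
       kernel of \<open>hkr\<close>.\<close>
    define y where "y = unaug x (y0 - from_ext (nwedge y0))"
    have yl: "y0 - from_ext (nwedge y0) \<in> fsupp (len (Suc n))"
      using hl from_ext_len[OF y0] by (simp add: y0_def)
    have "tbar (psi x) (from_ext (nwedge y0)) = 0"
      using tbar_from_ext[OF gchar_psi y0, of x] by (simp add: contr_chi_def psi_central True)
    then have e: "- tbar (psi x) (y0 - from_ext (nwedge y0)) = q"
      unfolding y0_def[symmetric] by (simp add: qh[folded y0_def, symmetric] \<open>tbar (psi x) (from_ext (nwedge y0)) = 0\<close>)
    have "hoch y = z"
      unfolding y_def hoch_unaug[OF yl] by (simp only: e z flip: unaug_simps(4))
    moreover have "hkr y = 0"
      unfolding y_def hkr_fib[OF unaug_fib] aug_unaug by (simp add: nwedge_from_ext[OF y0])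
    moreover have "y \<in> fsupp (len (Suc (Suc n)))" unfolding y_def by (rule unaug_len[OF yl])
    ultimately show ?thesis by (intro bexI[of _ y] conjI)
  next
    case False
    obtain i where i: "i < m" "psi x (t i) \<noteq> 1"
    proof -
      have "\<exists>i<m. psi x (t i) \<noteq> 1"
      proof (rule ccontr)
        assume *: "\<not> (\<exists>i<m. psi x (t i) \<noteq> 1)"
        have p1: "psi x g = 1" for g
          by (rule char_trivial[OF gchar_psi]) (use * in auto)
        have "lam g x = 1" for g
          using lam_psi(1)[of g x] unfolding p1 by simp
        then have "x \<in> central" unfolding central_def by blast
        then show False using False by contradiction
      qed
      then show ?thesis using that by blast
    qed
    \<comment> \<open>Wedging with \<open>e\<^sub>i\<close> and dividing by the nonzero coefficient of \<open>contr i\<close> is a contracting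
       homotopy.\<close>
    define a where "a = 1 / (psi x (t i) - 1)"
    have D: "contr_chi (psi x) (to_ext (psi x) q) = 0"
      using to_ext_tbar[OF gchar_psi, of x q] by (simp add: tq)
    define v where "v = a *\<^sub>p wedge1 i (to_ext (psi x) q)"
    have v: "v \<in> fsupp (nsets m (Suc n))" unfolding v_def using i te by (simp add: wedge1_nsets)
    have "contr_chi (psi x) v = to_ext (psi x) q"
    proof -
      have "(psi x (t j) - 1) *\<^sub>p contr j (wedge1 i w) = (if j = i then (psi x (t i) - 1) *\<^sub>p w else 0)
          - (psi x (t j) - 1) *\<^sub>p wedge1 i (contr j w)" for j w
        by (simp add: contr_wedge1_self contr_wedge1_anticomm pscale_diff_right)
      then have "contr_chi (psi x) (wedge1 i w)
          = (psi x (t i) - 1) *\<^sub>p w - wedge1 i (contr_chi (psi x) w)" for w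
        using i by (simp add: contr_chi_def sum_subtractf)
      then show ?thesis using D i by (simp add: v_def a_def)
    qed
    then have fv: "tbar (psi x) (from_ext v) = - from_ext (to_ext (psi x) q)"
      using tbar_from_ext[OF gchar_psi v, of x] by simp
    define y where "y = unaug x (htpy (psi x) q + from_ext v)"
    have yl: "htpy (psi x) q + from_ext v \<in> fsupp (len (Suc n))"
      using hl from_ext_len[OF v] by simp
    have "- tbar (psi x) (htpy (psi x) q + from_ext v)
        = (q - from_ext (to_ext (psi x) q)) + from_ext (to_ext (psi x) q)"
      unfolding h by (simp add: fv)
    then have e: "- tbar (psi x) (htpy (psi x) q + from_ext v) = q" by simp
    have "hoch y = z"
      unfolding y_def hoch_unaug[OF yl] by (simp only: e z flip: unaug_simps(4))
    moreover have "hkr y = 0" using False by (simp add: y_def hkr_fib[OF unaug_fib])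
    moreover have "y \<in> fsupp (len (Suc (Suc n)))" unfolding y_def by (rule unaug_len[OF yl])
    ultimately show ?thesis by (intro bexI[of _ y] conjI)
  qed
qed

text \<open>The complex and \<open>hkr\<close> split over the total degrees, of which a chain involves finitely many.\<close>

lemma hkr_kernel:
  assumes zl: "z \<in> fsupp (len (Suc n))" and z: "hoch z = 0" "hkr z = 0"
  shows "\<exists>y \<in> fsupp (len (Suc (Suc n))). hoch y = z \<and> hkr y = 0"
proof -
  have "\<exists>y \<in> fsupp (len (Suc (Suc n))). hoch y = total_part x z \<and> hkr y = 0" for x
  proof (rule hkr_kernel_fib)
    show "total_part x z \<in> fsupp (fib x)" "total_part x z \<in> fsupp (len (Suc n))"
      using zl by (rule total_part_fib total_part_len)+
    show "hoch (total_part x z) = 0"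
      using total_part_commute[OF klin_hoch_ops(4) hoch_sum, of x z] z by simp
    have "hkr (total_part x p) = ext (\<lambda>(x', S). if x' = x then bas (x', S) else 0) (hkr p)" for p
    proof (rule klin_eqI[where p = p])
      fix l
      have "ext (\<lambda>(x', S). if x' = x then bas (x', S) else 0) (emb x'' y) = (if x'' = x then emb x'' y else 0)" for x'' y
        by (rule klin_eqI[where p = y
              and f = "\<lambda>y. ext (\<lambda>(x', S). if x' = x then bas (x', S) else 0) (emb x'' y)"
              and g = "\<lambda>y. if x'' = x then emb x'' y else 0"])
          (auto intro!: klin_intros simp: emb_bas klin_def)
      then show "hkr (total_part x (bas l)) = ext (\<lambda>(x', S). if x' = x then bas (x', S) else 0) (hkr (bas l))"
        by (simp add: total_part_def hkr_bas)
    qed (intro klin_intros)+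
    then show "hkr (total_part x z) = 0" using z by simp
  qed
  then have "\<forall>x. \<exists>y. y \<in> fsupp (len (Suc (Suc n))) \<and> hoch y = total_part x z \<and> hkr y = 0" by blast
  then obtain y where
    "\<forall>x. y x \<in> fsupp (len (Suc (Suc n))) \<and> hoch (y x) = total_part x z \<and> hkr (y x) = 0"
    by (rule choice[THEN exE])
  then have y: "y x \<in> fsupp (len (Suc (Suc n)))" "hoch (y x) = total_part x z" "hkr (y x) = 0" for x
    by simp_all
  let ?y = "\<Sum>x\<in>sum_list ` Poly_Mapping.keys z. y x"
  have "hoch ?y = (\<Sum>x\<in>sum_list ` Poly_Mapping.keys z. total_part x z)" by (simp add: y)
  then have "hoch ?y = z" by (simp only: flip: total_part_sum)
  moreover have "hkr ?y = 0" by (simp add: y)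
  moreover have "?y \<in> fsupp (len (Suc (Suc n)))" by (intro fsupp_sum y)
  ultimately show ?thesis by (intro bexI[of _ ?y] conjI)
qed

end


section \<open>Cyclic homology\<close>

context lattice
begin

lemma wedge_bprime: "l \<noteq> [] \<Longrightarrow> ext wedge_list (bar0 l)
    = (wedge_list (tl l) :: nat set \<Rightarrow>\<^sub>0 'k::field)"
  by (cases l) (simp_all only: wedge_bar0 list.sel, simp)

end

context twisted_lattice
begin

text \<open>
  Both sides are \<open>(g\<^sub>1 \<and> \<dots> \<and> g\<^sub>n - (- 1)\<^sup>n g\<^sub>0 \<and> \<dots> \<and> g\<^bsub>n-1\<^esub>) / n!\<close>: the boundary without the last
  face is the boundary of the bar complex, whose wedge product telescopes to the first term, minus
  the face dropping the last entry, which gives the second.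
\<close>

lemma hkr_one_minus_cyc: "hkr (p - cyc p) = hkr_d (bprime p)"
proof (rule klin_eqI[where p = p])
  fix l :: "'g list"
  show "hkr (bas l - cyc (bas l)) = hkr_d (bprime (bas l))"
  proof (cases l rule: rev_cases)
    case (snoc u g)
    define n where "n = length u"
    have ne: "l \<noteq> []" and ll: "length l = Suc n" and bl: "butlast l = u" using snoc by (simp_all add: n_def)
    have s: "sum_list (g # u) = sum_list l" by (simp add: snoc add.commute)
    have b: "bprime0 l = bar0 l - (- 1) ^ n *\<^sub>p bas u"
      using bar0_bprime0[OF ne] by (simp add: ll bl)
    have bl_len: "bprime0 l \<in> fsupp (len n)"
      using bprime_len[of "bas l" n] ll by simp
    have sum: "bprime0 l \<in> fsupp {l'. sum_list l' = sum_list l}" by (rule bprime0_sum)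
    have dl: "hkr_d (bprime0 l) = (if sum_list l \<in> central then emb (sum_list l) (nwedge (bprime0 l)) else 0)"
      if "n > 0"
    proof (rule klin_eq_on[where S = "{l'. l' \<noteq> [] \<and> sum_list l' = sum_list l}" and p = "bprime0 l" and f = hkr_d])
      show "klin (\<lambda>p. if sum_list l \<in> central then emb (sum_list l) (nwedge p) else 0)"
        by (intro klin_intros)
      show "bprime0 l \<in> fsupp {l'. l' \<noteq> [] \<and> sum_list l' = sum_list l}"
        using bl_len sum that by (auto simp: fsupp_def subset_iff)
    qed (auto intro: klin_intros simp: hkr_d_bas)
    have w: "nwedge (bprime0 l) = (1 / fact n) *\<^sub>p (wedge_list (tl l) - (- 1) ^ n *\<^sub>p wedge_list u)"
    proof -
      have "nwedge (bprime0 l) = (1 / fact n) *\<^sub>p ext wedge_list (bprime0 l)" by (rule nwedge_len[OF bl_len])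
      then show ?thesis using wedge_bprime[OF ne, where 'k = 'k] by (simp add: b)
    qed
    show ?thesis
    proof (cases "n > 0")
      case True
      then show ?thesis
        using dl s lam_central by (auto simp: cyc_bas_snoc snoc hkr_bas nwedge_bas w[unfolded snoc] n_def pscale_distribs
            add.commute split: if_splits)
    next
      case False
      then have "u = []" by (simp add: n_def)
      then show ?thesis by (simp add: snoc cyc_bas_ne)
    qed
  qed (simp add: hkr_bas)
qed (intro klin_intros)+

lemma hkr_d_cyc: "hkr_d (cyc p) = hkr_d p"
proof (rule klin_eqI[where p = p])
  fix l :: "'g list"
  show "hkr_d (cyc (bas l)) = hkr_d (bas l)"
  proof (cases l rule: rev_cases)
    case (snoc u g)
    have "sum_list (g # u) = sum_list l" by (simp add: snoc add.commute)
    then show ?thesis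
      by (simp add: snoc cyc_bas_snoc hkr_d_bas nwedge_bas wedge_list_snoc add.commute mult.commute
          del: wedge_list.simps)
  qed (simp add: hkr_d_bas)
qed (intro klin_intros)+

lemma hkr_d_cns0: "hkr_d (cns 0 p) = 0"
  by (rule klin_eqI[where p = p and f = "\<lambda>p. hkr_d (cns 0 p)" and g = "\<lambda>_. 0"])
    (auto intro!: klin_intros simp: hkr_d_bas nwedge_bas)

lemma wedge_total_hkr_d: "wedge_total (hkr_d p) = 0"
  by (rule klin_eqI[where p = p and f = "\<lambda>p. wedge_total (hkr_d p)" and g = "\<lambda>_. 0"])
    (auto intro!: klin_intros simp: hkr_d_bas nwedge_bas wedge_total_emb wedge_list_sum)

text \<open>
  The norm has \<open>n + 1\<close> summands on which \<open>hkr_d\<close> takes the same value, which cancels the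
  denominator \<open>(n + 1)!\<close> down to \<open>n!\<close>. In \<open>x \<and> g\<^sub>1 \<and> \<dots> \<and> g\<^sub>n\<close> only the summand \<open>g\<^sub>0\<close> of \<open>x\<close>
  survives.
\<close>

lemma hkr_d_norm:
  assumes p: "p \<in> fsupp (len (Suc n))"
  shows "hkr_d (norm_op (Suc n) p) = wedge_total (hkr p)"
proof -
  have c: "hkr_d ((cyc ^^ i) p) = hkr_d p" for i
    by (induction i) (simp_all add: hkr_d_cyc)
  have "hkr_d (norm_op (Suc n) p) = (\<Sum>i<Suc n. hkr_d p)"
    unfolding norm_op_def by (simp only: hkr_simps c)
  also have "\<dots> = of_nat (Suc n) *\<^sub>p hkr_d p"
    by (rule poly_mapping_eqI) (simp add: lookup_sum lookup_add algebra_simps)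
  also have "\<dots> = wedge_total (hkr p)"
  proof (rule klin_eq_on[OF _ _ p])
    fix l :: "'g list" assume "l \<in> len (Suc n)"
    then obtain g r where l: "l = g # r" and r: "length r = n" by (auto simp: length_Suc_conv)
    have "wedge_vec (sum_list l) (wedge_list r) = (wedge_vec g (wedge_list r) :: nat set \<Rightarrow>\<^sub>0 'k)"
      by (simp add: l wedge_vec_add wedge_list_sum)
    moreover have "of_nat (Suc n) * (1 / fact (Suc n)) = (1 / fact n :: 'k)"
      by (simp add: field_simps del: of_nat_Suc)
    ultimately show "of_nat (Suc n) *\<^sub>p hkr_d (bas l) = wedge_total (hkr (bas l))"
      using r by (auto simp: l hkr_d_bas hkr_bas nwedge_bas wedge_total_emb simp del: of_nat_Suc fact_Suc
          simp flip: emb_simps)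
  qed (intro klin_intros)+
  finally show ?thesis .
qed

text \<open>
  The total complex of the cyclic bicomplex in monomial coordinates.  The map \<open>tot_hkr\<close> compares it
  with the total complex of the exterior algebra whose only differential is the wedge product with
  the total degree.
\<close>

definition tot_deg :: "nat \<Rightarrow> (nat \<Rightarrow> 'g list \<Rightarrow>\<^sub>0 'k) set"
  where "tot_deg n = {c. (\<forall>p\<le>n. c p \<in> fsupp (len (Suc (n - p)))) \<and> (\<forall>p>n. c p = 0)}"

definition tot_d :: "nat \<Rightarrow> (nat \<Rightarrow> 'g list \<Rightarrow>\<^sub>0 'k) \<Rightarrow> (nat \<Rightarrow> 'g list \<Rightarrow>\<^sub>0 'k)"
  where "tot_d n c p = (if p \<le> n then
      if even p then hoch (c p) + (c (Suc p) - cyc (c (Suc p)))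
      else - bprime (c p) + norm_op (Suc (n - p)) (c (Suc p)) else 0)"

definition tot_hkr :: "(nat \<Rightarrow> 'g list \<Rightarrow>\<^sub>0 'k) \<Rightarrow> nat \<Rightarrow> ('g \<times> nat set \<Rightarrow>\<^sub>0 'k)"
  where "tot_hkr c i = hkr (c (2 * i)) + hkr_d (c (2 * i + 1))"

definition tot_cycle :: "nat \<Rightarrow> (nat \<Rightarrow> 'g list \<Rightarrow>\<^sub>0 'k) \<Rightarrow> bool"
  where "tot_cycle n c \<longleftrightarrow> (\<forall>k. n = Suc k \<longrightarrow> (\<forall>p. tot_d k c p = 0))"

lemma tot_deg_le: "c \<in> tot_deg n \<Longrightarrow> p \<le> n \<Longrightarrow> c p \<in> fsupp (len (Suc (n - p)))"
  and tot_deg_gt: "c \<in> tot_deg n \<Longrightarrow> p > n \<Longrightarrow> c p = 0"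
  by (simp_all add: tot_deg_def)

lemma tot_deg_add: "c \<in> tot_deg n \<Longrightarrow> e \<in> tot_deg n \<Longrightarrow> (\<lambda>p. c p + e p) \<in> tot_deg n"
  and tot_deg_diff: "c \<in> tot_deg n \<Longrightarrow> e \<in> tot_deg n \<Longrightarrow> (\<lambda>p. c p - e p) \<in> tot_deg n"
  by (simp_all add: tot_deg_def)

lemma tot_d_add: "tot_d n (\<lambda>p. c p + e p) q = tot_d n c q + tot_d n e q"
  and tot_d_diff: "tot_d n (\<lambda>p. c p - e p) q = tot_d n c q - tot_d n e q"
  and tot_d_scale: "tot_d n (\<lambda>p. a *\<^sub>p c p) q = a *\<^sub>p tot_d n c q"
  by (simp_all add: tot_d_def pscale_distribs)

lemma tot_hkr_add: "tot_hkr (\<lambda>p. c p + e p) i = tot_hkr c i + tot_hkr e i"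
  and tot_hkr_diff: "tot_hkr (\<lambda>p. c p - e p) i = tot_hkr c i - tot_hkr e i"
  and tot_hkr_scale: "tot_hkr (\<lambda>p. a *\<^sub>p c p) i = a *\<^sub>p tot_hkr c i"
  by (simp_all add: tot_hkr_def pscale_distribs)

lemma tot_d_deg:
  assumes c: "c \<in> tot_deg (Suc n)"
  shows "tot_d n c \<in> tot_deg n"
proof -
  have "tot_d n c p \<in> fsupp (len (Suc (n - p)))" if p: "p \<le> n" for p
  proof -
    have 1: "c p \<in> fsupp (len (Suc (Suc (n - p))))" using tot_deg_le[OF c, of p] p by (simp add: Suc_diff_le)
    have 2: "c (Suc p) \<in> fsupp (len (Suc (n - p)))" using tot_deg_le[OF c, of "Suc p"] p by simp
    show ?thesis using 1 2 p by (simp add: tot_d_def hoch_len bprime_len norm_op_len cyc_len)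
  qed
  then show ?thesis by (simp add: tot_deg_def tot_d_def)
qed

lemma bprime_len1: "p \<in> fsupp (len 1) \<Longrightarrow> bprime p = 0"
  by (rule klin_eq_on[where f = bprime and g = "\<lambda>_. 0" and S = "len 1"])
    (auto intro: klin_intros simp: length_Suc_conv)

lemma hoch_len1: "p \<in> fsupp (len 1) \<Longrightarrow> hoch p = 0"
  by (rule klin_eq_on[where f = hoch and g = "\<lambda>_. 0" and S = "len 1"])
    (auto intro: klin_intros simp: length_Suc_conv hoch_def cyc_bas_ne)

lemma hoch_hoch:
  assumes "p \<in> fsupp (len (Suc (Suc n)))"
  shows "hoch (hoch p) = 0"
proof (rule klin_eq_on[where f = "\<lambda>p. hoch (hoch p)" and g = "\<lambda>_. 0", OF _ _ assms])
  fix l :: "'g list" assume l: "l \<in> len (Suc (Suc n))"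
  then have f: "(bas l :: 'g list \<Rightarrow>\<^sub>0 'k) \<in> fsupp (fib (sum_list l))" by (auto simp: fib_def intro!: fsupp_single)
  let ?x = "sum_list l"
  define q where "q = aug (psi ?x) (bas l :: 'g list \<Rightarrow>\<^sub>0 'k)"
  have q: "q \<in> fsupp (len (Suc n))" unfolding q_def using l by (intro aug_len) simp
  have "bas l = unaug ?x q" unfolding q_def by (simp only: unaug_aug[OF f])
  then have "hoch (hoch (bas l)) = hoch (hoch (unaug ?x q))" by simp
  also have "\<dots> = - hoch (unaug ?x (tbar (psi ?x) q))" by (simp add: hoch_unaug[OF q])
  also have "\<dots> = 0" by (simp add: hoch_unaug[OF tbar_len[OF q]] gchar_psi)
  finally show "hoch (hoch (bas l)) = 0" .
qed (intro klin_intros)+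

lemma tot_d_tot_d:
  assumes c: "c \<in> tot_deg (Suc (Suc n))"
  shows "tot_d n (tot_d (Suc n) c) p = 0"
proof (cases "p \<le> n")
  case True
  let ?k = "n - p"
  have 0: "c p \<in> fsupp (len (Suc (Suc (Suc ?k))))" using tot_deg_le[OF c, of p] True by (simp add: Suc_diff_le)
  have 1: "c (Suc p) \<in> fsupp (len (Suc (Suc ?k)))" using tot_deg_le[OF c, of "Suc p"] True by (simp add: Suc_diff_le)
  have 2: "c (Suc (Suc p)) \<in> fsupp (len (Suc ?k))" using tot_deg_le[OF c, of "Suc (Suc p)"] True by simp
  show ?thesis
  proof (cases "even p")
    case even: True
    have "hoch (c (Suc p)) - hoch (cyc (c (Suc p))) = bprime (c (Suc p)) - cyc (bprime (c (Suc p)))"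
      using hoch_one_minus_cyc[OF 1] by simp
    then show ?thesis using True even
      by (simp add: tot_d_def hoch_hoch[OF 0] cyc_norm_op(1)[OF 2])
  next
    case odd: False
    have "bprime (norm_op (Suc (Suc ?k)) (c (Suc p))) = norm_op (Suc ?k) (hoch (c (Suc p)))"
      by (rule bprime_norm_op[OF 1])
    then show ?thesis using True odd
      by (simp add: tot_d_def Suc_diff_le cyc_norm_op(2)[OF 2])
  qed
qed (simp add: tot_d_def)

text \<open>
  The Hochschild boundary is killed by \<open>hkr\<close>. By \<open>hkr_one_minus_cyc\<close>, the horizontal differential
  into an even column cancels against the vertical one of the odd column next to it; what remains
  is the norm leaving the following even column.
\<close>

lemma tot_hkr_tot_d:
  assumes c: "c \<in> tot_deg (Suc n)"
  shows "tot_hkr (tot_d n c) i = wedge_total (tot_hkr c (Suc i))"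
proof -
  have R: "wedge_total (tot_hkr c (Suc i)) = wedge_total (hkr (c (Suc (Suc (2 * i)))))"
    by (simp add: tot_hkr_def wedge_total_hkr_d)
  consider "2 * i + 1 \<le> n" | "2 * i = n" | "2 * i > n" by linarith
  then show ?thesis
  proof cases
    case 1
    let ?k = "n - (2 * i + 1)"
    have 0: "c (2 * i) \<in> fsupp (len (Suc (Suc (Suc ?k))))"
    proof -
      have "Suc (Suc n - 2 * i) = Suc (Suc (Suc ?k))" using 1 by simp
      then show ?thesis using tot_deg_le[OF c, of "2 * i"] 1 by simp
    qed
    have 2: "c (Suc (Suc (2 * i))) \<in> fsupp (len (Suc ?k))"
      using tot_deg_le[OF c, of "Suc (Suc (2 * i))"] 1 by simp
    have "tot_hkr (tot_d n c) i = hkr (c (2 * i + 1) - cyc (c (2 * i + 1)))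
        - hkr_d (bprime (c (2 * i + 1))) + hkr_d (norm_op (Suc ?k) (c (Suc (Suc (2 * i)))))"
      using 1 by (simp add: tot_hkr_def tot_d_def hkr_hoch[OF 0])
    then show ?thesis by (simp only: hkr_one_minus_cyc hkr_d_norm[OF 2] R) simp
  next
    case 2
    have 0: "c (2 * i) \<in> fsupp (len (Suc (Suc 0)))" using tot_deg_le[OF c, of "2 * i"] 2 by simp
    have 1: "c (2 * i + 1) \<in> fsupp (len 1)" using tot_deg_le[OF c, of "2 * i + 1"] 2 by simp
    have "bprime (c (2 * i + 1)) = 0" using 1 by (rule bprime_len1)
    then have e: "hkr (c (2 * i + 1) - cyc (c (2 * i + 1))) = 0" unfolding hkr_one_minus_cyc by simp
    have "tot_d n c (2 * i) = hoch (c (2 * i)) + (c (2 * i + 1) - cyc (c (2 * i + 1)))"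
      "tot_d n c (2 * i + 1) = 0"
      by (simp_all add: tot_d_def flip: 2)
    then have "tot_hkr (tot_d n c) i = 0"
      unfolding tot_hkr_def by (simp only: klin_add[OF klin_hkr(1)] e hkr_hoch[OF 0]) simp
    moreover have "c (Suc (Suc (2 * i))) = 0" by (rule tot_deg_gt[OF c]) (use 2 in simp)
    ultimately show ?thesis unfolding R by simp
  next
    case 3
    then show ?thesis unfolding R
      using tot_deg_gt[OF c, of "Suc (Suc (2 * i))"] by (simp add: tot_hkr_def tot_d_def)
  qed
qed

text \<open>
  The kernel of \<open>tot_hkr\<close> is acyclic.  A cycle in it is bounded column by column, starting from the
  last nonzero one: even columns by exactness of the kernel of \<open>hkr\<close>, odd ones by the contraction
  that inserts a unit.
\<close>

lemma tot_hkr_kernel_upto: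
  assumes "c \<in> tot_deg n" "tot_cycle n c" "\<And>i. tot_hkr c i = 0" "\<And>p. p \<ge> k \<Longrightarrow> c p = 0"
  shows "\<exists>e \<in> tot_deg (Suc n). (\<forall>p. tot_d n e p = c p) \<and> (\<forall>i. tot_hkr e i = 0)"
  using assms
proof (induction k arbitrary: c)
  case 0
  have "(\<lambda>_. 0) \<in> tot_deg (Suc n)" by (simp add: tot_deg_def)
  then show ?case using 0 by (intro bexI[of _ "\<lambda>_. 0"]) (auto simp: tot_d_def tot_hkr_def)
next
  case (Suc k)
  note c = Suc.prems(1)
  show ?case
  proof (cases "k \<le> n")
    case False
    then have "c p = 0" if "p \<ge> k" for p using tot_deg_gt[OF c, of p] that by simp
    then show ?thesis using Suc by blast
  next
    case True
    have ck: "c k \<in> fsupp (len (Suc (n - k)))" by (rule tot_deg_le[OF c True])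
    have vert: "(if even k then hoch (c k) else bprime (c k)) = 0"
    proof (cases "k = n")
      case True
      then have "c k \<in> fsupp (len 1)" using ck by simp
      then have "hoch (c k) = 0" "bprime (c k) = 0" by (simp_all add: hoch_len1 bprime_len1)
      then show ?thesis by simp
    next
      case False
      then obtain n' where n': "n = Suc n'" using True by (cases n) auto
      have "tot_d n' c k = 0" using Suc.prems(2) n' by (simp add: tot_cycle_def)
      then show ?thesis using False True n' Suc.prems(4)[of "Suc k"] by (auto simp: tot_d_def split: if_splits)
    qed
    obtain y where y: "y \<in> fsupp (len (Suc (Suc (n - k))))"
      "if even k then hoch y = c k \<and> hkr y = 0 else - bprime y = c k \<and> hkr_d y = 0"
    proof (cases "even k")
      case True
      have "hkr (c k) = 0"
        using Suc.prems(3)[of "k div 2"] Suc.prems(4)[of "Suc k"] True by (simp add: tot_hkr_def)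
      then show ?thesis using hkr_kernel[OF ck] vert True that by auto
    next
      case False
      have "- bprime (- cns 0 (c k)) = c k"
        using bprime_cns0[OF ck] vert False by simp
      moreover have "- cns 0 (c k) \<in> fsupp (len (Suc (Suc (n - k))))"
        by (intro fsupp_simps cns_len ck)
      ultimately show ?thesis using that[of "- cns 0 (c k)"] False by (simp add: hkr_d_cns0)
    qed
    define e1 where "e1 p = (if p = k then y else 0)" for p
    have e1: "e1 \<in> tot_deg (Suc n)" using y(1) True by (auto simp: tot_deg_def e1_def Suc_diff_le)
    have he1: "tot_hkr e1 i = 0" for i
      using y(2) by (auto simp: tot_hkr_def e1_def split: if_splits)
    have e1k: "tot_d n e1 k = c k"
      using y(2) True by (auto simp: tot_d_def e1_def split: if_splits)
    have e1gt: "tot_d n e1 p = 0" if "p > k" for p using that by (simp add: tot_d_def e1_def)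
    let ?c = "\<lambda>p. c p - tot_d n e1 p"
    have "\<exists>e \<in> tot_deg (Suc n). (\<forall>p. tot_d n e p = ?c p) \<and> (\<forall>i. tot_hkr e i = 0)"
    proof (rule Suc.IH)
      show "?c \<in> tot_deg n" by (intro tot_deg_diff c tot_d_deg e1)
      show "tot_cycle n ?c"
        using Suc.prems(2) tot_d_tot_d e1 by (auto simp: tot_cycle_def tot_d_diff)
      show "tot_hkr ?c i = 0" for i
        by (simp add: tot_hkr_diff Suc.prems(3) tot_hkr_tot_d[OF e1] he1)
      show "?c p = 0" if "p \<ge> k" for p
        using that e1k e1gt[of p] Suc.prems(4)[of p] by (cases "p = k") auto
    qed
    then obtain e2 where e2: "e2 \<in> tot_deg (Suc n)" "\<And>p. tot_d n e2 p = ?c p" "\<And>i. tot_hkr e2 i = 0"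
      by blast
    show ?thesis
      by (rule bexI[of _ "\<lambda>p. e1 p + e2 p"])
        (simp_all add: tot_d_add tot_hkr_add e2 he1 tot_deg_add e1)
  qed
qed

lemma tot_hkr_kernel:
  assumes "c \<in> tot_deg n" "tot_cycle n c" "\<And>i. tot_hkr c i = 0"
  shows "\<exists>e \<in> tot_deg (Suc n). (\<forall>p. tot_d n e p = c p) \<and> (\<forall>i. tot_hkr e i = 0)"
  by (rule tot_hkr_kernel_upto[OF assms, of "Suc n"]) (simp add: tot_deg_gt[OF assms(1)])

definition ext_deg :: "nat \<Rightarrow> (nat \<Rightarrow> 'g \<times> nat set \<Rightarrow>\<^sub>0 'k) set"
  where "ext_deg n = {y. (\<forall>i. 2 * i \<le> n \<longrightarrow> y i \<in> fsupp (central \<times> nsets m (n - 2 * i)))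
    \<and> (\<forall>i. 2 * i > n \<longrightarrow> y i = 0)}"

lemma tot_hkr_deg:
  assumes "c \<in> tot_deg n"
  shows "tot_hkr c \<in> ext_deg n"
proof -
  have d: "hkr_d p \<in> fsupp (central \<times> nsets m k)" if "p \<in> fsupp (len k)" for p k
    using that unfolding hkr_d_def by (elim ext_fsupp) (auto intro!: emb_fsupp nwedge_nsets)
  have "tot_hkr c i \<in> fsupp (central \<times> nsets m (n - 2 * i))" if "2 * i \<le> n" for i
  proof (cases "2 * i = n")
    case True
    then show ?thesis using tot_deg_le[OF assms, of "2 * i"] tot_deg_gt[OF assms, of "2 * i + 1"]
      by (simp add: tot_hkr_def hkr_fsupp)
  next
    case False
    then have "2 * i + 1 \<le> n" using that by simp
    then have "c (2 * i + 1) \<in> fsupp (len (n - 2 * i))"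
      using tot_deg_le[OF assms, of "2 * i + 1"] by (simp add: Suc_diff_Suc)
    then show ?thesis using tot_deg_le[OF assms, of "2 * i"] that
      by (simp add: tot_hkr_def hkr_fsupp d)
  qed
  then show ?thesis by (simp add: ext_deg_def tot_hkr_def tot_deg_gt[OF assms])
qed

text \<open>Even columns suffice to hit every element.\<close>

lemma tot_hkr_surj:
  assumes "y \<in> ext_deg n"
  shows "\<exists>c \<in> tot_deg n. \<forall>i. tot_hkr c i = y i"
proof -
  have "\<forall>i. \<exists>z. 2 * i \<le> n \<longrightarrow> z \<in> fsupp (len (Suc (n - 2 * i))) \<and> hkr z = y i"
    using assms hkr_section by (auto simp: ext_deg_def) blast
  then obtain z where z: "\<forall>i. 2 * i \<le> n \<longrightarrow> z i \<in> fsupp (len (Suc (n - 2 * i))) \<and> hkr (z i) = y i"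
    by (rule choice[THEN exE])
  define c where "c p = (if even p \<and> p \<le> n then z (p div 2) else 0)" for p
  have "c \<in> tot_deg n" using z by (auto simp: tot_deg_def c_def elim!: evenE)
  moreover have "tot_hkr c i = y i" for i
    using z assms by (auto simp: tot_hkr_def c_def ext_deg_def)
  ultimately show ?thesis by blast
qed

text \<open>
  A lift of a cycle of the target has its boundary in the kernel of \<open>tot_hkr\<close>, where it bounds by
  acyclicity; subtracting the bounding chain makes the lift a cycle.
\<close>

lemma tot_hkr_lift_cycle:
  assumes y: "y \<in> ext_deg n" and d: "\<And>i. wedge_total (y (Suc i)) = 0"
  shows "\<exists>c \<in> tot_deg n. tot_cycle n c \<and> (\<forall>i. tot_hkr c i = y i)"
proof -
  obtain c where c: "c \<in> tot_deg n" "\<And>i. tot_hkr c i = y i" using tot_hkr_surj[OF y] by blast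
  show ?thesis
  proof (cases n)
    case 0
    then show ?thesis using c by (intro bexI[of _ c]) (auto simp: tot_cycle_def)
  next
    case (Suc k)
    have ck: "c \<in> tot_deg (Suc k)" using c Suc by simp
    have "\<exists>e \<in> tot_deg (Suc k). (\<forall>p. tot_d k e p = tot_d k c p) \<and> (\<forall>i. tot_hkr e i = 0)"
    proof (rule tot_hkr_kernel)
      show "tot_d k c \<in> tot_deg k" by (rule tot_d_deg[OF ck])
      show "tot_cycle k (tot_d k c)" using ck by (auto simp: tot_cycle_def tot_d_tot_d)
      show "tot_hkr (tot_d k c) i = 0" for i by (simp add: tot_hkr_tot_d[OF ck] c d)
    qed
    then obtain e where e: "e \<in> tot_deg (Suc k)" "\<And>p. tot_d k e p = tot_d k c p" "\<And>i. tot_hkr e i = 0"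
      by blast
    show ?thesis
      using e ck Suc by (intro bexI[of _ "\<lambda>p. c p - e p"])
        (auto simp: tot_cycle_def tot_d_diff tot_hkr_diff c tot_deg_diff)
  qed
qed

text \<open>
  For \<open>x \<noteq> 0\<close>, contraction with a coordinate that does not vanish at \<open>x\<close> is a contracting homotopy
  of the wedge product with \<open>x\<close>.
\<close>

definition pivot :: "'g \<Rightarrow> nat"
  where "pivot x = (SOME j. j < m \<and> \<phi> j x \<noteq> 0)"

lemma pivot: "x \<noteq> 0 \<Longrightarrow> pivot x < m \<and> \<phi> (pivot x) x \<noteq> 0"
  unfolding pivot_def by (rule someI_ex) (use coords_eq_0[of x] in blast)

definition contr_total :: "('g \<times> nat set \<Rightarrow>\<^sub>0 'k) \<Rightarrow> ('g \<times> nat set \<Rightarrow>\<^sub>0 'k)"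
  where "contr_total = ext (\<lambda>(x, S). if x = 0 then 0 else
    (1 / of_int (\<phi> (pivot x) x)) *\<^sub>p emb x (contr (pivot x) (bas S)))"

definition zero_part :: "('g \<times> nat set \<Rightarrow>\<^sub>0 'k) \<Rightarrow> ('g \<times> nat set \<Rightarrow>\<^sub>0 'k)"
  where "zero_part = ext (\<lambda>(x, S). if x = 0 then bas (x, S) else 0)"

definition coker_part :: "('g \<times> nat set \<Rightarrow>\<^sub>0 'k) \<Rightarrow> ('g \<times> nat set \<Rightarrow>\<^sub>0 'k)"
  where "coker_part y = y - zero_part y - wedge_total (contr_total y)"

lemma klin_parts [klin_intros]: "klin contr_total" "klin zero_part" "klin coker_part"
proof -
  show 1: "klin contr_total" "klin zero_part"
    by (simp_all add: contr_total_def zero_part_def klin_ext)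
  show "klin coker_part" unfolding coker_part_def[abs_def] by (intro klin_intros 1)
qed

lemmas [klin_intros] = klin_parts[THEN klin_comp]
lemmas parts_simps [simp] = klin_simps[OF klin_parts(1)] klin_simps[OF klin_parts(2)]
  klin_simps[OF klin_parts(3)]

lemma contr_total_emb: "contr_total (emb x y) = (if x = 0 then 0 else
    (1 / of_int (\<phi> (pivot x) x)) *\<^sub>p emb x (contr (pivot x) y))"
  by (rule klin_eqI[where p = y and f = "\<lambda>y. contr_total (emb x y)"])
    (intro klin_intros, intro klin_intros, simp add: contr_total_def emb_bas)

lemma zero_part_emb: "zero_part (emb x y) = (if x = 0 then emb x y else 0)"
  by (rule klin_eqI[where p = y and f = "\<lambda>y. zero_part (emb x y)"])
    (intro klin_intros, intro klin_intros, simp add: zero_part_def emb_bas)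

lemma klin_eq_emb:
  assumes "klin f" "klin h" "\<And>x S. f (emb x (bas S)) = h (emb x (bas S))"
  shows "f p = h p"
proof (rule klin_eqI[OF assms(1,2)])
  fix a show "f (bas a) = h (bas a)" using assms(3)[of "fst a" "snd a"] by (simp add: emb_bas)
qed

text \<open>The Leibniz rule for contraction.\<close>

lemma wedge_contr_total: "wedge_total (contr_total y) + contr_total (wedge_total y) = y - zero_part y"
proof (rule klin_eq_emb[where p = y])
  fix x :: 'g and S
  let ?b = "bas S :: nat set \<Rightarrow>\<^sub>0 'k"
  show "wedge_total (contr_total (emb x ?b)) + contr_total (wedge_total (emb x ?b)) = emb x ?b - zero_part (emb x ?b)"
  proof (cases "x = 0")
    case False
    then have "pivot x < m" "of_int (\<phi> (pivot x) x) \<noteq> (0 :: 'k)" using pivot by auto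
    then show ?thesis using False
      by (simp add: contr_total_emb wedge_total_emb zero_part_emb contr_wedge_vec pscale_distribs)
  qed (simp add: contr_total_emb wedge_total_emb zero_part_emb)
qed (intro klin_intros)+

lemma parts_relations:
  "wedge_total (wedge_total y) = 0" "wedge_total (zero_part y) = 0" "zero_part (wedge_total y) = 0"
  "zero_part (contr_total y) = 0" "zero_part (zero_part y) = zero_part y"
proof -
  note e = klin_eq_emb[where p = y]
  show "wedge_total (wedge_total y) = 0"
    by (rule e[where f = "\<lambda>y. wedge_total (wedge_total y)" and h = "\<lambda>_. 0"])
      (intro klin_intros, intro klin_intros, simp add: wedge_total_emb)
  show "wedge_total (zero_part y) = 0"
    by (rule e[where f = "\<lambda>y. wedge_total (zero_part y)" and h = "\<lambda>_. 0"])
      (intro klin_intros, intro klin_intros, simp add: wedge_total_emb zero_part_emb)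
  show "zero_part (wedge_total y) = 0"
    by (rule e[where f = "\<lambda>y. zero_part (wedge_total y)" and h = "\<lambda>_. 0"])
      (intro klin_intros, intro klin_intros, simp add: wedge_total_emb zero_part_emb)
  show "zero_part (contr_total y) = 0"
    by (rule e[where f = "\<lambda>y. zero_part (contr_total y)" and h = "\<lambda>_. 0"])
      (intro klin_intros, intro klin_intros, simp add: contr_total_emb zero_part_emb)
  show "zero_part (zero_part y) = zero_part y"
    by (rule e[where f = "\<lambda>y. zero_part (zero_part y)"])
      (intro klin_intros, intro klin_intros, simp add: zero_part_emb)
qed

lemma coker_part_wedge: "coker_part (wedge_total u) = 0"
proof -
  have "contr_total (wedge_total u) = u - zero_part u - wedge_total (contr_total u)"
    using wedge_contr_total[of u] by (simp add: algebra_simps)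
  then show ?thesis by (simp add: coker_part_def parts_relations)
qed

lemma zero_part_coker_part: "zero_part (coker_part y) = 0"
  by (simp add: coker_part_def parts_relations)

text \<open>
  A finite family of elements is stored as one element of the free vector space on a disjoint
  union.
\<close>

definition tag :: "nat \<Rightarrow> ('g \<times> nat set \<Rightarrow>\<^sub>0 'k) \<Rightarrow> (nat \<times> 'g \<times> nat set \<Rightarrow>\<^sub>0 'k)"
  where "tag i = ext (\<lambda>p. bas (i, p))"

definition untag :: "nat \<Rightarrow> (nat \<times> 'g \<times> nat set \<Rightarrow>\<^sub>0 'k) \<Rightarrow> ('g \<times> nat set \<Rightarrow>\<^sub>0 'k)"
  where "untag i = ext (\<lambda>(j, p). if j = i then bas p else 0)"

lemma klin_tag [klin_intros]: "klin (tag i)" "klin (untag i)"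
  by (simp_all add: tag_def untag_def klin_ext)

lemmas [klin_intros] = klin_tag[THEN klin_comp]
lemmas tag_simps [simp] = klin_simps[OF klin_tag(1)] klin_simps[OF klin_tag(2)]

lemma untag_tag: "untag i (tag j y) = (if i = j then y else 0)"
  by (rule klin_eqI[where p = y and f = "\<lambda>y. untag i (tag j y)"])
    (intro klin_intros, intro klin_intros, auto simp: tag_def untag_def)

text \<open>
  A basis of the homology of the target of \<open>tot_hkr\<close>. For \<open>x \<noteq> 0\<close> the cokernel of the wedge
  product with \<open>x\<close> has as basis the monomials that avoid the pivot coordinate of \<open>x\<close>.
\<close>

definition hc_index :: "nat \<Rightarrow> (nat \<times> 'g \<times> nat set) set"
  where "hc_index n = {(i, x, S). x = 0 \<and> 2 * i \<le> n \<and> S \<in> nsets m (n - 2 * i)}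
    \<union> {(i, x, S). i = 0 \<and> x \<in> central - {0} \<and> S \<in> nsets m n \<and> pivot x \<notin> S}"

definition hc_coords :: "nat \<Rightarrow> (nat \<Rightarrow> 'g list \<Rightarrow>\<^sub>0 'k) \<Rightarrow> (nat \<times> 'g \<times> nat set \<Rightarrow>\<^sub>0 'k)"
  where "hc_coords n c = (\<Sum>i\<le>n. tag i (zero_part (tot_hkr c i))) + tag 0 (coker_part (tot_hkr c 0))"

lemma hc_coords_add: "hc_coords n (\<lambda>p. c p + e p) = hc_coords n c + hc_coords n e"
  and hc_coords_diff: "hc_coords n (\<lambda>p. c p - e p) = hc_coords n c - hc_coords n e"
  and hc_coords_scale: "hc_coords n (\<lambda>p. a *\<^sub>p c p) = a *\<^sub>p hc_coords n c"
proof -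
  show "hc_coords n (\<lambda>p. c p + e p) = hc_coords n c + hc_coords n e"
    unfolding hc_coords_def tot_hkr_add parts_simps tag_simps sum.distrib by (simp only: ac_simps)
  show "hc_coords n (\<lambda>p. c p - e p) = hc_coords n c - hc_coords n e"
    unfolding hc_coords_def tot_hkr_diff parts_simps tag_simps sum_subtractf by simp
  show "hc_coords n (\<lambda>p. a *\<^sub>p c p) = a *\<^sub>p hc_coords n c"
    unfolding hc_coords_def tot_hkr_scale parts_simps tag_simps pscale_sum_right pscale_add_right
    by (rule refl)
qed

lemma zero_central: "0 \<in> central"
  unfolding central_def by simp

lemma hc_coords_deg:
  assumes "c \<in> tot_deg n"
  shows "hc_coords n c \<in> fsupp (hc_index n)"
proof -
  have y: "tot_hkr c \<in> ext_deg n" by (rule tot_hkr_deg[OF assms])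
  have "tag i (zero_part (tot_hkr c i)) \<in> fsupp (hc_index n)" for i
  proof (cases "2 * i \<le> n")
    case True
    then have "tot_hkr c i \<in> fsupp (central \<times> nsets m (n - 2 * i))" using y by (simp add: ext_deg_def)
    then have "zero_part (tot_hkr c i) \<in> fsupp ({0} \<times> nsets m (n - 2 * i))"
      unfolding zero_part_def by (rule ext_fsupp) auto
    then show ?thesis unfolding tag_def using True by (elim ext_fsupp) (auto simp: hc_index_def intro!: fsupp_single)
  next
    case False
    then show ?thesis using y by (simp add: ext_deg_def)
  qed
  moreover have "tag 0 (coker_part (tot_hkr c 0)) \<in> fsupp (hc_index n)"
  proof -
    have "2 * 0 \<le> n \<longrightarrow> tot_hkr c 0 \<in> fsupp (central \<times> nsets m (n - 2 * 0))"
      using y unfolding ext_deg_def by blast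
    then have "tot_hkr c 0 \<in> fsupp (central \<times> nsets m n)" by simp
    then have "coker_part (tot_hkr c 0) \<in> fsupp {(x, S). x \<in> central - {0} \<and> S \<in> nsets m n \<and> pivot x \<notin> S}"
    proof (rule klin_fsupp[OF klin_parts(3)])
      fix xS assume "xS \<in> central \<times> nsets m n"
      then obtain x S where xS: "xS = (x, S)" "x \<in> central" "S \<in> nsets m n" by auto
      show "coker_part (bas xS) \<in> fsupp {(x, S). x \<in> central - {0} \<and> S \<in> nsets m n \<and> pivot x \<notin> S}"
      proof (cases "x = 0")
        case True
        then show ?thesis using xS
          by (simp add: coker_part_def zero_part_emb contr_total_emb flip: emb_bas)
      next
        case False
        let ?j = "pivot x" and ?b = "bas S :: nat set \<Rightarrow>\<^sub>0 'k"
        have j: "?j < m" "of_int (\<phi> ?j x) \<noteq> (0 :: 'k)" using pivot[OF False] by auto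
        define u where "u = contr ?j (wedge_vec x ?b)"
        have bS: "?b \<in> fsupp (nsets m n)" using xS by simp
        have u: "u \<in> fsupp (nsets m n)" unfolding u_def by (intro contr_nsets wedge_vec_nsets bS)
        have "coker_part (bas xS) = (1 / of_int (\<phi> ?j x)) *\<^sub>p emb x u"
          using False j by (simp add: u_def xS coker_part_def zero_part_emb contr_total_emb wedge_total_emb
              contr_wedge_vec pscale_distribs flip: emb_bas)
        moreover have "u \<in> fsupp {S. S \<in> nsets m n \<and> ?j \<notin> S}"
        proof -
          have "u \<in> fsupp {S. ?j \<notin> S}"
            unfolding u_def by (rule klin_fsupp[OF klin_contr, of _ UNIV]) (auto simp: contr_bas intro!: fsupp_single)
          with u show ?thesis by (auto simp: fsupp_def)
        qed
        then have "emb x u \<in> fsupp {(x, S). x \<in> central - {0} \<and> S \<in> nsets m n \<and> pivot x \<notin> S}"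
          unfolding emb_def using False xS by (elim ext_fsupp) (auto intro!: fsupp_single)
        ultimately show ?thesis by simp
      qed
    qed
    then show ?thesis unfolding tag_def by (rule ext_fsupp) (auto simp: hc_index_def intro!: fsupp_single)
  qed
  ultimately show ?thesis unfolding hc_coords_def by (intro fsupp_simps(2) fsupp_sum)
qed

lemma hc_coords_boundary:
  assumes "c \<in> tot_deg (Suc n)"
  shows "hc_coords n (tot_d n c) = 0"
  by (simp add: hc_coords_def tot_hkr_tot_d[OF assms] parts_relations coker_part_wedge)

lemma contr_total_deg:
  assumes "y \<in> fsupp (central \<times> nsets m (Suc k))"
  shows "contr_total y \<in> fsupp (central \<times> nsets m k)"
  unfolding contr_total_def
  by (rule ext_fsupp[OF assms]) (auto intro!: emb_fsupp contr_nsets fsupp_simps(5))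

lemma contr_total_deg0: "y \<in> fsupp (central \<times> nsets m 0) \<Longrightarrow> contr_total y = 0"
  by (rule klin_eq_on[where f = contr_total and g = "\<lambda>_. 0" and S = "central \<times> nsets m 0"])
    (auto intro!: klin_intros simp: contr_total_emb contr_nsets_0[of "bas _" m] simp flip: emb_bas)

text \<open>
  If the coordinates vanish, then \<open>tot_hkr c\<close> is the boundary of the family obtained by
  \<open>contr_total\<close>. Correct \<open>c\<close> by the boundary of a lift of that family; the result lies in the
  acyclic kernel.
\<close>

lemma hc_coords_kernel:
  assumes c: "c \<in> tot_deg n" "tot_cycle n c" and 0: "hc_coords n c = 0"
  shows "\<exists>e \<in> tot_deg (Suc n). \<forall>p. tot_d n e p = c p"
proof -
  let ?y = "tot_hkr c"
  have y: "?y \<in> ext_deg n" by (rule tot_hkr_deg[OF c(1)])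
  have U: "zero_part (?y k) + (if k = 0 then coker_part (?y 0) else 0) = 0" if "k \<le> n" for k
  proof -
    have "untag k (hc_coords n c) = zero_part (?y k) + (if k = 0 then coker_part (?y 0) else 0)"
      using that by (simp add: hc_coords_def untag_tag)
    then show ?thesis by (simp add: 0)
  qed
  have z: "zero_part (?y k) = 0" for k
  proof (cases "k \<le> n")
    case True
    then show ?thesis
      using arg_cong[OF U[OF True], of zero_part] by (cases "k = 0") (simp_all add: parts_relations zero_part_coker_part)
  next
    case False
    then show ?thesis using y by (simp add: ext_deg_def)
  qed
  have k: "coker_part (?y 0) = 0" using U[of 0] z by simp
  have wt: "wedge_total (?y (Suc i)) = 0" for i
  proof (cases n)
    case 0
    then show ?thesis using y by (simp add: ext_deg_def)
  next
    case (Suc n')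
    then have "tot_d n' c = (\<lambda>_. 0)" using c(2) by (auto simp: tot_cycle_def)
    then have "tot_hkr (tot_d n' c) i = 0" by (simp add: tot_hkr_def)
    then show ?thesis using tot_hkr_tot_d[of c n' i] c(1) Suc by simp
  qed
  have yi: "wedge_total (contr_total (?y i)) = ?y i" for i
  proof (cases i)
    case 0
    then show ?thesis using k z[of 0] by (simp add: coker_part_def)
  next
    case (Suc i')
    then show ?thesis using wedge_contr_total[of "?y i"] z[of i] wt[of i'] by simp
  qed
  define u where "u i = (case i of 0 \<Rightarrow> 0 | Suc i' \<Rightarrow> contr_total (?y i'))" for i
  have "u \<in> ext_deg (Suc n)"
  proof -
    have "contr_total (?y i) \<in> fsupp (central \<times> nsets m (n - Suc (2 * i)))" if "Suc (2 * i) \<le> n" for i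
    proof (rule contr_total_deg)
      have "Suc (n - Suc (2 * i)) = n - 2 * i" using that by simp
      then show "?y i \<in> fsupp (central \<times> nsets m (Suc (n - Suc (2 * i))))" using y that by (simp add: ext_deg_def)
    qed
    moreover have "contr_total (?y i) = 0" if "Suc (2 * i) > n" for i
    proof (cases "2 * i = n")
      case True
      then show ?thesis using y by (intro contr_total_deg0) (auto simp: ext_deg_def)
    next
      case False
      then show ?thesis using y that by (simp add: ext_deg_def)
    qed
    ultimately show ?thesis by (auto simp: ext_deg_def u_def split: nat.split)
  qed
  then obtain a where a: "a \<in> tot_deg (Suc n)" "\<And>i. tot_hkr a i = u i" using tot_hkr_surj by blast
  have "\<exists>e \<in> tot_deg (Suc n). (\<forall>p. tot_d n e p = c p - tot_d n a p) \<and> (\<forall>i. tot_hkr e i = 0)"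
  proof (rule tot_hkr_kernel)
    show "(\<lambda>p. c p - tot_d n a p) \<in> tot_deg n" by (intro tot_deg_diff c tot_d_deg a)
    show "tot_cycle n (\<lambda>p. c p - tot_d n a p)"
      using c(2) a(1) by (auto simp: tot_cycle_def tot_d_diff tot_d_tot_d)
    show "tot_hkr (\<lambda>p. c p - tot_d n a p) i = 0" for i
      by (simp add: tot_hkr_diff tot_hkr_tot_d[OF a(1)] a(2) u_def yi)
  qed
  then obtain e where "e \<in> tot_deg (Suc n)" "\<And>p. tot_d n e p = c p - tot_d n a p" by blast
  then show ?thesis
    by (intro bexI[of _ "\<lambda>p. a p + e p"]) (simp_all add: tot_d_add tot_deg_add a)
qed

text \<open>
  The homology classes have representatives annihilated by the wedge product wherever the
  differential acts: in the summands with \<open>i > 0\<close> only \<open>x = 0\<close> occurs.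
\<close>

lemma hc_coords_surj:
  assumes v: "v \<in> fsupp (hc_index n)"
  shows "\<exists>c \<in> tot_deg n. tot_cycle n c \<and> hc_coords n c = v"
proof -
  define y where "y i = untag i v" for i
  have y0: "y i \<in> fsupp (if i = 0 then {(x, S). x \<in> central \<and> S \<in> nsets m n \<and> (x = 0 \<or> pivot x \<notin> S)}
      else if 2 * i \<le> n then {0} \<times> nsets m (n - 2 * i) else {})" for i
    unfolding y_def untag_def
    by (rule ext_fsupp[OF v]) (auto simp: hc_index_def zero_central intro!: fsupp_single)
  have deg: "y \<in> ext_deg n"
  proof -
    have "y i \<in> fsupp (central \<times> nsets m (n - 2 * i))" if "2 * i \<le> n" for i
      by (rule fsupp_mono[OF y0]) (use that zero_central in auto)
    moreover have "y i = 0" if "2 * i > n" for i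
      using y0[of i] that by (auto simp: fsupp_def)
    ultimately show ?thesis by (simp add: ext_deg_def)
  qed
  have yS: "y (Suc i) \<in> fsupp ({0} \<times> UNIV)" for i
    by (rule fsupp_mono[OF y0]) auto
  have zS: "zero_part (y (Suc i)) = y (Suc i)" for i
    by (rule klin_eq_on[where f = zero_part and g = "\<lambda>y. y", OF _ _ yS])
      (auto intro!: klin_intros simp: zero_part_def)
  obtain c where c: "c \<in> tot_deg n" "tot_cycle n c" "\<And>i. tot_hkr c i = y i"
    using tot_hkr_lift_cycle[OF deg] parts_relations(2)[of "y (Suc _)"] zS by metis
  have "contr_total (y 0) = 0"
  proof (rule klin_eq_on[where f = contr_total and g = "\<lambda>_. 0", OF _ _ y0])
    fix xS assume "xS \<in> (if (0::nat) = 0 then {(x, S). x \<in> central \<and> S \<in> nsets m n \<and> (x = 0 \<or> pivot x \<notin> S)}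
      else if 2 * 0 \<le> n then {0} \<times> nsets m (n - 2 * 0) else {})"
    then show "contr_total (bas xS) = 0"
      by (auto simp: contr_total_def contr_bas)
  qed (intro klin_intros)+
  then have 00: "zero_part (y 0) + coker_part (y 0) = y 0" by (simp add: coker_part_def)
  have "hc_coords n c = (\<Sum>i\<le>n. tag i (y i))"
  proof -
    have I: "{..n} = insert 0 {0<..n}" by auto
    have "(\<Sum>i\<in>{0<..n}. tag i (zero_part (y i))) = (\<Sum>i\<in>{0<..n}. tag i (y i))"
    proof (intro sum.cong refl)
      fix i assume "i \<in> {0<..n}"
      then show "tag i (zero_part (y i)) = tag i (y i)" using zS by (cases i) auto
    qed
    then have "(\<Sum>i\<le>n. tag i (zero_part (y i))) = tag 0 (zero_part (y 0)) + (\<Sum>i\<in>{0<..n}. tag i (y i))"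
      unfolding I by simp
    moreover have "(\<Sum>i\<le>n. tag i (y i)) = tag 0 (y 0) + (\<Sum>i\<in>{0<..n}. tag i (y i))"
      unfolding I by simp
    moreover have "tag 0 (zero_part (y 0)) + tag 0 (coker_part (y 0)) = tag 0 (y 0)"
      using arg_cong[OF 00, of "tag 0"] by simp
    ultimately show ?thesis by (simp add: hc_coords_def c(3) algebra_simps)
  qed
  also have "\<dots> = v" unfolding y_def
  proof (rule klin_eq_on[where f = "\<lambda>v. \<Sum>i\<le>n. tag i (untag i v)" and g = "\<lambda>v. v", OF _ _ v])
    fix a assume "a \<in> hc_index n"
    then obtain j p where a: "a = (j, p)" "j \<le> n" by (auto simp: hc_index_def)
    have "(\<Sum>i\<le>n. tag i (untag i (bas a))) = (\<Sum>i\<le>n. if i = j then bas a else (0 :: nat \<times> 'g \<times> nat set \<Rightarrow>\<^sub>0 'k))"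
      by (intro sum.cong) (auto simp: a tag_def untag_def)
    then show "(\<Sum>i\<le>n. tag i (untag i (bas a))) = (bas a :: nat \<times> 'g \<times> nat set \<Rightarrow>\<^sub>0 'k)" using a by simp
  qed (intro klin_intros)+
  finally show ?thesis using c by blast
qed

end


section \<open>Vector spaces with coordinates\<close>

text \<open>
  The module \<open>M\<close> is a vector space with a basis indexed by \<open>S\<close>, and \<open>F\<close> takes coordinates. Only
  the bijection and its compatibility with the operations are recorded; the axioms of a vector
  space follow from those of the free one.
\<close>

definition coords :: "('k::field, 'v, 'm) module_scheme \<Rightarrow> 'b set \<Rightarrow> ('v \<Rightarrow> 'b \<Rightarrow>\<^sub>0 'k) \<Rightarrow> bool"
  where "coords M S F \<longleftrightarrow> bij_betw F (carrier M) (fsupp S) \<and> \<zero>\<^bsub>M\<^esub> \<in> carrier M \<and> F \<zero>\<^bsub>M\<^esub> = 0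
    \<and> (\<forall>x\<in>carrier M. \<forall>y\<in>carrier M. x \<oplus>\<^bsub>M\<^esub> y \<in> carrier M \<and> F (x \<oplus>\<^bsub>M\<^esub> y) = F x + F y)
    \<and> (\<forall>c. \<forall>x\<in>carrier M. c \<odot>\<^bsub>M\<^esub> x \<in> carrier M \<and> F (c \<odot>\<^bsub>M\<^esub> x) = c *\<^sub>p F x)"

lemma coordsI:
  assumes "bij_betw F (carrier M) (fsupp S)" "\<zero>\<^bsub>M\<^esub> \<in> carrier M" "F \<zero>\<^bsub>M\<^esub> = 0"
    "\<And>x y. x \<in> carrier M \<Longrightarrow> y \<in> carrier M \<Longrightarrow> x \<oplus>\<^bsub>M\<^esub> y \<in> carrier M"
    "\<And>x y. x \<in> carrier M \<Longrightarrow> y \<in> carrier M \<Longrightarrow> F (x \<oplus>\<^bsub>M\<^esub> y) = F x + F y"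
    "\<And>c x. x \<in> carrier M \<Longrightarrow> c \<odot>\<^bsub>M\<^esub> x \<in> carrier M"
    "\<And>c x. x \<in> carrier M \<Longrightarrow> F (c \<odot>\<^bsub>M\<^esub> x) = c *\<^sub>p F x"
  shows "coords M S F"
  using assms by (simp add: coords_def)

lemma
  assumes "coords M S F"
  shows coords_bij: "bij_betw F (carrier M) (fsupp S)"
    and coords_zero: "\<zero>\<^bsub>M\<^esub> \<in> carrier M" "F \<zero>\<^bsub>M\<^esub> = 0"
    and coords_add: "x \<in> carrier M \<Longrightarrow> y \<in> carrier M \<Longrightarrow> x \<oplus>\<^bsub>M\<^esub> y \<in> carrier M"
      "x \<in> carrier M \<Longrightarrow> y \<in> carrier M \<Longrightarrow> F (x \<oplus>\<^bsub>M\<^esub> y) = F x + F y"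
    and coords_smult: "x \<in> carrier M \<Longrightarrow> c \<odot>\<^bsub>M\<^esub> x \<in> carrier M"
      "x \<in> carrier M \<Longrightarrow> F (c \<odot>\<^bsub>M\<^esub> x) = c *\<^sub>p F x"
  using assms by (simp_all add: coords_def)

lemma coords_fsupp: "coords M S F \<Longrightarrow> x \<in> carrier M \<Longrightarrow> F x \<in> fsupp S"
  using coords_bij bij_betwE by fastforce

lemma coords_inj: "coords M S F \<Longrightarrow> x \<in> carrier M \<Longrightarrow> y \<in> carrier M \<Longrightarrow> F x = F y \<Longrightarrow> x = y"
  by (meson coords_bij bij_betw_imp_inj_on inj_onD)

lemma coords_surj:
  assumes "coords M S F" "p \<in> fsupp S"
  obtains x where "x \<in> carrier M" "F x = p"
  using coords_bij[OF assms(1)] assms(2) by (metis bij_betw_imp_surj_on imageE)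

lemma coords_abelian_group:
  assumes c: "coords M S F"
  shows "abelian_group M"
proof (rule abelian_groupI)
  note [simp] = coords_add[OF c] coords_zero[OF c] coords_smult[OF c]
  note inj = coords_inj[OF c]
  show "\<exists>y\<in>carrier M. y \<oplus>\<^bsub>M\<^esub> x = \<zero>\<^bsub>M\<^esub>" if "x \<in> carrier M" for x
    by (rule bexI[of _ "(- 1) \<odot>\<^bsub>M\<^esub> x"], rule inj) (use that in simp_all)
  show "x \<oplus>\<^bsub>M\<^esub> y \<oplus>\<^bsub>M\<^esub> z = x \<oplus>\<^bsub>M\<^esub> (y \<oplus>\<^bsub>M\<^esub> z)"
    if "x \<in> carrier M" "y \<in> carrier M" "z \<in> carrier M" for x y z
    by (rule inj) (use that in \<open>simp_all add: add.assoc\<close>)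
  show "x \<oplus>\<^bsub>M\<^esub> y = y \<oplus>\<^bsub>M\<^esub> x" if "x \<in> carrier M" "y \<in> carrier M" for x y
    by (rule inj) (use that in \<open>simp_all add: add.commute\<close>)
  show "\<zero>\<^bsub>M\<^esub> \<oplus>\<^bsub>M\<^esub> x = x" if "x \<in> carrier M" for x
    by (rule inj) (use that in simp_all)
qed (simp_all add: coords_add[OF c] coords_zero[OF c])

lemma scalars_simps [simp]:
  "carrier (scalars :: 'k::field ring) = UNIV" "x \<oplus>\<^bsub>scalars :: 'k ring\<^esub> y = x + y"
  "x \<otimes>\<^bsub>scalars :: 'k ring\<^esub> y = x * y" "\<one>\<^bsub>scalars :: 'k ring\<^esub> = 1"
  by (simp_all add: ring_of_type_algebra_def)

lemma coords_module:
  fixes M :: "('k::field, 'v, 'm) module_scheme"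
  assumes c: "coords M S F"
  shows "module (scalars :: 'k ring) M"
proof (rule moduleI)
  note [simp] = coords_add[OF c] coords_zero[OF c] coords_smult[OF c]
  note inj = coords_inj[OF c]
  show "cring (scalars :: 'k ring)" by (rule cring_from_type_algebra)
  show "abelian_group M" by (rule coords_abelian_group[OF c])
  show "(a \<oplus>\<^bsub>scalars\<^esub> b) \<odot>\<^bsub>M\<^esub> x = a \<odot>\<^bsub>M\<^esub> x \<oplus>\<^bsub>M\<^esub> b \<odot>\<^bsub>M\<^esub> x" if "x \<in> carrier M" for a b x
    by (rule inj) (use that in \<open>simp_all add: pscale_add_left\<close>)
  show "a \<odot>\<^bsub>M\<^esub> (x \<oplus>\<^bsub>M\<^esub> y) = a \<odot>\<^bsub>M\<^esub> x \<oplus>\<^bsub>M\<^esub> a \<odot>\<^bsub>M\<^esub> y" if "x \<in> carrier M" "y \<in> carrier M" for a x y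
    by (rule inj) (use that in \<open>simp_all add: pscale_add_right\<close>)
  show "(a \<otimes>\<^bsub>scalars\<^esub> b) \<odot>\<^bsub>M\<^esub> x = a \<odot>\<^bsub>M\<^esub> (b \<odot>\<^bsub>M\<^esub> x)" if "x \<in> carrier M" for a b x
    by (rule inj) (use that in simp_all)
  show "\<one>\<^bsub>scalars\<^esub> \<odot>\<^bsub>M\<^esub> x = x" if "x \<in> carrier M" for x
    by (rule inj) (use that in simp_all)
qed (simp_all add: coords_smult[OF c])

lemma coords_minus:
  assumes c: "coords M S F" and x: "x \<in> carrier M"
  shows "\<ominus>\<^bsub>M\<^esub> x \<in> carrier M" "F (\<ominus>\<^bsub>M\<^esub> x) = - F x"
proof -
  interpret abelian_group M by (rule coords_abelian_group[OF c])
  show m: "\<ominus>\<^bsub>M\<^esub> x \<in> carrier M" using x by simp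
  have "F x + F (\<ominus>\<^bsub>M\<^esub> x) = F \<zero>\<^bsub>M\<^esub>"
    using coords_add(2)[OF c x m] x by (simp add: r_neg)
  then show "F (\<ominus>\<^bsub>M\<^esub> x) = - F x"
    by (simp add: coords_zero[OF c] eq_neg_iff_add_eq_0 add.commute)
qed

lemma coords_diff:
  assumes c: "coords M S F" and "x \<in> carrier M" "y \<in> carrier M"
  shows "x \<ominus>\<^bsub>M\<^esub> y \<in> carrier M" "F (x \<ominus>\<^bsub>M\<^esub> y) = F x - F y"
  using assms by (simp_all add: a_minus_def coords_add[OF c] coords_minus[OF c])

lemma coords_finsum:
  assumes c: "coords M S F" and f: "\<And>a. a \<in> A \<Longrightarrow> f a \<in> carrier M" and "finite A"
  shows "finsum M f A \<in> carrier M" "F (finsum M f A) = (\<Sum>a\<in>A. F (f a))"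
proof -
  interpret abelian_group M by (rule coords_abelian_group[OF c])
  have "finsum M f A \<in> carrier M \<and> F (finsum M f A) = (\<Sum>a\<in>A. F (f a))"
    using \<open>finite A\<close> f
    by (induction A rule: finite_induct) (simp_all add: coords_zero[OF c] coords_add[OF c] Pi_def)
  then show "finsum M f A \<in> carrier M" "F (finsum M f A) = (\<Sum>a\<in>A. F (f a))" by simp_all
qed

lemma coords_isomorphic:
  assumes M: "coords M S F" and N: "coords N S G"
  shows "M \<simeq>\<^sub>k N"
proof -
  define h where "h = inv_into (carrier N) G \<circ> F"
  have iN: "bij_betw (inv_into (carrier N) G) (fsupp S) (carrier N)"
    by (rule bij_betw_inv_into[OF coords_bij[OF N]])
  have bij: "bij_betw h (carrier M) (carrier N)"
    unfolding h_def by (rule bij_betw_trans[OF coords_bij[OF M] iN])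
  then have cl: "h x \<in> carrier N" if "x \<in> carrier M" for x using that bij_betwE by blast
  have Gh: "G (h x) = F x" if "x \<in> carrier M" for x
    unfolding h_def using bij_betw_inv_into_right[OF coords_bij[OF N] coords_fsupp[OF M that]] by simp
  have "h (x \<oplus>\<^bsub>M\<^esub> y) = h x \<oplus>\<^bsub>N\<^esub> h y" if "x \<in> carrier M" "y \<in> carrier M" for x y
    by (rule coords_inj[OF N]) (simp_all add: that cl Gh coords_add[OF M] coords_add[OF N])
  moreover have "h (c \<odot>\<^bsub>M\<^esub> x) = c \<odot>\<^bsub>N\<^esub> h x" if "x \<in> carrier M" for c x
    by (rule coords_inj[OF N]) (simp_all add: that cl Gh coords_smult[OF M] coords_smult[OF N])
  ultimately show ?thesis
    unfolding module_isomorphic_def iso_def hom_def using bij cl by (intro exI[of _ h]) auto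
qed

lemma coords_reindex:
  fixes M :: "('k::field, 'v, 'm) module_scheme" and f :: "'b \<Rightarrow> 'c"
  assumes c: "coords M S F" and f: "bij_betw f S T"
  shows "coords M T (\<lambda>x. ext (\<lambda>a. bas (f a)) (F x))"
proof -
  let ?g = "inv_into S f"
  have "bij_betw (ext (\<lambda>a. bas (f a))) (fsupp S) (fsupp T :: ('c \<Rightarrow>\<^sub>0 'k) set)"
  proof (rule bij_betwI[where g = "ext (\<lambda>b. bas (?g b))"])
    show "ext (\<lambda>a. bas (f a)) \<in> fsupp S \<rightarrow> fsupp T"
      using bij_betwE[OF f] by (auto intro!: ext_fsupp[of _ S] fsupp_single)
    show "ext (\<lambda>b. bas (?g b)) \<in> fsupp T \<rightarrow> fsupp S"
      using bij_betwE[OF bij_betw_inv_into[OF f]] by (auto intro!: ext_fsupp[of _ T] fsupp_single)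
    show "ext (\<lambda>b. bas (?g b)) (ext (\<lambda>a. bas (f a)) p) = p" if "p \<in> fsupp S" for p :: "'b \<Rightarrow>\<^sub>0 'k"
      by (rule klin_eq_on[where g = "\<lambda>p. p", OF _ _ that])
        (auto intro!: klin_intros simp: bij_betw_inv_into_left[OF f])
    show "ext (\<lambda>a. bas (f a)) (ext (\<lambda>b. bas (?g b)) p) = p" if "p \<in> fsupp T" for p :: "'c \<Rightarrow>\<^sub>0 'k"
      by (rule klin_eq_on[where g = "\<lambda>p. p", OF _ _ that])
        (auto intro!: klin_intros simp: bij_betw_inv_into_right[OF f])
  qed
  then have "bij_betw (\<lambda>x. ext (\<lambda>a. bas (f a)) (F x)) (carrier M) (fsupp T)"
    using bij_betw_trans[OF coords_bij[OF c]] by (simp add: o_def)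
  then show ?thesis
    by (intro coordsI) (simp_all add: coords_zero[OF c] coords_add[OF c] coords_smult[OF c])
qed

lemma coords_free_module: "coords (free_module B) B (\<lambda>p. p)"
  by (rule coordsI) (auto simp: free_module_def fsupp_def[symmetric] pscale_def[symmetric] fun_eq_iff bij_betw_def)

text \<open>
  Coordinates of a quotient by the kernel of a linear map.  The hypotheses on \<open>M\<close> are weak enough
  for the space of cycles of a complex.
\<close>

lemma quotient_coords:
  fixes M :: "('k::field, 'v, 'm) module_scheme"
  assumes add: "\<And>x y. x \<in> carrier M \<Longrightarrow> y \<in> carrier M \<Longrightarrow> x \<oplus>\<^bsub>M\<^esub> y \<in> carrier M \<and> \<phi> (x \<oplus>\<^bsub>M\<^esub> y) = \<phi> x + \<phi> y"
    and smult: "\<And>c x. x \<in> carrier M \<Longrightarrow> c \<odot>\<^bsub>M\<^esub> x \<in> carrier M \<and> \<phi> (c \<odot>\<^bsub>M\<^esub> x) = c *\<^sub>p \<phi> x"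
    and sub: "\<And>x y. x \<in> carrier M \<Longrightarrow> y \<in> carrier M \<Longrightarrow> \<exists>z\<in>carrier M. z \<oplus>\<^bsub>M\<^esub> x = y"
    and surj: "\<phi> ` carrier M = fsupp S"
    and H: "H = {x \<in> carrier M. \<phi> x = 0}"
  shows "coords (quotient_module M H) S (\<lambda>U. the_elem (\<phi> ` U))"
    and "\<And>x. x \<in> carrier M \<Longrightarrow> H +>\<^bsub>M\<^esub> x = {y \<in> carrier M. \<phi> y = \<phi> x}"
    and "carrier (quotient_module M H) = (\<lambda>v. {y \<in> carrier M. \<phi> y = v}) ` fsupp S"
proof -
  have cos: "H +>\<^bsub>M\<^esub> x = {y \<in> carrier M. \<phi> y = \<phi> x}" if x: "x \<in> carrier M" for x
  proof -
    have "H +>\<^bsub>M\<^esub> x = {h \<oplus>\<^bsub>M\<^esub> x | h. h \<in> H}" by (auto simp: a_r_coset_def r_coset_def)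
    also have "\<dots> = {y \<in> carrier M. \<phi> y = \<phi> x}"
    proof (intro equalityI subsetI)
      fix y assume "y \<in> {h \<oplus>\<^bsub>M\<^esub> x | h. h \<in> H}"
      then show "y \<in> {y \<in> carrier M. \<phi> y = \<phi> x}" using add x by (auto simp: H)
    next
      fix y assume y: "y \<in> {y \<in> carrier M. \<phi> y = \<phi> x}"
      then obtain z where z: "z \<in> carrier M" "z \<oplus>\<^bsub>M\<^esub> x = y" using sub x by blast
      then have "\<phi> z + \<phi> x = \<phi> x" using add[OF z(1) x] y by simp
      then show "y \<in> {h \<oplus>\<^bsub>M\<^esub> x | h. h \<in> H}" using z by (auto simp: H)
    qed
    finally show ?thesis .
  qed
  then show "\<And>x. x \<in> carrier M \<Longrightarrow> H +>\<^bsub>M\<^esub> x = {y \<in> carrier M. \<phi> y = \<phi> x}" .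
  define D where "D v = {y \<in> carrier M. \<phi> y = v}" for v
  have car: "carrier (quotient_module M H) = D ` fsupp S"
  proof -
    have "carrier (quotient_module M H) = (\<lambda>x. H +>\<^bsub>M\<^esub> x) ` carrier M"
      by (auto simp: quotient_module_def A_RCOSETS_def RCOSETS_def a_r_coset_def)
    also have "\<dots> = (\<lambda>x. D (\<phi> x)) ` carrier M" by (rule image_cong) (simp_all add: cos D_def)
    also have "\<dots> = D ` fsupp S" unfolding surj[symmetric] by auto
    finally show ?thesis .
  qed
  then show "carrier (quotient_module M H) = (\<lambda>v. {y \<in> carrier M. \<phi> y = v}) ` fsupp S"
    by (simp add: D_def)
  have ne: "\<exists>x\<in>carrier M. \<phi> x = v" if "v \<in> fsupp S" for v using that unfolding surj[symmetric] by auto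
  have el: "the_elem (\<phi> ` D v) = v" if "v \<in> fsupp S" for v
  proof -
    have "\<phi> ` D v = {v}" using ne[OF that] by (auto simp: D_def)
    then show ?thesis by simp
  qed
  have in_surj: "\<phi> x \<in> fsupp S" if "x \<in> carrier M" for x using that surj by auto
  have z: "H = D 0" by (auto simp: H D_def)
  have addD: "D v \<oplus>\<^bsub>quotient_module M H\<^esub> D w = D (v + w)" if v: "v \<in> fsupp S" and w: "w \<in> fsupp S" for v w
  proof -
    have "D v \<oplus>\<^bsub>quotient_module M H\<^esub> D w = {a \<oplus>\<^bsub>M\<^esub> b | a b. a \<in> D v \<and> b \<in> D w}"
      by (auto simp: quotient_module_def set_add_def set_mult_def)
    also have "\<dots> = D (v + w)"
    proof (intro equalityI subsetI)
      fix y assume "y \<in> {a \<oplus>\<^bsub>M\<^esub> b | a b. a \<in> D v \<and> b \<in> D w}"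
      then show "y \<in> D (v + w)" using add by (auto simp: D_def)
    next
      fix y assume y: "y \<in> D (v + w)"
      obtain b where b: "b \<in> D w" using ne[OF w] by (auto simp: D_def)
      then obtain a where a: "a \<in> carrier M" "a \<oplus>\<^bsub>M\<^esub> b = y" using sub y by (auto simp: D_def)
      then have "\<phi> a = v" using add[OF a(1), of b] b y by (simp add: D_def)
      then show "y \<in> {a \<oplus>\<^bsub>M\<^esub> b | a b. a \<in> D v \<and> b \<in> D w}" using a b by (auto simp: D_def)
    qed
    finally show ?thesis .
  qed
  have smD: "c \<odot>\<^bsub>quotient_module M H\<^esub> D v = D (c *\<^sub>p v)" if v: "v \<in> fsupp S" for c v
  proof -
    have "c \<odot>\<^bsub>quotient_module M H\<^esub> D v = (\<Union>x\<in>D v. H +>\<^bsub>M\<^esub> (c \<odot>\<^bsub>M\<^esub> x))"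
      by (simp add: quotient_module_def)
    also have "\<dots> = (\<Union>x\<in>D v. D (c *\<^sub>p v))"
      by (rule SUP_cong) (use smult cos in \<open>auto simp: D_def\<close>)
    also have "\<dots> = D (c *\<^sub>p v)" using ne[OF v] by (auto simp: D_def)
    finally show ?thesis .
  qed
  show "coords (quotient_module M H) S (\<lambda>U. the_elem (\<phi> ` U))"
  proof (rule coordsI)
    show "bij_betw (\<lambda>U. the_elem (\<phi> ` U)) (carrier (quotient_module M H)) (fsupp S)"
      unfolding car by (rule bij_betwI[where g = D]) (auto simp: el)
    have "\<zero>\<^bsub>quotient_module M H\<^esub> = D 0" by (simp add: quotient_module_def z)
    then show "\<zero>\<^bsub>quotient_module M H\<^esub> \<in> carrier (quotient_module M H)"
      "the_elem (\<phi> ` \<zero>\<^bsub>quotient_module M H\<^esub>) = 0"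
      by (auto simp: car el)
  qed (auto simp: car el addD smD)
qed

lemma coords_sub:
  assumes c: "coords M S F" and "x \<in> carrier M" "y \<in> carrier M"
  shows "\<exists>z\<in>carrier M. z \<oplus>\<^bsub>M\<^esub> x = y"
  by (rule bexI[of _ "y \<ominus>\<^bsub>M\<^esub> x"], rule coords_inj[OF c])
    (simp_all add: assms coords_add[OF c] coords_diff[OF c])

text \<open>
  The kernel is a subspace, so it contains the span of \<open>Y\<close>; the hypothesis \<open>ker\<close> is the other
  inclusion.
\<close>

lemma submodule_span_eq_kernel:
  fixes M :: "('k::field, 'v, 'm) module_scheme"
  assumes c: "coords M T F"
    and add: "\<And>x y. x \<in> carrier M \<Longrightarrow> y \<in> carrier M \<Longrightarrow> \<phi> (x \<oplus>\<^bsub>M\<^esub> y) = (\<phi> x + \<phi> y :: 'b \<Rightarrow>\<^sub>0 'k)"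
    and smult: "\<And>a x. x \<in> carrier M \<Longrightarrow> \<phi> (a \<odot>\<^bsub>M\<^esub> x) = a *\<^sub>p \<phi> x"
    and Y: "\<And>x. x \<in> Y \<Longrightarrow> x \<in> carrier M \<and> \<phi> x = 0"
    and ker: "\<And>H x. submodule H scalars M \<Longrightarrow> Y \<subseteq> H \<Longrightarrow> x \<in> carrier M \<Longrightarrow> \<phi> x = 0 \<Longrightarrow> x \<in> H"
  shows "submodule_span M Y = {x \<in> carrier M. \<phi> x = 0}"
proof -
  interpret module "scalars :: 'k ring" M by (rule coords_module[OF c])
  have z: "\<phi> \<zero>\<^bsub>M\<^esub> = 0" using add[of "\<zero>\<^bsub>M\<^esub>" "\<zero>\<^bsub>M\<^esub>"] by simp
  have "submodule {x \<in> carrier M. \<phi> x = 0} scalars M"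
  proof (rule submoduleI)
    fix a assume a: "a \<in> {x \<in> carrier M. \<phi> x = 0}"
    then have "\<phi> (\<ominus>\<^bsub>M\<^esub> a) + \<phi> a = 0" using add[of "\<ominus>\<^bsub>M\<^esub> a" a] z by (simp add: l_neg)
    then show "\<ominus>\<^bsub>M\<^esub> a \<in> {x \<in> carrier M. \<phi> x = 0}" using a by simp
  qed (auto simp: z add smult)
  then show ?thesis
    unfolding submodule_span_def using Y ker by (intro equalityI) blast+
qed


section \<open>Tensor powers\<close>

text \<open>
  The product of tensors in coordinates: the words in a basis of \<open>M\<close> form a basis of the tensor
  algebra, and \<open>tens F xs\<close> is the multilinear expansion of the pure tensor of \<open>xs\<close>.
\<close>

definition tcons :: "('b \<Rightarrow>\<^sub>0 'k::field) \<Rightarrow> ('b list \<Rightarrow>\<^sub>0 'k) \<Rightarrow> ('b list \<Rightarrow>\<^sub>0 'k)"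
  where "tcons p q = ext (\<lambda>b. cns b q) p"

primrec tens :: "('v \<Rightarrow> 'b \<Rightarrow>\<^sub>0 'k::field) \<Rightarrow> 'v list \<Rightarrow> ('b list \<Rightarrow>\<^sub>0 'k)"
  where "tens F [] = bas []" | "tens F (x # xs) = tcons (F x) (tens F xs)"

lemma klin_tcons [klin_intros]: "klin (\<lambda>p. tcons p q)" "klin (tcons p)"
proof -
  show "klin (\<lambda>p. tcons p q)" unfolding tcons_def by (rule klin_ext)
  show "klin (tcons p)"
    unfolding tcons_def[abs_def] ext_def
    by (intro klin_intros klin_sumI)
qed

lemmas [klin_intros] = klin_comp[OF klin_tcons(1)] klin_comp[OF klin_tcons(2)]
lemmas tcons_simps [simp] = klin_simps[OF klin_tcons(1)] klin_simps[OF klin_tcons(2)]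

lemma tcons_bas: "tcons (bas b) q = cns b q"
  by (simp add: tcons_def)

definition nlists :: "'b set \<Rightarrow> nat \<Rightarrow> 'b list set"
  where "nlists B n = {l. length l = n \<and> set l \<subseteq> B}"

lemma tcons_fsupp:
  "p \<in> fsupp B \<Longrightarrow> q \<in> fsupp (nlists B n) \<Longrightarrow> tcons p q \<in> fsupp (nlists B (Suc n))"
  unfolding tcons_def
  by (erule ext_fsupp) (auto simp: cns_def nlists_def intro!: ext_fsupp[of q "nlists B n"] fsupp_single)

lemma tens_fsupp: "(\<And>x. x \<in> set xs \<Longrightarrow> F x \<in> fsupp B) \<Longrightarrow> tens F xs \<in> fsupp (nlists B (length xs))"
  by (induction xs) (auto intro!: tcons_fsupp fsupp_single simp: nlists_def[of _ 0])

lemma tens_additive: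
  assumes "F z = F x + F y"
  shows "tens F (us @ z # ws) = tens F (us @ x # ws) + tens F (us @ y # ws)"
  by (induction us) (simp_all add: assms)

lemma tens_scale:
  assumes "F z = c *\<^sub>p F x"
  shows "tens F (us @ z # ws) = c *\<^sub>p tens F (us @ x # ws)"
  by (induction us) (simp_all add: assms)

lemma submodule_free_module:
  fixes H :: "('b \<Rightarrow>\<^sub>0 'k::field) set"
  assumes "submodule H scalars (free_module T)"
  shows "0 \<in> H" "p \<in> H \<Longrightarrow> q \<in> H \<Longrightarrow> p + q \<in> H" "p \<in> H \<Longrightarrow> c *\<^sub>p p \<in> H" "p \<in> H \<Longrightarrow> - p \<in> H"
proof -
  interpret submodule H scalars "free_module T" by (rule assms)
  show "0 \<in> H" using one_closed by (simp add: free_module_def)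
  show "p \<in> H \<Longrightarrow> q \<in> H \<Longrightarrow> p + q \<in> H" using m_closed[of p q] by (simp add: free_module_def)
  show sc: "c *\<^sub>p p \<in> H" if "p \<in> H" for c p using smult_closed[of c p] that by (simp add: free_module_def pscale_def)
  show "p \<in> H \<Longrightarrow> - p \<in> H" using sc[of p "- 1"] by simp
qed

lemma fsupp_induct [consumes 1, case_names zero add single]:
  assumes p: "p \<in> fsupp S" and "P 0"
    "\<And>p q. p \<in> fsupp S \<Longrightarrow> q \<in> fsupp S \<Longrightarrow> P p \<Longrightarrow> P q \<Longrightarrow> P (p + q)"
    "\<And>a c. a \<in> S \<Longrightarrow> P (c *\<^sub>p bas a)"
  shows "P (p :: 'b \<Rightarrow>\<^sub>0 'k::field)"
proof -
  have "finite A \<Longrightarrow> A \<subseteq> S \<Longrightarrow> P (\<Sum>a\<in>A. Poly_Mapping.lookup p a *\<^sub>p bas a)" for A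
  proof (induction A rule: finite_induct)
    case (insert a A)
    then have "P (Poly_Mapping.lookup p a *\<^sub>p bas a + (\<Sum>a\<in>A. Poly_Mapping.lookup p a *\<^sub>p bas a))"
      by (intro assms(3,4) fsupp_simps fsupp_single fsupp_sum) auto
    then show ?case using insert by simp
  qed (use assms in simp)
  from this[of "Poly_Mapping.keys p"] show ?thesis
    using p by (simp add: fsupp_def flip: poly_mapping_decomp)
qed

context
  fixes M :: "('k::field, 'v, 'm) module_scheme" and B :: "'b set" and F
  assumes c: "coords M B F"
begin

definition base_vec :: "'b \<Rightarrow> 'v"
  where "base_vec b = inv_into (carrier M) F (bas b)"

lemma base_vec: "b \<in> B \<Longrightarrow> base_vec b \<in> carrier M" "b \<in> B \<Longrightarrow> F (base_vec b) = bas b"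
proof -
  assume "b \<in> B"
  then have "bas b \<in> F ` carrier M" using bij_betw_imp_surj_on[OF coords_bij[OF c]] by simp
  then show "base_vec b \<in> carrier M" "F (base_vec b) = bas b"
    unfolding base_vec_def by (rule inv_into_into, rule f_inv_into_f)
qed

lemma tens_base_vec: "set l \<subseteq> B \<Longrightarrow> tens F (map base_vec l) = bas l"
  by (induction l) (simp_all add: base_vec tcons_bas cns_bas)

lemma tensor_relations_kernel:
  assumes "r \<in> tensor_relations M n"
  shows "r \<in> fsupp (tuples M n) \<and> ext (tens F) r = 0"
proof -
  have tup: "us @ x # ws \<in> tuples M n" if "xs \<in> tuples M n" "i < n" "us = take i xs" "ws = drop (Suc i) xs" "x \<in> carrier M" for xs i us ws x
    using that by (auto simp: tuples_def dest: in_set_takeD in_set_dropD)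
  have up: "xs[i := x] = take i xs @ x # drop (Suc i) xs" if "xs \<in> tuples M n" "i < n" for xs i x
    using that by (simp add: tuples_def upd_conv_take_nth_drop)
  from assms consider
    xs i x y where "xs \<in> tuples M n" "i < n" "x \<in> carrier M" "y \<in> carrier M"
      "r = bas (xs[i := x \<oplus>\<^bsub>M\<^esub> y]) - bas (xs[i := x]) - bas (xs[i := y])"
  | xs i a x where "xs \<in> tuples M n" "i < n" "x \<in> carrier M"
      "r = bas (xs[i := a \<odot>\<^bsub>M\<^esub> x]) - Poly_Mapping.single (xs[i := x]) a"
    unfolding tensor_relations_def by blast
  then show ?thesis
  proof cases
    case 1
    then show ?thesis
      using tens_additive[of F "x \<oplus>\<^bsub>M\<^esub> y" x y] coords_add[OF c]
      by (auto simp: up tup intro!: fsupp_single fsupp_simps(4))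
  next
    case 2
    then show ?thesis
      using tens_scale[of F "a \<odot>\<^bsub>M\<^esub> x" a x] coords_smult[OF c]
      by (auto simp: up tup intro!: fsupp_single fsupp_simps(4))
  qed
qed

text \<open>
  Modulo the multilinearity relations every entry can be expanded in the basis. The entries in
  \<open>us\<close> are left alone, so that the induction can expand the list from its end.
\<close>

lemma tensor_null_reduce:
  assumes H: "submodule H scalars (free_module (tuples M n))" "tensor_relations M n \<subseteq> H"
    and xs: "us @ vs \<in> tuples M n"
  shows "bas (us @ vs) - ext (\<lambda>l. bas (us @ map base_vec l)) (tens F vs) \<in> H"
  using xs
proof (induction vs arbitrary: us)
  case Nil
  then show ?case using submodule_free_module(1)[OF H(1)] by simp
next
  case (Cons x vs)
  note h = submodule_free_module[OF H(1)]
  have hd: "p \<in> H \<Longrightarrow> q \<in> H \<Longrightarrow> p - q \<in> H" for p q using h(2)[of p "- q"] h(4) by simp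
  have x: "x \<in> carrier M" using Cons.prems by (simp add: tuples_def)
  have lin: "\<forall>y\<in>carrier M. F y = p \<longrightarrow> bas (us @ y # ws) - ext (\<lambda>b. bas (us @ base_vec b # ws)) p \<in> H"
    if p: "p \<in> fsupp B" and ws: "us @ x # ws \<in> tuples M n" for p ws
    using p
  proof (induction p rule: fsupp_induct)
    define xs where "xs = us @ x # ws"
    have i: "length us < n" and xs: "xs \<in> tuples M n" using ws by (simp_all add: tuples_def xs_def)
    have up: "us @ y # ws = xs[length us := y]" for y by (simp add: xs_def)
    have rel1: "bas (us @ (y \<oplus>\<^bsub>M\<^esub> z) # ws) - bas (us @ y # ws) - bas (us @ z # ws) \<in> H"
      if "y \<in> carrier M" "z \<in> carrier M" for y z
      using H(2) xs i that unfolding up tensor_relations_def by blast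
    have rel2: "bas (us @ (a \<odot>\<^bsub>M\<^esub> y) # ws) - Poly_Mapping.single (us @ y # ws) a \<in> H"
      if "y \<in> carrier M" for a y
      using H(2) xs i that unfolding up tensor_relations_def by blast
    {
      case zero
      have "0 \<odot>\<^bsub>M\<^esub> y = y" if "y \<in> carrier M" "F y = 0" for y
        by (rule coords_inj[OF c]) (simp_all add: that coords_smult[OF c])
      then show ?case using rel2[of _ 0] by force
    next
      case (add p q)
      show ?case
      proof (intro ballI impI)
        fix y assume y: "y \<in> carrier M" "F y = p + q"
        obtain y1 where y1: "y1 \<in> carrier M" "F y1 = p" using coords_surj[OF c add(1)] .
        obtain y2 where y2: "y2 \<in> carrier M" "F y2 = q" using coords_surj[OF c add(2)] .
        have e: "y = y1 \<oplus>\<^bsub>M\<^esub> y2" by (rule coords_inj[OF c]) (simp_all add: y y1 y2 coords_add[OF c])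
        let ?E = "ext (\<lambda>b. bas (us @ base_vec b # ws))"
        have "bas (us @ y # ws) - ?E (p + q) = (bas (us @ (y1 \<oplus>\<^bsub>M\<^esub> y2) # ws) - bas (us @ y1 # ws) - bas (us @ y2 # ws))
          + ((bas (us @ y1 # ws) - ?E p) + (bas (us @ y2 # ws) - ?E q))" by (simp add: e)
        also have "\<dots> \<in> H" using add y1 y2 by (intro h(2) rel1) auto
        finally show "bas (us @ y # ws) - ?E (p + q) \<in> H" .
      qed
    next
      case (single b a)
      show ?case
      proof (intro ballI impI)
        fix y assume y: "y \<in> carrier M" "F y = a *\<^sub>p bas b"
        have "y = a \<odot>\<^bsub>M\<^esub> base_vec b"
          by (rule coords_inj[OF c]) (simp_all add: y single base_vec coords_smult[OF c])
        then show "bas (us @ y # ws) - ext (\<lambda>b. bas (us @ base_vec b # ws)) (a *\<^sub>p bas b) \<in> H"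
          using rel2[OF base_vec(1)[OF single], of a] by (simp add: pscale_single)
      qed
    }
  qed
  have tv: "tens F vs \<in> fsupp (nlists B (length vs))"
    using Cons.prems by (intro tens_fsupp) (auto simp: tuples_def intro!: coords_fsupp[OF c])
  let ?L = "ext (\<lambda>l. bas (us @ x # map base_vec l))"
  let ?R = "ext (\<lambda>l. bas (us @ map base_vec l))"
  have 1: "bas (us @ x # vs) - ?L (tens F vs) \<in> H"
    using Cons.IH[of "us @ [x]"] Cons.prems by simp
  have 2: "?L q - ?R (tcons (F x) q) \<in> H" if "q \<in> fsupp (nlists B (length vs))" for q
    using that
  proof (induction q rule: fsupp_induct)
    case (add p q)
    then show ?case using h(2)[OF add(3,4)] by (simp add: algebra_simps)
  next
    case (single l a)
    have t: "us @ x # map base_vec l \<in> tuples M n"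
      using Cons.prems single by (auto simp: tuples_def nlists_def base_vec)
    have r: "?R (tcons (F x) (bas l)) = ext (\<lambda>b. bas (us @ base_vec b # map base_vec l)) (F x)"
      unfolding tcons_def ext_ext by (simp add: cns_bas)
    have "bas (us @ x # map base_vec l) - ?R (tcons (F x) (bas l)) \<in> H"
      unfolding r using lin[OF coords_fsupp[OF c x] t] x by blast
    from h(3)[OF this, of a] show ?case by (simp add: pscale_diff_right)
  qed (use h(1) in simp)
  show ?case using h(2)[OF 1 2[OF tv]] by simp
qed

text \<open>A combination of tuples with vanishing expansion is congruent to its expansion, hence to zero.\<close>

lemma tensor_null_eq: "tensor_null M n = {p \<in> fsupp (tuples M n). ext (tens F) p = 0}"
proof -
  have car: "carrier (free_module (tuples M n)) = (fsupp (tuples M n) :: ('v list \<Rightarrow>\<^sub>0 'k) set)"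
    by (simp add: free_module_def fsupp_def)
  have "submodule_span (free_module (tuples M n)) (tensor_relations M n)
      = {p \<in> carrier (free_module (tuples M n)). ext (tens F) p = 0}"
  proof (rule submodule_span_eq_kernel[OF coords_free_module])
    fix H p assume H: "submodule H scalars (free_module (tuples M n))" "tensor_relations M n \<subseteq> H"
      and p: "p \<in> carrier (free_module (tuples M n))" "ext (tens F) p = 0"
    note h = submodule_free_module[OF H(1)]
    have "p - ext (\<lambda>l. bas (map base_vec l)) (ext (tens F) p) \<in> H" if "p \<in> fsupp (tuples M n)"
      using that
    proof (induction p rule: fsupp_induct)
      case (add p q)
      then show ?case using h(2)[OF add(3,4)] by (simp add: algebra_simps)
    next
      case (single l a)
      then show ?case using h(3)[OF tensor_null_reduce[OF H, of "[]" l], of a] by (simp add: pscale_diff_right)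
    qed (use h(1) in simp)
    then show "p \<in> H" using p by (simp add: car)
  qed (use tensor_relations_kernel in \<open>auto simp: car\<close>, simp_all add: free_module_def flip: pscale_def)
  then show ?thesis by (simp add: tensor_null_def car)
qed

definition tval :: "('v list \<Rightarrow>\<^sub>0 'k) set \<Rightarrow> ('b list \<Rightarrow>\<^sub>0 'k)"
  where "tval U = the_elem (ext (tens F) ` U)"

lemma tensor_coords:
  shows "coords (tensor_power M n) (nlists B n) tval"
    and "p \<in> fsupp (tuples M n) \<Longrightarrow> tensor_null M n +>\<^bsub>free_module (tuples M n)\<^esub> p
      = {q \<in> fsupp (tuples M n). ext (tens F) q = ext (tens F) p}"
    and "carrier (tensor_power M n) = (\<lambda>v. {q \<in> fsupp (tuples M n). ext (tens F) q = v}) ` fsupp (nlists B n)"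
proof -
  have car: "carrier (free_module (tuples M n)) = (fsupp (tuples M n) :: ('v list \<Rightarrow>\<^sub>0 'k) set)"
    by (simp add: free_module_def fsupp_def)
  have surj: "ext (tens F) ` fsupp (tuples M n) = fsupp (nlists B n)"
  proof (intro equalityI subsetI)
    fix v assume "v \<in> ext (tens F) ` fsupp (tuples M n)"
    then obtain p where p: "p \<in> fsupp (tuples M n)" "v = ext (tens F) p" by auto
    have "tens F xs \<in> fsupp (nlists B n)" if "xs \<in> tuples M n" for xs
      using tens_fsupp[of xs F B] that by (auto simp: tuples_def intro!: coords_fsupp[OF c])
    then show "v \<in> fsupp (nlists B n)" using p by (auto intro: ext_fsupp)
  next
    fix v :: "'b list \<Rightarrow>\<^sub>0 'k" assume v: "v \<in> fsupp (nlists B n)"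
    have "ext (\<lambda>l. bas (map base_vec l)) v \<in> fsupp (tuples M n)"
      by (rule ext_fsupp[OF v]) (auto simp: nlists_def tuples_def intro!: fsupp_single base_vec(1))
    moreover have "ext (tens F) (ext (\<lambda>l. bas (map base_vec l)) v) = v"
      by (rule klin_eq_on[where g = "\<lambda>v. v", OF _ _ v])
        (auto intro!: klin_intros simp: nlists_def tens_base_vec)
    ultimately show "v \<in> ext (tens F) ` fsupp (tuples M n)" by force
  qed
  note q = quotient_coords[where M = "free_module (tuples M n)" and \<phi> = "ext (tens F)" and S = "nlists B n"
      and H = "tensor_null M n", unfolded car]
  have a: "x \<oplus>\<^bsub>free_module (tuples M n)\<^esub> y = x + y" "c \<odot>\<^bsub>free_module (tuples M n)\<^esub> x = c *\<^sub>p x" for x y :: "'v list \<Rightarrow>\<^sub>0 'k" and c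
    by (simp_all add: free_module_def pscale_def)
  have sub: "\<exists>z\<in>fsupp (tuples M n). z + x = y" if "x \<in> fsupp (tuples M n)" "y \<in> fsupp (tuples M n)" for x y :: "'v list \<Rightarrow>\<^sub>0 'k"
    using that by (intro bexI[of _ "y - x"]) simp_all
  show "coords (tensor_power M n) (nlists B n) tval"
    unfolding tensor_power_def tval_def[abs_def] by (rule q(1)) (simp_all add: a surj tensor_null_eq sub)
  show "p \<in> fsupp (tuples M n) \<Longrightarrow> tensor_null M n +>\<^bsub>free_module (tuples M n)\<^esub> p
      = {q \<in> fsupp (tuples M n). ext (tens F) q = ext (tens F) p}"
    by (rule q(2)) (simp_all add: a surj tensor_null_eq sub)
  show "carrier (tensor_power M n) = (\<lambda>v. {q \<in> fsupp (tuples M n). ext (tens F) q = v}) ` fsupp (nlists B n)"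
    unfolding tensor_power_def by (rule q(3)) (simp_all add: a surj tensor_null_eq sub)
qed

lemma tval_eq:
  assumes "U \<in> carrier (tensor_power M n)"
  shows "U = {q \<in> fsupp (tuples M n). ext (tens F) q = tval U}" "U \<noteq> {}"
proof -
  obtain v where U: "U = {q \<in> fsupp (tuples M n). ext (tens F) q = v}" and v: "v \<in> fsupp (nlists B n)"
    using assms unfolding tensor_coords(3) by auto
  have "ext (\<lambda>l. bas (map base_vec l)) v \<in> U"
    unfolding U using v
    by (auto intro!: ext_fsupp[OF v] klin_eq_on[where g = "\<lambda>v. v", OF _ _ v] klin_intros fsupp_single
        base_vec(1) simp: nlists_def tuples_def tens_base_vec)
  then show ne: "U \<noteq> {}" by auto
  then have "ext (tens F) ` U = {v}" using U by auto
  then have "tval U = v" by (simp add: tval_def)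
  then show "U = {q \<in> fsupp (tuples M n). ext (tens F) q = tval U}" using U by simp
qed

lemma tval_mem:
  assumes "U \<in> carrier (tensor_power M n)" "p \<in> U"
  shows "p \<in> fsupp (tuples M n)" "ext (tens F) p = tval U"
  using equalityD1[OF tval_eq(1)[OF assms(1)], THEN subsetD, OF assms(2)] by auto

lemma pure_tensor:
  assumes "xs \<in> tuples M n"
  shows "pure_tensor M xs \<in> carrier (tensor_power M n)" "tval (pure_tensor M xs) = tens F xs"
proof -
  have n: "length xs = n" using assms by (simp add: tuples_def)
  have p: "(bas xs :: 'v list \<Rightarrow>\<^sub>0 'k) \<in> fsupp (tuples M n)" using assms by simp
  have e: "pure_tensor M xs = {q \<in> fsupp (tuples M n). ext (tens F) q = tens F xs}"
    unfolding pure_tensor_def n by (simp add: tensor_coords(2)[OF p])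
  have t: "tens F xs \<in> fsupp (nlists B n)"
    using tens_fsupp[of xs F B] assms n by (auto simp: tuples_def intro!: coords_fsupp[OF c])
  show 1: "pure_tensor M xs \<in> carrier (tensor_power M n)"
    unfolding e tensor_coords(3) using t by blast
  have "bas xs \<in> pure_tensor M xs" unfolding e using p by simp
  from tval_mem(2)[OF 1 this] show "tval (pure_tensor M xs) = tens F xs" by simp
qed

lemma tensor_lift_coords:
  assumes N: "coords N S G" and f: "\<And>xs. xs \<in> tuples M n \<Longrightarrow> f xs \<in> carrier N"
    and L: "klin L" "\<And>xs. xs \<in> tuples M n \<Longrightarrow> G (f xs) = L (tens F xs)"
    and U: "U \<in> carrier (tensor_power M n)"
  shows "tensor_lift N f U \<in> carrier N" "G (tensor_lift N f U) = L (tval U)"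
proof -
  have lift: "free_lift N f p \<in> carrier N \<and> G (free_lift N f p) = L (ext (tens F) p)"
    if p: "p \<in> fsupp (tuples M n)" for p
  proof -
    have fc: "Poly_Mapping.lookup p b \<odot>\<^bsub>N\<^esub> f b \<in> carrier N" if "b \<in> Poly_Mapping.keys p" for b
      using that p f by (auto simp: fsupp_def intro!: coords_smult[OF N])
    have "G (free_lift N f p) = (\<Sum>b\<in>Poly_Mapping.keys p. G (Poly_Mapping.lookup p b \<odot>\<^bsub>N\<^esub> f b))"
      unfolding free_lift_def by (rule coords_finsum(2)[OF N fc]) simp_all
    also have "\<dots> = (\<Sum>b\<in>Poly_Mapping.keys p. Poly_Mapping.lookup p b *\<^sub>p L (tens F b))"
      using p f L by (intro sum.cong) (auto simp: fsupp_def coords_smult[OF N])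
    also have "\<dots> = L (ext (tens F) p)"
      by (simp add: ext_def klin_sum[OF L(1)] klin_scale[OF L(1)])
    finally have "G (free_lift N f p) = L (ext (tens F) p)" .
    moreover have "free_lift N f p \<in> carrier N"
      unfolding free_lift_def by (rule coords_finsum(1)[OF N fc]) simp_all
    ultimately show ?thesis by simp
  qed
  obtain q where q: "q \<in> U" using tval_eq(2)[OF U] by auto
  have fl: "free_lift N f p \<in> carrier N" "G (free_lift N f p) = L (tval U)" if "p \<in> U" for p
    using lift[OF tval_mem(1)[OF U that]] tval_mem(2)[OF U that] by simp_all
  have "free_lift N f p = free_lift N f q" if "p \<in> U" for p
    using fl(2)[OF that] fl(2)[OF q] by (intro coords_inj[OF N fl(1)[OF that] fl(1)[OF q]]) simp
  then have "free_lift N f ` U = (\<lambda>_. free_lift N f q) ` U" by (rule image_cong[OF refl])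
  also have "\<dots> = {free_lift N f q}" using q by auto
  finally have "free_lift N f ` U = {free_lift N f q}" .
  then have "tensor_lift N f U = free_lift N f q" by (simp add: tensor_lift_def)
  then show "tensor_lift N f U \<in> carrier N" "G (tensor_lift N f U) = L (tval U)"
    using fl[OF q] by simp_all
qed

end


section \<open>Exterior powers and direct sums\<close>

definition wedge_comb :: "(nat \<Rightarrow>\<^sub>0 'k::field) \<Rightarrow> (nat set \<Rightarrow>\<^sub>0 'k) \<Rightarrow> (nat set \<Rightarrow>\<^sub>0 'k)"
  where "wedge_comb p y = ext (\<lambda>i. wedge1 i y) p"

primrec wedge_word :: "nat list \<Rightarrow> (nat set \<Rightarrow>\<^sub>0 'k::field)"
  where "wedge_word [] = bas {}" | "wedge_word (i # l) = wedge1 i (wedge_word l)"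

lemma wedge_word_cns: "ext wedge_word (cns i q) = wedge1 i (ext wedge_word q)"
  by (rule klin_eqI[where p = q]) (auto intro!: klin_intros simp: cns_bas)

lemma wedge_word_tcons: "ext wedge_word (tcons p q) = wedge_comb p (ext wedge_word q)"
  by (simp add: tcons_def wedge_comb_def ext_ext wedge_word_cns)

lemma klin_wedge_comb: "klin (wedge_comb p)"
  unfolding wedge_comb_def[abs_def] ext_def by (intro klin_intros klin_sumI)

lemma wedge_comb_anticomm: "wedge_comb p (wedge_comb q y) = - wedge_comb q (wedge_comb p y)"
proof -
  have e: "wedge1 i (ext (\<lambda>j. wedge1 j y) q) = ext (\<lambda>j. wedge1 i (wedge1 j y)) q" for i q and y :: "nat set \<Rightarrow>\<^sub>0 'a"
    by (rule klin_eqI[where p = q]) (auto intro!: klin_intros)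
  have n: "ext (\<lambda>j. - f j) q = - ext f q" for f :: "nat \<Rightarrow> nat set \<Rightarrow>\<^sub>0 'a" and q
    by (rule klin_eqI[where p = q]) (auto intro!: klin_intros)
  have w: "wedge1 i (wedge1 j y) = - wedge1 j (wedge1 i y)" for i j
    using wedge1_anticomm'[of i j y] by (simp add: eq_neg_iff_add_eq_0)
  have "wedge_comb p (wedge_comb q y) = ext (\<lambda>i. ext (\<lambda>j. wedge1 i (wedge1 j y)) q) p"
    by (simp add: wedge_comb_def e)
  also have "\<dots> = ext (\<lambda>j. ext (\<lambda>i. wedge1 i (wedge1 j y)) p) q"
    by (rule ext_swap)
  also have "\<dots> = ext (\<lambda>j. ext (\<lambda>i. - wedge1 j (wedge1 i y)) p) q"
    by (subst w) (rule refl)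
  also have "\<dots> = - wedge_comb q (wedge_comb p y)"
    by (simp add: wedge_comb_def e n)
  finally show ?thesis .
qed

primrec wedge_combs :: "(nat \<Rightarrow>\<^sub>0 'k::field) list \<Rightarrow> (nat set \<Rightarrow>\<^sub>0 'k)"
  where "wedge_combs [] = bas {}" | "wedge_combs (p # ps) = wedge_comb p (wedge_combs ps)"

lemma wedge_word_tens: "ext wedge_word (tens (\<lambda>p. p) ps) = wedge_combs ps"
  by (induction ps) (simp_all add: wedge_word_tcons)

lemma wedge_combs_repeated:
  fixes ps :: "(nat \<Rightarrow>\<^sub>0 'k::field_char_0) list"
  shows "\<not> distinct ps \<Longrightarrow> wedge_combs ps = 0"
proof (induction ps)
  case (Cons p ps)
  have "q \<in> set qs \<Longrightarrow> wedge_comb q (wedge_combs qs) = 0" for q and qs :: "(nat \<Rightarrow>\<^sub>0 'k) list"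
  proof (induction qs)
    case (Cons a qs)
    show ?case
    proof (cases "q = a")
      case True
      then show ?thesis by (simp add: eq_uminus_imp_0[OF wedge_comb_anticomm])
    next
      case False
      then have "wedge_comb q (wedge_comb a (wedge_combs qs)) = - wedge_comb a 0"
        using Cons by (subst wedge_comb_anticomm) simp
      then show ?thesis by (simp add: klin_zero[OF klin_wedge_comb])
    qed
  qed simp
  then show ?case using Cons by (auto simp: klin_zero[OF klin_wedge_comb])
qed simp

text \<open>
  The span of the tensors with a repeated factor, in coordinates.  Modulo it, a word in the basis
  vectors can be sorted at the cost of signs.
\<close>

inductive_set alt_null :: "nat \<Rightarrow> nat \<Rightarrow> (nat list \<Rightarrow>\<^sub>0 'k::field) set" for m n where
  gen: "set ps \<subseteq> fsupp {..<m} \<Longrightarrow> \<not> distinct ps \<Longrightarrow> length ps = n \<Longrightarrow> tens (\<lambda>p. p) ps \<in> alt_null m n"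
| zero: "0 \<in> alt_null m n"
| add: "p \<in> alt_null m n \<Longrightarrow> q \<in> alt_null m n \<Longrightarrow> p + q \<in> alt_null m n"
| scale: "p \<in> alt_null m n \<Longrightarrow> c *\<^sub>p p \<in> alt_null m n"

lemma alt_null_minus: "p \<in> alt_null m n \<Longrightarrow> - p \<in> alt_null m n"
  using alt_null.scale[of p m n "- 1"] by simp

lemma alt_null_diff: "p \<in> alt_null m n \<Longrightarrow> q \<in> alt_null m n \<Longrightarrow> p - q \<in> alt_null m n"
  using alt_null.add[OF _ alt_null_minus, of p m n q] by simp

lemma alt_null_cns: "p \<in> alt_null m n \<Longrightarrow> a < m \<Longrightarrow> cns a p \<in> alt_null m (Suc n)"
proof (induction p rule: alt_null.induct)
  case (gen ps)
  have "tens (\<lambda>p. p) (bas a # ps) \<in> alt_null m (Suc n)"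
    using gen by (intro alt_null.gen) auto
  then show ?case by (simp add: tcons_bas)
qed (auto simp: klin_simps[OF klin_cns] intro: alt_null.intros)

text \<open>Polarization: expand the square of \<open>bas a + bas b\<close>.\<close>

lemma alt_null_swap:
  assumes "a < m" "b < m" "set r \<subseteq> {..<m}" "length r = n"
  shows "(bas (a # b # r) + bas (b # a # r) :: nat list \<Rightarrow>\<^sub>0 'k::field) \<in> alt_null m (Suc (Suc n))"
    "(bas (a # a # r) :: nat list \<Rightarrow>\<^sub>0 'k) \<in> alt_null m (Suc (Suc n))"
proof -
  have t: "tens (\<lambda>p. p) (map bas r) = (bas r :: nat list \<Rightarrow>\<^sub>0 'k)"
    by (induction r) (simp_all add: tcons_bas cns_bas)
  have g: "tcons p (tcons p (bas r :: nat list \<Rightarrow>\<^sub>0 'k)) \<in> alt_null m (Suc (Suc n))" if "p \<in> fsupp {..<m}" for p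
    using alt_null.gen[of "p # p # map bas r" m "Suc (Suc n)"] that assms
    by (auto simp: t intro!: fsupp_single)
  show 2: "(bas (a # a # r) :: nat list \<Rightarrow>\<^sub>0 'k) \<in> alt_null m (Suc (Suc n))"
    using g[of "bas a"] assms by (simp add: tcons_bas cns_bas)
  have 3: "(bas (b # b # r) :: nat list \<Rightarrow>\<^sub>0 'k) \<in> alt_null m (Suc (Suc n))"
    using g[of "bas b"] assms by (simp add: tcons_bas cns_bas)
  have 1: "tcons (bas a + bas b) (tcons (bas a + bas b) (bas r :: nat list \<Rightarrow>\<^sub>0 'k)) \<in> alt_null m (Suc (Suc n))"
    using assms by (intro g) simp
  have "(bas (a # b # r) + bas (b # a # r) :: nat list \<Rightarrow>\<^sub>0 'k)
      = tcons (bas a + bas b) (tcons (bas a + bas b) (bas r)) - bas (a # a # r) - bas (b # b # r)"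
    by (simp add: tcons_bas cns_bas)
  also have "\<dots> \<in> alt_null m (Suc (Suc n))" by (intro alt_null_diff 1 2 3)
  finally show "(bas (a # b # r) + bas (b # a # r) :: nat list \<Rightarrow>\<^sub>0 'k) \<in> alt_null m (Suc (Suc n))" .
qed

definition sorted_word :: "(nat set \<Rightarrow>\<^sub>0 'k::field) \<Rightarrow> (nat list \<Rightarrow>\<^sub>0 'k)"
  where "sorted_word = ext (\<lambda>S. bas (sorted_list_of_set S))"

lemma klin_sorted_word [klin_intros]: "klin sorted_word"
  by (simp add: sorted_word_def klin_ext)

lemmas [klin_intros] = klin_comp[OF klin_sorted_word]
lemmas sorted_word_simps [simp] = klin_simps[OF klin_sorted_word]

lemma sign_below_min: "(\<And>b. b \<in> S \<Longrightarrow> a < b) \<Longrightarrow> sign_below a S = (1 :: 'k::field)"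
proof -
  assume "\<And>b. b \<in> S \<Longrightarrow> a < b"
  then have "{j \<in> S. j < a} = {}" by fastforce
  then show ?thesis unfolding sign_below_def by (simp only: card.empty power_0)
qed

lemma sorted_word_below:
  assumes "finite S" "\<And>b. b \<in> S \<Longrightarrow> a < b"
  shows "sorted_word (wedge1 a (bas S)) = cns a (sorted_word (bas S :: nat set \<Rightarrow>\<^sub>0 'k::field))"
    "sorted_list_of_set (insert a S) = a # sorted_list_of_set S"
proof -
  have a: "a \<notin> S" "{j \<in> S. j < a} = {}" using assms(2) by fastforce+
  show s: "sorted_list_of_set (insert a S) = a # sorted_list_of_set S"
    using assms a by (intro sorted_list_of_set_nonempty[of "insert a S", THEN trans])
      (auto simp: Min_insert2 less_imp_le intro: arg_cong[where f = sorted_list_of_set])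
  then show "sorted_word (wedge1 a (bas S)) = cns a (sorted_word (bas S :: nat set \<Rightarrow>\<^sub>0 'k))"
    using a(1) sign_below_min[OF assms(2), where 'k = 'k] by (simp add: sorted_word_def wedge1_bas cns_bas)
qed

text \<open>
  Insertion sort, with \<open>wedge1\<close> keeping track of the sign: a letter that is larger than the
  smallest letter of the word is exchanged with it, and the induction applies to the rest.
\<close>

lemma sort_insert:
  fixes y :: "nat set \<Rightarrow>\<^sub>0 'k::field"
  assumes "a < m"
  shows "S \<in> nsets m n \<Longrightarrow> cns a (sorted_word (bas S)) - sorted_word (wedge1 a (bas S :: nat set \<Rightarrow>\<^sub>0 'k))
    \<in> alt_null m (Suc n)"
proof (induction n arbitrary: S)
  case 0
  then have "S = {}" by (auto simp: nsets_def dest: finite_subset[OF _ finite_lessThan])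
  then show ?case using sorted_word_below(1)[of "{}" a, where 'k = 'k] by (simp add: alt_null.zero)
next
  case (Suc n)
  define b U where "b = Min S" and "U = S - {b}"
  have fin: "finite S" "S \<noteq> {}" "S \<subseteq> {..<m}" using Suc.prems by (auto simp: nsets_def nsets_finite[OF Suc.prems])
  then have b: "b \<in> S" "\<And>c. c \<in> U \<Longrightarrow> b < c"
    by (auto simp: b_def U_def less_le)
  have S: "S = insert b U" "b \<notin> U" using b by (auto simp: U_def)
  have bm: "b < m" and U: "U \<in> nsets m n" using Suc.prems fin b by (auto simp: U_def nsets_def)
  have fU: "finite U" using fin S by simp
  have wS: "(bas S :: nat set \<Rightarrow>\<^sub>0 'k) = wedge1 b (bas U)"
    using S sign_below_min[OF b(2), where 'k = 'k] by (simp add: wedge1_bas)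
  have sS: "sorted_word (bas S :: nat set \<Rightarrow>\<^sub>0 'k) = bas (b # sorted_list_of_set U)"
    using sorted_word_below(2)[OF fU b(2)] S by (simp add: sorted_word_def)
  let ?r = "sorted_list_of_set U"
  have r: "set ?r \<subseteq> {..<m}" "length ?r = n" using U fU by (auto simp: nsets_def)
  consider "a < b" | "a = b" | "b < a" by linarith
  then show ?case
  proof cases
    case 1
    then have "\<And>c. c \<in> S \<Longrightarrow> a < c" using S b(2) by fastforce
    then show ?thesis using sorted_word_below(1)[OF fin(1), of a, where 'k = 'k] by (simp add: alt_null.zero)
  next
    case 2
    then have "wedge1 a (bas S :: nat set \<Rightarrow>\<^sub>0 'k) = 0" using b by (simp add: wedge1_bas)
    then show ?thesis using alt_null_swap(2)[OF assms bm r] 2 by (simp add: sS cns_bas)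
  next
    case 3
    have "sorted_word (wedge1 b (wedge1 a (bas U))) = cns b (sorted_word (wedge1 a (bas U :: nat set \<Rightarrow>\<^sub>0 'k)))"
    proof (cases "a \<in> U")
      case False
      have e: "wedge1 a (bas U) = sign_below a U *\<^sub>p (bas (insert a U) :: nat set \<Rightarrow>\<^sub>0 'k)"
        using False by (simp add: wedge1_bas pscale_single)
      have "sorted_word (wedge1 b (bas (insert a U))) = cns b (sorted_word (bas (insert a U) :: nat set \<Rightarrow>\<^sub>0 'k))"
        by (rule sorted_word_below) (use fU b 3 in auto)
      then show ?thesis unfolding e wedge1_simps sorted_word_simps klin_scale[OF klin_cns] by (rule arg_cong)
    qed (simp add: wedge1_bas klin_zero[OF klin_cns])
    moreover have "wedge1 a (bas S) = - wedge1 b (wedge1 a (bas U :: nat set \<Rightarrow>\<^sub>0 'k))"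
      using 3 by (simp add: wS wedge1_anticomm[of a b])
    ultimately have "cns a (sorted_word (bas S)) - sorted_word (wedge1 a (bas S :: nat set \<Rightarrow>\<^sub>0 'k))
        = (bas (a # b # ?r) + bas (b # a # ?r)) - cns b (cns a (sorted_word (bas U)) - sorted_word (wedge1 a (bas U)))"
      by (simp add: sS cns_bas klin_simps[OF klin_cns]) (simp add: sorted_word_def cns_bas)
    also have "\<dots> \<in> alt_null m (Suc (Suc n))"
      by (intro alt_null_diff alt_null_swap alt_null_cns Suc.IH U assms bm r)
    finally show ?thesis .
  qed
qed

lemma wedge_word_nsets: "set l \<subseteq> {..<m} \<Longrightarrow> wedge_word l \<in> fsupp (nsets m (length l))"
  by (induction l) (auto intro!: wedge1_nsets, simp add: nsets_def)

lemma sort_word: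
  "set l \<subseteq> {..<m} \<Longrightarrow> bas l - sorted_word (wedge_word l) \<in> (alt_null m (length l) :: (nat list \<Rightarrow>\<^sub>0 'k::field) set)"
proof (induction l)
  case Nil
  then show ?case by (simp add: sorted_word_def alt_null.zero)
next
  case (Cons a l)
  have "cns a (sorted_word y) - sorted_word (wedge1 a y) \<in> alt_null m (Suc n)"
    if "y \<in> fsupp (nsets m n)" for n and y :: "nat set \<Rightarrow>\<^sub>0 'k"
    using that
  proof (induction y rule: fsupp_induct)
    case zero
    then show ?case by (simp add: alt_null.zero klin_zero[OF klin_cns])
  next
    case (add p q)
    then show ?case using alt_null.add[OF add(3,4)] by (simp add: klin_add[OF klin_cns] algebra_simps)
  next
    case (single S c)
    then show ?case using alt_null.scale[OF sort_insert[of a m, OF _ single, where 'k = 'k], of c] Cons.prems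
      by (simp add: klin_scale[OF klin_cns] pscale_diff_right)
  qed
  from this[of "wedge_word l" "length l"] have "cns a (sorted_word (wedge_word l))
      - sorted_word (wedge_word (a # l)) \<in> (alt_null m (Suc (length l)) :: (nat list \<Rightarrow>\<^sub>0 'k) set)"
    using wedge_word_nsets[of l m, where 'a = 'k] Cons.prems by simp
  moreover have "cns a (bas l - sorted_word (wedge_word l)) \<in> (alt_null m (Suc (length l)) :: (nat list \<Rightarrow>\<^sub>0 'k) set)"
    using Cons by (intro alt_null_cns) auto
  ultimately have "(cns a (sorted_word (wedge_word l)) - sorted_word (wedge_word (a # l)))
      + cns a (bas l - sorted_word (wedge_word l)) \<in> (alt_null m (Suc (length l)) :: (nat list \<Rightarrow>\<^sub>0 'k) set)"
    by (rule alt_null.add)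
  then show ?case by (simp add: klin_diff[OF klin_cns] cns_bas)
qed

text \<open>
  The wedge product of the entries vanishes on tensors with a repeated factor. Conversely, a
  tensor with wedge product zero is congruent to the sorted form of this product, hence to zero,
  modulo those tensors.
\<close>

theorem exterior_power_coords:
  "\<exists>F. coords (exterior_power (std_space m :: ('k::field_char_0, nat \<Rightarrow>\<^sub>0 'k) module) n) (nsets m n) F"
proof -
  let ?V = "std_space m :: ('k, nat \<Rightarrow>\<^sub>0 'k) module"
  let ?T = "tensor_power ?V n"
  have c: "coords ?V {..<m} (\<lambda>p. p)" unfolding std_space_def by (rule coords_free_module)
  have carV: "carrier ?V = fsupp {..<m}" by (simp add: std_space_def free_module_def fsupp_def)
  let ?\<theta> = "tval (\<lambda>p. p) :: ((nat \<Rightarrow>\<^sub>0 'k) list \<Rightarrow>\<^sub>0 'k) set \<Rightarrow> _"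
  note T = tensor_coords(1)[OF c, of n]
  define \<phi> where "\<phi> U = ext wedge_word (?\<theta> U)" for U
  let ?Y = "{pure_tensor ?V xs | xs. xs \<in> tuples ?V n \<and> \<not> distinct xs}"
  have add: "\<phi> (x \<oplus>\<^bsub>?T\<^esub> y) = \<phi> x + \<phi> y" if "x \<in> carrier ?T" "y \<in> carrier ?T" for x y
    using that by (simp add: \<phi>_def coords_add[OF T])
  have smult: "\<phi> (a \<odot>\<^bsub>?T\<^esub> x) = a *\<^sub>p \<phi> x" if "x \<in> carrier ?T" for a x
    using that by (simp add: \<phi>_def coords_smult[OF T])
  have ker: "submodule_span ?T ?Y = {x \<in> carrier ?T. \<phi> x = 0}"
  proof (rule submodule_span_eq_kernel[OF T add smult])
    show "x \<in> carrier ?T \<and> \<phi> x = 0" if "x \<in> ?Y" for x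
      using that by (auto simp: \<phi>_def pure_tensor[OF c] wedge_word_tens wedge_combs_repeated)
  next
    fix H x assume H: "submodule H scalars ?T" "?Y \<subseteq> H" and x: "x \<in> carrier ?T" "\<phi> x = 0"
    interpret module "scalars :: 'k ring" ?T by (rule coords_module[OF T])
    note h = submoduleE[OF H(1)]
    have zero: "\<zero>\<^bsub>?T\<^esub> \<in> H" using H(1) unfolding submodule_def subgroup_def by simp
    have null: "\<forall>u\<in>carrier ?T. ?\<theta> u = q \<longrightarrow> u \<in> H" if "q \<in> alt_null m k" "k = n" for q k
      using that
    proof (induction rule: alt_null.induct)
      case (gen ps)
      then have ps: "ps \<in> tuples ?V n" by (auto simp: tuples_def carV)
      then have "pure_tensor ?V ps \<in> H" using H(2) gen by blast
      then show ?case
        using coords_inj[OF T] pure_tensor[OF c ps] by metis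
    next
      case zero
      then show ?case using coords_inj[OF T _ coords_zero(1)[OF T]] coords_zero(2)[OF T] \<open>\<zero>\<^bsub>?T\<^esub> \<in> H\<close> by metis
    next
      case (add p q)
      show ?case
      proof (intro ballI impI)
        fix u assume u: "u \<in> carrier ?T" "?\<theta> u = p + q"
        have lenps: "r \<in> fsupp (nlists {..<m} j)" if "r \<in> alt_null m j" for r :: "nat list \<Rightarrow>\<^sub>0 'k" and j
          using that
        proof (induction rule: alt_null.induct)
          case (gen ps)
          then show ?case using tens_fsupp[of ps "\<lambda>p. p" "{..<m}"] by auto
        qed auto
        obtain v where v: "v \<in> carrier ?T" "?\<theta> v = p" using coords_surj[OF T] lenps[OF add(1)] add.prems by blast
        obtain w where w: "w \<in> carrier ?T" "?\<theta> w = q" using coords_surj[OF T] lenps[OF add(2)] add.prems by blast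
        have "u = v \<oplus>\<^bsub>?T\<^esub> w" by (rule coords_inj[OF T]) (simp_all add: u v w coords_add[OF T])
        moreover have "v \<in> H" "w \<in> H" using add v w by auto
        ultimately show "u \<in> H" using h(5) by simp
      qed
    next
      case (scale p a)
      show ?case
      proof (intro ballI impI)
        fix u assume u: "u \<in> carrier ?T" "?\<theta> u = a *\<^sub>p p"
        show "u \<in> H"
        proof (cases "a = 0")
          case True
          then have "u = \<zero>\<^bsub>?T\<^esub>" by (intro coords_inj[OF T]) (simp_all add: u coords_zero[OF T])
          then show ?thesis using \<open>\<zero>\<^bsub>?T\<^esub> \<in> H\<close> by simp
        next
          case False
          let ?v = "(1 / a) \<odot>\<^bsub>?T\<^esub> u"
          have v: "?v \<in> carrier ?T" "?\<theta> ?v = p" using u False by (simp_all add: coords_smult[OF T])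
          then have "?v \<in> H" using scale by blast
          then have "a \<odot>\<^bsub>?T\<^esub> ?v \<in> H" using h(4) by simp
          moreover have "a \<odot>\<^bsub>?T\<^esub> ?v = u"
            by (rule coords_inj[OF T]) (use u False in \<open>simp_all add: coords_smult[OF T]\<close>)
          ultimately show ?thesis by simp
        qed
      qed
    qed
    have "q - sorted_word (ext wedge_word q) \<in> alt_null m n" if "q \<in> fsupp (nlists {..<m} n)" for q :: "nat list \<Rightarrow>\<^sub>0 'k"
      using that
    proof (induction q rule: fsupp_induct)
      case zero
      then show ?case by (simp add: alt_null.zero)
    next
      case (add p q)
      then show ?case using alt_null.add[OF add(3,4)] by (simp add: algebra_simps)
    next
      case (single l a)
      then have l: "set l \<subseteq> {..<m}" "length l = n" by (auto simp: nlists_def)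
      show ?case using alt_null.scale[OF sort_word[OF l(1), where 'k = 'k], of a] l by (simp add: pscale_diff_right)
    qed
    from this[OF coords_fsupp[OF T x(1)]] x(2) have "?\<theta> x \<in> alt_null m n" by (simp add: \<phi>_def)
    then show "x \<in> H" using null x(1) by blast
  qed
  have surj: "\<phi> ` carrier ?T = fsupp (nsets m n)"
  proof (intro equalityI subsetI)
    fix v assume "v \<in> \<phi> ` carrier ?T"
    then obtain u where u: "u \<in> carrier ?T" "v = \<phi> u" by auto
    show "v \<in> fsupp (nsets m n)" unfolding u \<phi>_def
      by (rule ext_fsupp[OF coords_fsupp[OF T u(1)]]) (use wedge_word_nsets in \<open>auto simp: nlists_def\<close>)
  next
    fix v :: "nat set \<Rightarrow>\<^sub>0 'k" assume v: "v \<in> fsupp (nsets m n)"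
    have "sorted_word v \<in> fsupp (nlists {..<m} n)" unfolding sorted_word_def
    proof (rule ext_fsupp[OF v])
      fix S assume S: "S \<in> nsets m n"
      have "finite S" by (rule nsets_finite[OF S])
      then show "(bas (sorted_list_of_set S) :: nat list \<Rightarrow>\<^sub>0 'k) \<in> fsupp (nlists {..<m} n)"
        using S by (auto simp: nlists_def nsets_def intro!: fsupp_single)
    qed
    then obtain u where u: "u \<in> carrier ?T" "?\<theta> u = sorted_word v" using coords_surj[OF T] by blast
    have w: "wedge_word (sorted_list_of_set S) = (bas S :: nat set \<Rightarrow>\<^sub>0 'k)" if "finite S" for S
      using that
    proof (induction "card S" arbitrary: S)
      case (Suc k)
      define b U where "b = Min S" and "U = S - {b}"
      have ne: "S \<noteq> {}" using Suc by auto
      have b: "b \<in> S" "\<And>c. c \<in> U \<Longrightarrow> b < c" using Suc.prems ne by (auto simp: b_def U_def less_le)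
      have S: "S = insert b U" "b \<notin> U" "finite U" using b Suc.prems by (auto simp: U_def)
      have "sign_below b U = (1 :: 'k)" using b(2) by (rule sign_below_min)
      moreover have "wedge_word (sorted_list_of_set U) = (bas U :: nat set \<Rightarrow>\<^sub>0 'k)"
        using Suc S by simp
      ultimately show ?case using sorted_word_below(2)[OF S(3) b(2)] S by (simp add: wedge1_bas)
    qed simp
    have "ext wedge_word (sorted_word v) = v" unfolding sorted_word_def
      by (rule klin_eq_on[where g = "\<lambda>v. v", OF _ _ v])
        (auto intro!: klin_intros w nsets_finite)
    then show "v \<in> \<phi> ` carrier ?T" using u by (force simp: \<phi>_def)
  qed
  have "coords (quotient_module ?T (submodule_span ?T ?Y)) (nsets m n) (\<lambda>U. the_elem (\<phi> ` U))"
    by (rule quotient_coords(1)[OF _ _ _ surj ker]) (auto simp: add smult coords_add[OF T] coords_smult[OF T] coords_sub[OF T])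
  then show ?thesis unfolding exterior_power_def by blast
qed

definition pair_fst :: "'i \<Rightarrow> ('b \<Rightarrow>\<^sub>0 'k::field) \<Rightarrow> ('i \<times> 'b \<Rightarrow>\<^sub>0 'k)"
  where "pair_fst i = ext (\<lambda>b. bas (i, b))"

lemma lookup_pair_fst: "Poly_Mapping.lookup (pair_fst i p) (j, b) = (if i = j then Poly_Mapping.lookup p b else 0)"
proof -
  have "Poly_Mapping.lookup (pair_fst i p) (j, b)
      = (\<Sum>a\<in>Poly_Mapping.keys p. if a = b \<and> i = j then Poly_Mapping.lookup p a else 0)"
    unfolding pair_fst_def ext_def lookup_sum
    by (intro sum.cong refl) (simp add: lookup_single when_def)
  also have "\<dots> = (if i = j then Poly_Mapping.lookup p b else 0)"
    by (cases "i = j") (simp_all add: in_keys_iff)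
  finally show ?thesis .
qed

lemma direct_sum_coords:
  fixes M :: "'i \<Rightarrow> ('k::field, 'v, 'm) module_scheme" and B :: "'i \<Rightarrow> 'b set"
  assumes c: "\<And>i. i \<in> I \<Longrightarrow> coords (M i) (B i) (F i)"
  shows "\<exists>G. coords (direct_sum_module I M) (SIGMA i:I. B i) G"
proof -
  let ?D = "direct_sum_module I M"
  define G where "G f = (\<Sum>i\<in>{i \<in> I. f i \<noteq> \<zero>\<^bsub>M i\<^esub>}. pair_fst i (F i (f i)))" for f
  have car: "f \<in> carrier ?D \<longleftrightarrow> f \<in> (\<Pi>\<^sub>E i\<in>I. carrier (M i)) \<and> finite {i \<in> I. f i \<noteq> \<zero>\<^bsub>M i\<^esub>}" for f
    by (simp add: direct_sum_module_def)
  have G: "Poly_Mapping.lookup (G f) (i, b) = (if i \<in> I then Poly_Mapping.lookup (F i (f i)) b else 0)"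
    if f: "f \<in> carrier ?D" for f i b
  proof -
    let ?A = "{i \<in> I. f i \<noteq> \<zero>\<^bsub>M i\<^esub>}"
    have "Poly_Mapping.lookup (G f) (i, b) = (\<Sum>j\<in>?A. if j = i then Poly_Mapping.lookup (F i (f i)) b else 0)"
      unfolding G_def lookup_sum by (intro sum.cong) (auto simp: lookup_pair_fst)
    also have "\<dots> = (if i \<in> ?A then Poly_Mapping.lookup (F i (f i)) b else 0)"
      using f by (simp add: car)
    also have "\<dots> = (if i \<in> I then Poly_Mapping.lookup (F i (f i)) b else 0)"
      using coords_zero(2)[OF c] by auto
    finally show ?thesis .
  qed
  have el: "f i \<in> carrier (M i)" if "f \<in> carrier ?D" "i \<in> I" for f i using that by (auto simp: car)
  have zero_car: "\<zero>\<^bsub>?D\<^esub> \<in> carrier ?D" "\<zero>\<^bsub>?D\<^esub> = (\<lambda>i\<in>I. \<zero>\<^bsub>M i\<^esub>)"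
    using coords_zero(1)[OF c] by (auto simp: direct_sum_module_def cong: conj_cong)
  have add_eq: "f \<oplus>\<^bsub>?D\<^esub> g = (\<lambda>i\<in>I. f i \<oplus>\<^bsub>M i\<^esub> g i)" for f g by (simp add: direct_sum_module_def)
  have smult_eq: "a \<odot>\<^bsub>?D\<^esub> f = (\<lambda>i\<in>I. a \<odot>\<^bsub>M i\<^esub> f i)" for a f by (simp add: direct_sum_module_def)
  have z: "\<zero>\<^bsub>M i\<^esub> \<oplus>\<^bsub>M i\<^esub> \<zero>\<^bsub>M i\<^esub> = \<zero>\<^bsub>M i\<^esub>" "a \<odot>\<^bsub>M i\<^esub> \<zero>\<^bsub>M i\<^esub> = \<zero>\<^bsub>M i\<^esub>" if "i \<in> I" for i a
    by (rule coords_inj[OF c[OF that]];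
        simp add: coords_add[OF c[OF that]] coords_smult[OF c[OF that]] coords_zero[OF c[OF that]])+
  have add_car: "f \<oplus>\<^bsub>?D\<^esub> g \<in> carrier ?D" if f: "f \<in> carrier ?D" and g: "g \<in> carrier ?D" for f g
  proof -
    have "{i \<in> I. (f \<oplus>\<^bsub>?D\<^esub> g) i \<noteq> \<zero>\<^bsub>M i\<^esub>} \<subseteq> {i \<in> I. f i \<noteq> \<zero>\<^bsub>M i\<^esub>} \<union> {i \<in> I. g i \<noteq> \<zero>\<^bsub>M i\<^esub>}"
      using z by (auto simp: add_eq)
    then have "finite {i \<in> I. (f \<oplus>\<^bsub>?D\<^esub> g) i \<noteq> \<zero>\<^bsub>M i\<^esub>}"
      by (rule finite_subset) (use f g in \<open>simp add: car\<close>)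
    moreover have "f \<oplus>\<^bsub>?D\<^esub> g \<in> (\<Pi>\<^sub>E i\<in>I. carrier (M i))"
      using el[OF f] el[OF g] by (auto simp: add_eq coords_add[OF c])
    ultimately show ?thesis unfolding car by blast
  qed
  have smult_car: "a \<odot>\<^bsub>?D\<^esub> f \<in> carrier ?D" if f: "f \<in> carrier ?D" for a f
  proof -
    have "{i \<in> I. (a \<odot>\<^bsub>?D\<^esub> f) i \<noteq> \<zero>\<^bsub>M i\<^esub>} \<subseteq> {i \<in> I. f i \<noteq> \<zero>\<^bsub>M i\<^esub>}"
      using z by (auto simp: smult_eq)
    then have "finite {i \<in> I. (a \<odot>\<^bsub>?D\<^esub> f) i \<noteq> \<zero>\<^bsub>M i\<^esub>}"
      by (rule finite_subset) (use f in \<open>simp add: car\<close>)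
    moreover have "a \<odot>\<^bsub>?D\<^esub> f \<in> (\<Pi>\<^sub>E i\<in>I. carrier (M i))"
      using el[OF f] by (auto simp: smult_eq coords_smult[OF c])
    ultimately show ?thesis unfolding car by blast
  qed
  have "coords ?D (SIGMA i:I. B i) G"
  proof (rule coordsI)
    show "bij_betw G (carrier ?D) (fsupp (SIGMA i:I. B i))"
    proof (rule bij_betw_imageI)
      show "inj_on G (carrier ?D)"
      proof (rule inj_onI)
        fix f g assume f: "f \<in> carrier ?D" and g: "g \<in> carrier ?D" and "G f = G g"
        then have "F i (f i) = F i (g i)" if "i \<in> I" for i
          using G[OF f, of i] G[OF g, of i] that by (intro poly_mapping_eqI) simp
        then have "f i = g i" if "i \<in> I" for i
          using coords_inj[OF c[OF that]] el f g that by blast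
        then show "f = g" using f g by (intro PiE_ext[where s = "\<lambda>i. carrier (M i)" and k = I]) (auto simp: car)
      qed
      show "G ` carrier ?D = fsupp (SIGMA i:I. B i)"
      proof (intro equalityI subsetI)
        fix p assume "p \<in> G ` carrier ?D"
        then obtain f where f: "f \<in> carrier ?D" "p = G f" by auto
        have "i \<in> I \<and> b \<in> B i" if "Poly_Mapping.lookup p (i, b) \<noteq> 0" for i b
          using that G[OF f(1), of i b] coords_fsupp[OF c el[OF f(1)], of i] f(2)
          by (auto simp: fsupp_def in_keys_iff subset_iff split: if_splits)
        then show "p \<in> fsupp (SIGMA i:I. B i)" by (auto simp: fsupp_def in_keys_iff)
      next
        fix p :: "'i \<times> 'b \<Rightarrow>\<^sub>0 'k" assume p: "p \<in> fsupp (SIGMA i:I. B i)"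
        define part where "part i = ext (\<lambda>(j, b). if j = i then bas b else 0) p" for i
        have lp: "Poly_Mapping.lookup (part i) b = Poly_Mapping.lookup p (i, b)" for i b
        proof -
          have "Poly_Mapping.lookup (part i) b = (\<Sum>a\<in>Poly_Mapping.keys p. if a = (i, b) then Poly_Mapping.lookup p a else 0)"
            unfolding part_def ext_def lookup_sum
            by (intro sum.cong refl) (auto simp: lookup_single when_def split: prod.splits)
          then show ?thesis by (simp add: in_keys_iff)
        qed
        have part: "part i \<in> fsupp (B i)" for i
          unfolding part_def by (rule ext_fsupp[OF p]) auto
        define f where "f = (\<lambda>i\<in>I. SOME x. x \<in> carrier (M i) \<and> F i x = part i)"
        have fi: "f i \<in> carrier (M i) \<and> F i (f i) = part i" if "i \<in> I" for i
          using someI_ex[of "\<lambda>x. x \<in> carrier (M i) \<and> F i x = part i"] coords_surj[OF c[OF that] part[of i]] that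
          by (auto simp: f_def)
        have "{i \<in> I. f i \<noteq> \<zero>\<^bsub>M i\<^esub>} \<subseteq> fst ` Poly_Mapping.keys p"
        proof
          fix i assume i: "i \<in> {i \<in> I. f i \<noteq> \<zero>\<^bsub>M i\<^esub>}"
          then have "part i \<noteq> 0" using fi[of i] coords_inj[OF c, of i "f i" "\<zero>\<^bsub>M i\<^esub>"] coords_zero[OF c, of i] by auto
          then obtain b where "Poly_Mapping.lookup (part i) b \<noteq> 0" by (metis lookup_zero poly_mapping_eqI)
          then show "i \<in> fst ` Poly_Mapping.keys p" by (force simp: lp in_keys_iff)
        qed
        then have "finite {i \<in> I. f i \<noteq> \<zero>\<^bsub>M i\<^esub>}" by (rule finite_subset) simp
        moreover have "f \<in> (\<Pi>\<^sub>E i\<in>I. carrier (M i))"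
          using fi by (intro PiE_I) (auto simp: f_def)
        ultimately have f: "f \<in> carrier ?D" unfolding car by blast
        have "G f = p"
        proof (rule poly_mapping_eqI)
          fix ib :: "'i \<times> 'b" obtain i b where ib: "ib = (i, b)" by (cases ib)
          have "Poly_Mapping.lookup p (i, b) = 0" if "i \<notin> I" using p that by (auto simp: fsupp_def in_keys_iff)
          then show "Poly_Mapping.lookup (G f) ib = Poly_Mapping.lookup p ib"
            using G[OF f, of i b] fi[of i] by (auto simp: ib lp)
        qed
        then show "p \<in> G ` carrier ?D" using f by blast
      qed
    qed
    show "\<zero>\<^bsub>?D\<^esub> \<in> carrier ?D" by (rule zero_car)
    have "{i \<in> I. \<zero>\<^bsub>?D\<^esub> i \<noteq> \<zero>\<^bsub>M i\<^esub>} = {}" by (auto simp: zero_car)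
    then show "G \<zero>\<^bsub>?D\<^esub> = 0" by (simp only: G_def) simp
    show "f \<oplus>\<^bsub>?D\<^esub> g \<in> carrier ?D" if "f \<in> carrier ?D" "g \<in> carrier ?D" for f g using that by (rule add_car)
    show "a \<odot>\<^bsub>?D\<^esub> f \<in> carrier ?D" if "f \<in> carrier ?D" for a f using that by (rule smult_car)
    show "G (f \<oplus>\<^bsub>?D\<^esub> g) = G f + G g" if f: "f \<in> carrier ?D" and g: "g \<in> carrier ?D" for f g
    proof (rule poly_mapping_eqI)
      fix ib :: "'i \<times> 'b" obtain i b where ib: "ib = (i, b)" by (cases ib)
      show "Poly_Mapping.lookup (G (f \<oplus>\<^bsub>?D\<^esub> g)) ib = Poly_Mapping.lookup (G f + G g) ib"
        using el[OF f, of i] el[OF g, of i]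
        unfolding ib lookup_add G[OF f] G[OF g] G[OF add_car[OF f g]]
        by (simp add: add_eq coords_add[OF c] lookup_add)
    qed
    show "G (a \<odot>\<^bsub>?D\<^esub> f) = a *\<^sub>p G f" if f: "f \<in> carrier ?D" for a f
    proof (rule poly_mapping_eqI)
      fix ib :: "'i \<times> 'b" obtain i b where ib: "ib = (i, b)" by (cases ib)
      show "Poly_Mapping.lookup (G (a \<odot>\<^bsub>?D\<^esub> f)) ib = Poly_Mapping.lookup (a *\<^sub>p G f) ib"
        using el[OF f, of i]
        unfolding ib lookup_pscale G[OF f] G[OF smult_car[OF f]]
        by (simp add: smult_eq coords_smult[OF c])
    qed
  qed
  then show ?thesis by blast
qed

lemma ext_restrict_same: "p \<in> fsupp S \<Longrightarrow> ext (\<lambda>a. if a \<in> S then bas a else 0) p = p"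
  by (rule klin_eq_on[where f = "ext (\<lambda>a. if a \<in> S then bas a else 0)" and g = "\<lambda>p. p" and S = S])
    (simp_all add: klin_ext klin_basic)

lemma ext_restrict_disjoint:
  "p \<in> fsupp S \<Longrightarrow> S \<inter> T = {} \<Longrightarrow> ext (\<lambda>a. if a \<in> T then bas a else 0) p = 0"
  by (rule klin_eq_on[where f = "ext (\<lambda>a. if a \<in> T then bas a else 0)" and g = "\<lambda>p. 0" and S = S])
    (auto simp: klin_ext klin_basic)

lemma direct_sum2_coords:
  fixes M :: "('k::field, 'v, 'm) module_scheme" and N :: "('k, 'w, 'n) module_scheme"
    and S :: "'b set"
  assumes M: "coords M S F" and N: "coords N T G" and ST: "S \<inter> T = {}"
  shows "coords (M \<oplus>\<^sub>k N) (S \<union> T) (\<lambda>(x, y). F x + G y)"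
proof (rule coordsI)
  let ?H = "\<lambda>(x, y). F x + G y"
  let ?res = "\<lambda>A. ext (\<lambda>a :: 'b. if a \<in> A then bas a else 0 :: 'b \<Rightarrow>\<^sub>0 'k)"
  have car: "carrier (M \<oplus>\<^sub>k N) = carrier M \<times> carrier N" by (simp add: direct_sum2_module_def)
  note rS = ext_restrict_same[of _ S] ext_restrict_disjoint[OF _ ST]
  note rT = ext_restrict_same[of _ T] ext_restrict_disjoint[OF _ ST[unfolded Int_commute[of S]]]
  show "bij_betw ?H (carrier (M \<oplus>\<^sub>k N)) (fsupp (S \<union> T))"
  proof (rule bij_betw_imageI)
    show "inj_on ?H (carrier (M \<oplus>\<^sub>k N))"
    proof (rule inj_onI, clarsimp simp: car)
      fix x y x' y' assume m: "x \<in> carrier M" "y \<in> carrier N" "x' \<in> carrier M" "y' \<in> carrier N"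
        and e: "F x + G y = F x' + G y'"
      note f = coords_fsupp[OF M] coords_fsupp[OF N]
      have "F x = F x'" using arg_cong[OF e, of "?res S"] m by (simp add: rS rT f)
      moreover have "G y = G y'" using arg_cong[OF e, of "?res T"] m by (simp add: rS rT f)
      ultimately show "x = x' \<and> y = y'" using m coords_inj[OF M] coords_inj[OF N] by blast
    qed
    show "?H ` carrier (M \<oplus>\<^sub>k N) = fsupp (S \<union> T)"
    proof (intro equalityI subsetI)
      fix p assume "p \<in> ?H ` carrier (M \<oplus>\<^sub>k N)"
      then show "p \<in> fsupp (S \<union> T)"
        using fsupp_mono[OF coords_fsupp[OF M], of _ "S \<union> T"] fsupp_mono[OF coords_fsupp[OF N], of _ "S \<union> T"]
        by (auto simp: car)
    next
      fix p :: "'b \<Rightarrow>\<^sub>0 'k" assume p: "p \<in> fsupp (S \<union> T)"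
      have "?res S p \<in> fsupp S" by (rule ext_fsupp[OF p]) auto
      then obtain x where x: "x \<in> carrier M" "F x = ?res S p" using coords_surj[OF M] by blast
      have "?res T p \<in> fsupp T" by (rule ext_fsupp[OF p]) auto
      then obtain y where y: "y \<in> carrier N" "G y = ?res T p" using coords_surj[OF N] by blast
      have "?res S p + ?res T p = p"
        by (rule klin_eq_on[where f = "\<lambda>p. ?res S p + ?res T p" and g = "\<lambda>p. p", OF _ _ p])
          (use ST in \<open>auto intro!: klin_intros\<close>)
      then show "p \<in> ?H ` carrier (M \<oplus>\<^sub>k N)" using x y by (auto simp: car intro!: image_eqI[of _ _ "(x, y)"])
    qed
  qed
qed (auto simp: direct_sum2_module_def coords_zero[OF M] coords_zero[OF N] coords_add[OF M] coords_add[OF N]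
    coords_smult[OF M] coords_smult[OF N] pscale_add_right)


section \<open>The monomial basis of the cyclic bicomplex\<close>

lemma coords_transform:
  assumes c: "coords M S F" and r: "klin r" "bij_betw r (fsupp S) (fsupp T)"
  shows "coords M T (\<lambda>x. r (F x))"
proof (rule coordsI)
  show "bij_betw (\<lambda>x. r (F x)) (carrier M) (fsupp T)"
    using bij_betw_trans[OF coords_bij[OF c] r(2)] by (simp add: o_def)
qed (simp_all add: coords_zero[OF c] coords_add[OF c] coords_smult[OF c] klin_simps[OF r(1)])

lemma nlists_UNIV: "nlists UNIV n = len n"
  by (auto simp: nlists_def len_def)

lemma fraction_product_eq:
  fixes a b c d e f :: "'a::field"
  assumes "b \<noteq> 0" "d \<noteq> 0" "f \<noteq> 0" "a * d * f = c * e * b"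
  shows "a * inverse b = (c * inverse d) * (e * inverse f)"
  using assms by (simp add: field_simps)

locale twisted_algebra = lattice m \<phi> t
  for m :: nat and \<phi> :: "nat \<Rightarrow> 'g::ab_group_add \<Rightarrow> int" and t :: "nat \<Rightarrow> 'g" +
  fixes \<omega> :: "'g \<Rightarrow> 'g \<Rightarrow> 'k::field_char_0"
  assumes cocycle: "normalized_2_cocycle \<omega>"
begin

lemma omega_nz [simp]: "\<omega> x y \<noteq> 0"
  and omega_0 [simp]: "\<omega> 0 g = 1" "\<omega> g 0 = 1"
  and omega_cocycle: "\<omega> y z * \<omega> x (y + z) = \<omega> x y * \<omega> (x + y) z"
  using cocycle by (simp_all add: normalized_2_cocycle_def)

lemma commutation_factor_add:
  "commutation_factor \<omega> (g + h) x = commutation_factor \<omega> g x * commutation_factor \<omega> h x"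
proof -
  have 1: "\<omega> h x * \<omega> g (h + x) = \<omega> g h * \<omega> (g + h) x" by (rule omega_cocycle)
  have 2: "\<omega> g h * \<omega> x (g + h) = \<omega> x g * \<omega> (x + g) h" by (rule omega_cocycle)
  have 3: "\<omega> x h * \<omega> g (h + x) = \<omega> g x * \<omega> (x + g) h"
    using omega_cocycle[of x h g] by (simp only: add.commute)
  have "\<omega> g h * (\<omega> (g + h) x * \<omega> x g * \<omega> x h) = (\<omega> g h * \<omega> (g + h) x) * (\<omega> x g * \<omega> x h)" by (simp only: mult.assoc)
  also have "\<dots> = (\<omega> x h * \<omega> g (h + x)) * (\<omega> h x * \<omega> x g)" by (simp only: 1[symmetric] mult.assoc mult.left_commute mult.commute)
  also have "\<dots> = (\<omega> x g * \<omega> (x + g) h) * (\<omega> g x * \<omega> h x)" by (simp only: 3 mult.assoc mult.left_commute mult.commute)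
  also have "\<dots> = \<omega> g h * (\<omega> g x * \<omega> h x * \<omega> x (g + h))" by (simp only: 2[symmetric] mult.assoc mult.left_commute mult.commute)
  finally have "\<omega> g h * (\<omega> (g + h) x * \<omega> x g * \<omega> x h) = \<omega> g h * (\<omega> g x * \<omega> h x * \<omega> x (g + h))" .
  then have "\<omega> (g + h) x * \<omega> x g * \<omega> x h = \<omega> g x * \<omega> h x * \<omega> x (g + h)"
    by (simp only: mult_cancel_left omega_nz simp_thms)
  from fraction_product_eq[OF omega_nz omega_nz omega_nz this] show ?thesis
    unfolding commutation_factor_def .
qed

sublocale twisted_lattice m \<phi> t "commutation_factor \<omega>"
proof unfold_locales
  fix g h x
  show "commutation_factor \<omega> (g + h) x = commutation_factor \<omega> g x * commutation_factor \<omega> h x"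
    by (rule commutation_factor_add)
  show "commutation_factor \<omega> 0 x = 1" "commutation_factor \<omega> g 0 = 1" "commutation_factor \<omega> x x = 1"
    by (simp_all add: commutation_factor_def)
qed

lemma central_eq: "central = X_lambda \<omega>"
  unfolding central_def X_lambda_def by (rule refl)

abbreviation A :: "('k, 'g \<Rightarrow>\<^sub>0 'k) module"
  where "A \<equiv> twisted_group_algebra \<omega>"

lemma A_coords: "coords A UNIV (\<lambda>p. p)"
  by (rule coordsI) (simp_all add: twisted_group_algebra_def fsupp_def pscale_def bij_betw_def)

lemma A_mult: "p \<otimes>\<^bsub>A\<^esub> q = ext (\<lambda>x. ext (\<lambda>y. \<omega> x y *\<^sub>p bas (x + y)) q) p"
  by (simp add: twisted_group_algebra_def ext_def pscale_sum_right pscale_single mult.assoc)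

lemma tuples_A: "tuples A n = {xs. length xs = n}"
  by (simp add: tuples_def twisted_group_algebra_def)

text \<open>
  The scalar by which \<open>e\<^bsub>g\<^sub>0\<^esub> \<otimes> \<dots> \<otimes> e\<^bsub>g\<^sub>n\<^esub>\<close> is rescaled is the one relating the product
  \<open>e\<^bsub>g\<^sub>0\<^esub> \<cdots> e\<^bsub>g\<^sub>n\<^esub>\<close> to the basis element of total degree. Multiplying neighbours does not change
  this product, which is why the inner faces carry no scalar in the rescaled basis.
\<close>

primrec cocyc :: "'g list \<Rightarrow> 'k"
  where "cocyc [] = 1" | "cocyc (g # l) = \<omega> g (sum_list l) * cocyc l"

lemma cocyc_nz [simp]: "cocyc l \<noteq> 0"
  by (induction l) simp_all

lemma cocyc_face:
  "Suc i < length l \<Longrightarrow> \<omega> (l ! i) (l ! Suc i) * cocyc (merge_at i l) = cocyc l \<and> sum_list (merge_at i l) = sum_list l"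
proof (induction i arbitrary: l)
  case 0
  then obtain a b r where l: "l = a # b # r" by (metis Suc_less_eq length_Cons length_Suc_conv less_nat_zero_code list.exhaust list.size(3))
  show ?case using omega_cocycle[of b "sum_list r" a] by (simp add: l add.assoc mult.left_commute mult.assoc)
next
  case (Suc i)
  then obtain a r where l: "l = a # r" by (cases l) auto
  show ?case using Suc.IH[of r] Suc.prems by (simp add: l mult.left_commute)
qed

lemma cocyc_snoc: "cocyc (u @ [z]) = cocyc u * \<omega> (sum_list u) z"
proof (induction u)
  case (Cons a u)
  then show ?case using omega_cocycle[of "sum_list u" z a] by (simp add: mult.left_commute mult.assoc mult.commute)
qed simp

text \<open>Moving the last factor of a product to the front multiplies it by the commutation factor.\<close>

lemma cocyc_rotate: "cocyc (z # u) = commutation_factor \<omega> z (sum_list u + z) * cocyc (u @ [z])"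
proof -
  let ?y = "sum_list u"
  have "\<omega> ?y z * \<omega> z (?y + z) = \<omega> z ?y * \<omega> (?y + z) z"
    using omega_cocycle[of ?y z z] by (simp add: add.commute)
  then have "\<omega> z ?y = \<omega> z (?y + z) * inverse (\<omega> (?y + z) z) * \<omega> ?y z"
    by (simp add: nonzero_eq_divide_eq flip: divide_inverse times_divide_eq_left) (simp add: mult.commute)
  then show ?thesis by (simp add: cocyc_snoc commutation_factor_def)
qed

definition resc :: "('g list \<Rightarrow>\<^sub>0 'k) \<Rightarrow> ('g list \<Rightarrow>\<^sub>0 'k)"
  where "resc = ext (\<lambda>l. cocyc l *\<^sub>p bas l)"

lemma klin_resc [klin_intros]: "klin resc"
  by (simp add: resc_def klin_ext)

lemmas [klin_intros] = klin_comp[OF klin_resc]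
lemmas resc_simps [simp] = klin_simps[OF klin_resc]

lemma resc_bas [simp]: "resc (bas l) = cocyc l *\<^sub>p bas l"
  by (simp add: resc_def)

lemma resc_bij: "bij_betw resc (fsupp S) (fsupp S)"
proof (rule bij_betwI[where g = "ext (\<lambda>l. (1 / cocyc l) *\<^sub>p bas l)"])
  show "resc \<in> fsupp S \<rightarrow> fsupp S" "ext (\<lambda>l. (1 / cocyc l) *\<^sub>p bas l) \<in> fsupp S \<rightarrow> fsupp S"
    unfolding resc_def by (auto elim!: ext_fsupp)
  show "ext (\<lambda>l. (1 / cocyc l) *\<^sub>p bas l) (resc p) = p" for p
    by (rule klin_eqI[where p = p and g = "\<lambda>p. p"]) (auto intro!: klin_intros)
  show "resc (ext (\<lambda>l. (1 / cocyc l) *\<^sub>p bas l) p) = p" for p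
    by (rule klin_eqI[where p = p and g = "\<lambda>p. p"]) (auto intro!: klin_intros)
qed

definition theta :: "(('g \<Rightarrow>\<^sub>0 'k) list \<Rightarrow>\<^sub>0 'k) set \<Rightarrow> ('g list \<Rightarrow>\<^sub>0 'k)"
  where "theta U = resc (tval (\<lambda>p. p) U)"

lemma theta_coords: "coords (hochschild_chains A n) (len (Suc n)) theta"
  unfolding theta_def[abs_def] hochschild_chains_def
  using coords_transform[OF tensor_coords(1)[OF A_coords, of "Suc n"] klin_resc resc_bij]
  by (simp add: nlists_UNIV)

lemma theta_pure:
  assumes "length xs = Suc n"
  shows "pure_tensor A xs \<in> carrier (hochschild_chains A n)"
    "theta (pure_tensor A xs) = resc (tens (\<lambda>p. p) xs)"
  using pure_tensor[OF A_coords, of xs "Suc n"] assms by (simp_all add: tuples_A hochschild_chains_def theta_def)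

text \<open>The faces and the rotation in the basis before rescaling.\<close>

definition wface :: "nat \<Rightarrow> ('g list \<Rightarrow>\<^sub>0 'k) \<Rightarrow> ('g list \<Rightarrow>\<^sub>0 'k)"
  where "wface i = ext (\<lambda>l. if Suc i < length l then \<omega> (l ! i) (l ! Suc i) *\<^sub>p bas (merge_at i l) else 0)"

lemma klin_wface [klin_intros]: "klin (wface i)"
  by (simp add: wface_def klin_ext)

lemmas [klin_intros] = klin_comp[OF klin_wface]

lemma klin_A_mult: "klin (\<lambda>p. p \<otimes>\<^bsub>A\<^esub> q)" "klin (\<lambda>q. p \<otimes>\<^bsub>A\<^esub> q)"
proof -
  show "klin (\<lambda>p. p \<otimes>\<^bsub>A\<^esub> q)" unfolding A_mult by (rule klin_ext)
  show "klin (\<lambda>q. p \<otimes>\<^bsub>A\<^esub> q)" unfolding A_mult ext_def[of _ p] by (intro klin_intros)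
qed

lemma wface_0: "wface 0 (tcons p (tcons q w)) = tcons (p \<otimes>\<^bsub>A\<^esub> q) w"
proof (rule klin_eqI[where p = p])
  fix a
  show "wface 0 (tcons (bas a) (tcons q w)) = tcons (bas a \<otimes>\<^bsub>A\<^esub> q) w"
  proof (rule klin_eqI[where p = q])
    fix b
    show "wface 0 (tcons (bas a) (tcons (bas b) w)) = tcons (bas a \<otimes>\<^bsub>A\<^esub> bas b) w"
      by (rule klin_eqI[where p = w])
        (auto intro!: klin_intros simp: tcons_bas cns_bas wface_def A_mult)
  qed (intro klin_intros klin_comp[OF klin_tcons(1) klin_A_mult(2)])+
qed (intro klin_intros klin_comp[OF klin_tcons(1) klin_A_mult(1)])+

lemma wface_Suc: "wface (Suc i) (cns a w) = cns a (wface i w)"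
  by (rule klin_eqI[where p = w])
    (auto intro!: klin_intros simp: cns_bas wface_def klin_simps[OF klin_cns])

lemma wface_Suc_tcons: "wface (Suc i) (tcons p w) = tcons p (wface i w)"
  by (rule klin_eqI[where p = p]) (auto intro!: klin_intros simp: tcons_bas wface_Suc)

lemma tens_face:
  "Suc i < length xs \<Longrightarrow> tens (\<lambda>p. p) (face A i xs) = wface i (tens (\<lambda>p. p) xs)"
proof (induction i arbitrary: xs)
  case 0
  then obtain a b r where xs: "xs = a # b # r" by (metis Suc_less_eq length_Cons length_Suc_conv less_nat_zero_code list.exhaust list.size(3))
  show ?case by (simp add: xs face_def wface_0)
next
  case (Suc i)
  then obtain a r where xs: "xs = a # r" by (cases xs) auto
  have "face A (Suc i) xs = a # face A i r" using Suc.prems by (simp add: xs face_def)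
  then show ?case using Suc.IH[of r] Suc.prems by (simp add: xs wface_Suc_tcons)
qed

lemma resc_wface: "w \<in> fsupp (len (Suc (Suc n))) \<Longrightarrow> i \<le> n \<Longrightarrow>
    resc (wface i w) = ext (\<lambda>l. bas (merge_at i l)) (resc w)"
  by (rule klin_eq_on[where f = "\<lambda>w. resc (wface i w)" and S = "len (Suc (Suc n))"])
    (auto intro!: klin_intros simp: wface_def cocyc_face)

definition rot :: "('g list \<Rightarrow>\<^sub>0 'k) \<Rightarrow> ('g list \<Rightarrow>\<^sub>0 'k)"
  where "rot = ext (\<lambda>l. if l = [] then 0 else bas (last l # butlast l))"

lemma klin_rot [klin_intros]: "klin rot"
  by (simp add: rot_def klin_ext)

lemmas [klin_intros] = klin_comp[OF klin_rot]

lemma tens_snoc: "tens (\<lambda>p. p) (u @ [z]) = ext (\<lambda>b. ext (\<lambda>l. bas (l @ [b])) (tens (\<lambda>p. p) u)) z"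
proof (induction u)
  case Nil
  show ?case by (simp add: tcons_def cns_bas)
next
  case (Cons a u)
  let ?w = "tens (\<lambda>p. p) u"
  have "tcons a (ext (\<lambda>b. ext (\<lambda>l. bas (l @ [b])) w) z) = ext (\<lambda>b. ext (\<lambda>l. bas (l @ [b])) (tcons a w)) z" for w
  proof (rule klin_eqI[where p = z])
    fix b
    show "tcons a (ext (\<lambda>b. ext (\<lambda>l. bas (l @ [b])) w) (bas b)) = ext (\<lambda>b. ext (\<lambda>l. bas (l @ [b])) (tcons a w)) (bas b)"
    proof (simp, rule klin_eqI[where p = a])
      fix c
      show "tcons (bas c) (ext (\<lambda>l. bas (l @ [b])) w) = ext (\<lambda>l. bas (l @ [b])) (tcons (bas c) w)"
        unfolding tcons_bas by (rule klin_eqI[where p = w]) (auto intro!: klin_intros simp: cns_bas)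
    qed (intro klin_intros)+
  qed (intro klin_intros)+
  then show ?case using Cons by simp
qed

lemma tens_rot: "xs \<noteq> [] \<Longrightarrow> tens (\<lambda>p. p) (last xs # butlast xs) = rot (tens (\<lambda>p. p) xs)"
proof (cases xs rule: rev_cases)
  case (snoc u z)
  have "rot (ext (\<lambda>b. ext (\<lambda>l. bas (l @ [b])) w) z) = tcons z w" for w
  proof (rule klin_eqI[where p = z])
    fix b
    show "rot (ext (\<lambda>b. ext (\<lambda>l. bas (l @ [b])) w) (bas b)) = tcons (bas b) w"
      unfolding tcons_bas by (simp, rule klin_eqI[where p = w]) (auto intro!: klin_intros simp: cns_bas rot_def)
  qed (intro klin_intros)+
  then show ?thesis by (simp add: snoc tens_snoc)
qed simp

lemma resc_rot: "w \<in> fsupp (len (Suc n)) \<Longrightarrow> (- 1) ^ n *\<^sub>p resc (rot w) = cyc (resc w)"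
proof (rule klin_eq_on[where f = "\<lambda>w. (- 1) ^ n *\<^sub>p resc (rot w)" and S = "len (Suc n)"])
  fix l :: "'g list" assume l: "l \<in> len (Suc n)"
  then obtain u z where u: "l = u @ [z]" "length u = n" by (cases l rule: rev_cases) auto
  show "(- 1) ^ n *\<^sub>p resc (rot (bas l)) = cyc (resc (bas l))"
    using cocyc_rotate[of z u] u by (simp add: rot_def cyc_bas_snoc mult.commute mult.left_commute del: cocyc.simps)
qed (auto intro!: klin_intros)

lemma tens_len: "length xs = n \<Longrightarrow> tens (\<lambda>p. p) xs \<in> fsupp (len n)"
  using tens_fsupp[of xs "\<lambda>p. p" UNIV] by (simp add: nlists_UNIV)

lemma rot_len: "w \<in> fsupp (len n) \<Longrightarrow> rot w \<in> fsupp (len n)"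
  unfolding rot_def by (erule ext_fsupp) auto

lemma resc_len: "w \<in> fsupp (len n) \<Longrightarrow> resc w \<in> fsupp (len n)"
  using resc_bij[of "len n"] bij_betwE by fastforce

lemma bprime_resc_tens:
  assumes "length xs = Suc (Suc n)"
  shows "(\<Sum>i\<le>n. (- 1) ^ i *\<^sub>p resc (tens (\<lambda>p. p) (face A i xs))) = bprime (resc (tens (\<lambda>p. p) xs))"
proof -
  have w: "tens (\<lambda>p. p) xs \<in> fsupp (len (Suc (Suc n)))" using assms by (rule tens_len)
  have "(\<Sum>i\<le>n. (- 1) ^ i *\<^sub>p resc (tens (\<lambda>p. p) (face A i xs)))
      = (\<Sum>i\<le>n. (- 1) ^ i *\<^sub>p ext (\<lambda>l. bas (merge_at i l)) (resc (tens (\<lambda>p. p) xs)))"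
    by (intro sum.cong refl) (simp add: tens_face assms resc_wface[OF w])
  also have "\<dots> = bprime (resc (tens (\<lambda>p. p) xs))"
  proof (rule klin_eq_on[where f = "\<lambda>q. \<Sum>i\<le>n. (- 1) ^ i *\<^sub>p ext (\<lambda>l. bas (merge_at i l)) q", OF _ _ resc_len[OF w]])
    fix l :: "'g list" assume "l \<in> len (Suc (Suc n))"
    then show "(\<Sum>i\<le>n. (- 1) ^ i *\<^sub>p ext (\<lambda>l. bas (merge_at i l)) (bas l)) = bprime (bas l)"
      by (simp add: bprime0_faces lessThan_Suc_atMost del: sum.lessThan_Suc sum.atMost_Suc)
  qed (intro klin_intros)+
  finally show ?thesis .
qed

lemma hoch_resc_tens:
  assumes "length xs = Suc (Suc n)"
  shows "(\<Sum>i\<le>Suc n. (- 1) ^ i *\<^sub>p resc (tens (\<lambda>p. p) (face A i xs))) = hoch (resc (tens (\<lambda>p. p) xs))"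
proof -
  have w: "tens (\<lambda>p. p) xs \<in> fsupp (len (Suc (Suc n)))" using assms by (rule tens_len)
  have "face A (Suc n) xs = face A 0 (last xs # butlast xs)"
  proof -
    obtain a u where xs: "xs = a # u" "length u = Suc n" using assms by (cases xs) auto
    then obtain v z where "u = v @ [z]" by (cases u rule: rev_cases) auto
    with xs show ?thesis by (simp add: face_def)
  qed
  then have "tens (\<lambda>p. p) (face A (Suc n) xs) = wface 0 (rot (tens (\<lambda>p. p) xs))"
    using assms by (subst tens_rot[symmetric]) (auto simp: tens_face)
  then have "resc (tens (\<lambda>p. p) (face A (Suc n) xs))
      = ext (\<lambda>l. bas (merge_at 0 l)) (resc (rot (tens (\<lambda>p. p) xs)))"
    by (simp add: resc_wface[OF rot_len[OF w]])
  also have "\<dots> = hd_face (resc (rot (tens (\<lambda>p. p) xs)))"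
    by (rule klin_eq_on[where S = "len (Suc (Suc n))", OF _ _ resc_len[OF rot_len[OF w]]])
      (auto intro!: klin_intros simp: length_Suc_conv)
  finally have "(- 1) ^ Suc n *\<^sub>p resc (tens (\<lambda>p. p) (face A (Suc n) xs))
      = hd_face (cyc (resc (tens (\<lambda>p. p) xs)))"
    by (simp only: resc_rot[OF w, symmetric] hoch_ops_simps)
  then show ?thesis using bprime_resc_tens[OF assms] by (simp add: hoch_def)
qed

lemma length_face: "length xs = Suc (Suc n) \<Longrightarrow> length (face A i xs) = Suc n"
  by (auto simp: face_def)

text \<open>
  The common form of the two boundaries \<open>b\<close> and \<open>b'\<close>, which are given by different sets \<open>J\<close> of
  faces.
\<close>

lemma theta_alternating_faces:
  assumes U: "U \<in> carrier (hochschild_chains A (Suc n))" and J: "finite J" and L: "klin L"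
    and eq: "\<And>xs. length xs = Suc (Suc n) \<Longrightarrow>
      (\<Sum>i\<in>J. (- 1) ^ i *\<^sub>p resc (tens (\<lambda>p. p) (face A i xs))) = L (resc (tens (\<lambda>p. p) xs))"
  shows "tensor_lift (hochschild_chains A n) (\<lambda>xs. \<Oplus>\<^bsub>hochschild_chains A n\<^esub> i\<in>J.
         (- 1) ^ i \<odot>\<^bsub>hochschild_chains A n\<^esub> pure_tensor A (face A i xs)) U \<in> carrier (hochschild_chains A n)"
    "theta (tensor_lift (hochschild_chains A n) (\<lambda>xs. \<Oplus>\<^bsub>hochschild_chains A n\<^esub> i\<in>J.
         (- 1) ^ i \<odot>\<^bsub>hochschild_chains A n\<^esub> pure_tensor A (face A i xs)) U) = L (theta U)"
proof -
  note c = theta_coords[of n]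
  let ?f = "\<lambda>xs. \<Oplus>\<^bsub>hochschild_chains A n\<^esub> i\<in>J.
         (- 1) ^ i \<odot>\<^bsub>hochschild_chains A n\<^esub> pure_tensor A (face A i xs)"
  have t: "(- 1) ^ i \<odot>\<^bsub>hochschild_chains A n\<^esub> pure_tensor A (face A i xs) \<in> carrier (hochschild_chains A n)"
    "theta ((- 1) ^ i \<odot>\<^bsub>hochschild_chains A n\<^esub> pure_tensor A (face A i xs))
      = (- 1) ^ i *\<^sub>p resc (tens (\<lambda>p. p) (face A i xs))" if "length xs = Suc (Suc n)" for i xs
    using theta_pure[OF length_face[OF that]] by (simp_all add: coords_smult[OF c])
  have "?f xs \<in> carrier (hochschild_chains A n) \<and> theta (?f xs) = L (resc (tens (\<lambda>p. p) xs))"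
    if "xs \<in> tuples A (Suc (Suc n))" for xs
  proof -
    have len: "length xs = Suc (Suc n)" using that by (simp add: tuples_A)
    show ?thesis
      using coords_finsum[OF c t(1)[OF len] J] eq[OF len] t(2)[OF len] by simp
  qed
  then have f: "?f xs \<in> carrier (hochschild_chains A n)" "theta (?f xs) = L (resc (tens (\<lambda>p. p) xs))"
    if "xs \<in> tuples A (Suc (Suc n))" for xs using that by blast+
  show "tensor_lift (hochschild_chains A n) ?f U \<in> carrier (hochschild_chains A n)"
    "theta (tensor_lift (hochschild_chains A n) ?f U) = L (theta U)"
    using tensor_lift_coords[OF A_coords c f(1) klin_comp[OF L klin_resc] f(2), where n = "Suc (Suc n)"] U
    by (simp_all add: hochschild_chains_def theta_def)
qed

lemma theta_hochschild_b:
  assumes "U \<in> carrier (hochschild_chains A (Suc n))"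
  shows "hochschild_b A n U \<in> carrier (hochschild_chains A n)" "theta (hochschild_b A n U) = hoch (theta U)"
  unfolding hochschild_b_def
  by (rule theta_alternating_faces[OF assms _ klin_hoch_ops(4)]; simp add: hoch_resc_tens del: sum.atMost_Suc)+

lemma theta_bar_b:
  assumes "U \<in> carrier (hochschild_chains A (Suc n))"
  shows "bar_b A n U \<in> carrier (hochschild_chains A n)" "theta (bar_b A n U) = bprime (theta U)"
  unfolding bar_b_def
  by (rule theta_alternating_faces[OF assms _ klin_hoch_ops(2)]; simp add: bprime_resc_tens del: sum.atMost_Suc)+

lemma theta_cyclic_t:
  assumes U: "U \<in> carrier (hochschild_chains A n)"
  shows "cyclic_t A n U \<in> carrier (hochschild_chains A n)" "theta (cyclic_t A n U) = cyc (theta U)"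
proof -
  note c = theta_coords[of n]
  let ?f = "\<lambda>xs. (- 1) ^ n \<odot>\<^bsub>hochschild_chains A n\<^esub> pure_tensor A (last xs # butlast xs)"
  have f: "?f xs \<in> carrier (hochschild_chains A n)" "theta (?f xs) = cyc (resc (tens (\<lambda>p. p) xs))"
    if "xs \<in> tuples A (Suc n)" for xs
  proof -
    have len: "length xs = Suc n" "xs \<noteq> []" using that by (auto simp: tuples_A)
    then have "length (last xs # butlast xs) = Suc n" by simp
    from theta_pure[OF this] show "?f xs \<in> carrier (hochschild_chains A n)"
      "theta (?f xs) = cyc (resc (tens (\<lambda>p. p) xs))"
      using resc_rot[OF tens_len[OF len(1)]] tens_rot[OF len(2)] by (simp_all add: coords_smult[OF c])
  qed
  show "cyclic_t A n U \<in> carrier (hochschild_chains A n)" "theta (cyclic_t A n U) = cyc (theta U)"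
    unfolding cyclic_t_def
    using tensor_lift_coords[OF A_coords c f(1) klin_comp[OF klin_hoch_ops(3) klin_resc] f(2), where n = "Suc n"] U
    by (simp_all add: hochschild_chains_def theta_def)
qed

lemma theta_cyclic_N:
  assumes U: "U \<in> carrier (hochschild_chains A n)"
  shows "cyclic_N A n U \<in> carrier (hochschild_chains A n)" "theta (cyclic_N A n U) = norm_op (Suc n) (theta U)"
proof -
  have t: "(cyclic_t A n ^^ i) U \<in> carrier (hochschild_chains A n) \<and> theta ((cyclic_t A n ^^ i) U) = (cyc ^^ i) (theta U)" for i
    by (induction i) (simp_all add: U theta_cyclic_t)
  show "cyclic_N A n U \<in> carrier (hochschild_chains A n)" "theta (cyclic_N A n U) = norm_op (Suc n) (theta U)"
    unfolding cyclic_N_def norm_op_def lessThan_Suc_atMost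
    using coords_finsum[OF theta_coords, of "{..n}" "\<lambda>i. (cyclic_t A n ^^ i) U" n] t by simp_all
qed

theorem HH_coords: "\<exists>G. coords (HH A n) (X_lambda \<omega> \<times> nsets m n) G"
proof -
  let ?C = "hochschild_chains A"
  note c = theta_coords
  have zero_iff: "U = \<zero>\<^bsub>?C k\<^esub> \<longleftrightarrow> theta U = 0" if "U \<in> carrier (?C k)" for U k
    using coords_inj[OF c that coords_zero(1)[OF c]] coords_zero(2)[OF c] by auto
  let ?Z = "cycles ?C (hochschild_b A) n"
  have Z: "?Z = {U \<in> carrier (?C n). hoch (theta U) = 0}"
  proof (cases n)
    case 0
    have "hoch (theta U) = 0" if "U \<in> carrier (?C 0)" for U
      using coords_fsupp[OF c that] by (intro hoch_len1) simp
    then show ?thesis by (auto simp: 0 cycles_def)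
  next
    case (Suc k)
    have "hochschild_b A k U = \<zero>\<^bsub>?C k\<^esub> \<longleftrightarrow> hoch (theta U) = 0" if "U \<in> carrier (?C (Suc k))" for U
      using zero_iff[OF theta_hochschild_b(1)[OF that]] theta_hochschild_b(2)[OF that] by simp
    then show ?thesis by (auto simp: cycles_def Suc)
  qed
  have B: "boundaries ?C (hochschild_b A) n = {U \<in> ?Z. hkr (theta U) = 0}"
  proof (intro equalityI subsetI)
    fix U assume "U \<in> boundaries ?C (hochschild_b A) n"
    then obtain V where V: "V \<in> carrier (?C (Suc n))" "U = hochschild_b A n V" by (auto simp: boundaries_def)
    then show "U \<in> {U \<in> ?Z. hkr (theta U) = 0}"
      using coords_fsupp[OF c V(1)] by (simp add: Z theta_hochschild_b hkr_hoch hoch_hoch)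
  next
    fix U assume U: "U \<in> {U \<in> ?Z. hkr (theta U) = 0}"
    then have u: "U \<in> carrier (?C n)" by (simp add: Z)
    obtain y where y: "y \<in> fsupp (len (Suc (Suc n)))" "hoch y = theta U"
      using hkr_kernel[OF coords_fsupp[OF c u]] U by (auto simp: Z)
    obtain V where V: "V \<in> carrier (?C (Suc n))" "theta V = y" using coords_surj[OF c y(1)] .
    have "U = hochschild_b A n V"
      by (rule coords_inj[OF c u]) (simp_all add: theta_hochschild_b V y)
    then show "U \<in> boundaries ?C (hochschild_b A) n" using V by (auto simp: boundaries_def)
  qed
  have "coords (quotient_module ((?C n)\<lparr>carrier := ?Z\<rparr>) (boundaries ?C (hochschild_b A) n))
      (central \<times> nsets m n) (\<lambda>U. the_elem ((\<lambda>U. hkr (theta U)) ` U))"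
  proof (rule quotient_coords(1))
    show "\<exists>z\<in>carrier ((?C n)\<lparr>carrier := ?Z\<rparr>). z \<oplus>\<^bsub>(?C n)\<lparr>carrier := ?Z\<rparr>\<^esub> x = y"
      if "x \<in> carrier ((?C n)\<lparr>carrier := ?Z\<rparr>)" "y \<in> carrier ((?C n)\<lparr>carrier := ?Z\<rparr>)" for x y
    proof -
      have x: "x \<in> carrier (?C n)" "hoch (theta x) = 0" "y \<in> carrier (?C n)" "hoch (theta y) = 0"
        using that by (simp_all add: Z)
      obtain z where z: "z \<in> carrier (?C n)" "z \<oplus>\<^bsub>?C n\<^esub> x = y" using coords_sub[OF c x(1) x(3)] by blast
      then have "theta z + theta x = theta y" using coords_add(2)[OF c z(1) x(1)] by simp
      then have "theta z = theta y - theta x" by (simp add: eq_diff_eq)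
      then show ?thesis using x z by (auto simp: Z)
    qed
    show "(\<lambda>U. hkr (theta U)) ` carrier ((?C n)\<lparr>carrier := ?Z\<rparr>) = fsupp (central \<times> nsets m n)"
    proof (intro equalityI subsetI)
      fix v assume "v \<in> (\<lambda>U. hkr (theta U)) ` carrier ((?C n)\<lparr>carrier := ?Z\<rparr>)"
      then show "v \<in> fsupp (central \<times> nsets m n)"
        using hkr_fsupp[OF coords_fsupp[OF c]] by (auto simp: Z)
    next
      fix v :: "'g \<times> nat set \<Rightarrow>\<^sub>0 'k" assume "v \<in> fsupp (central \<times> nsets m n)"
      then obtain z where z: "z \<in> fsupp (len (Suc n))" "hoch z = 0" "hkr z = v" using hkr_section by blast
      obtain V where "V \<in> carrier (?C n)" "theta V = z" using coords_surj[OF c z(1)] .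
      then show "v \<in> (\<lambda>U. hkr (theta U)) ` carrier ((?C n)\<lparr>carrier := ?Z\<rparr>)" using z by (force simp: Z)
    qed
  qed (simp_all add: B, simp_all add: Z coords_add[OF c] coords_smult[OF c])
  then show ?thesis unfolding HH_def homology_def central_eq by blast
qed

definition tot_theta :: "nat \<Rightarrow> (nat \<Rightarrow> (('g \<Rightarrow>\<^sub>0 'k) list \<Rightarrow>\<^sub>0 'k) set) \<Rightarrow> (nat \<Rightarrow> 'g list \<Rightarrow>\<^sub>0 'k)"
  where "tot_theta n c p = (if p \<le> n then theta (c p) else 0)"

lemma tot_carrier: "carrier (tot_chains A n) = (\<Pi>\<^sub>E p\<in>{..n}. carrier (hochschild_chains A (n - p)))"
  by (auto simp: tot_chains_def direct_sum_module_def)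

lemma tot_add: "c \<oplus>\<^bsub>tot_chains A n\<^esub> e = (\<lambda>p\<in>{..n}. c p \<oplus>\<^bsub>hochschild_chains A (n - p)\<^esub> e p)"
  and tot_smult: "a \<odot>\<^bsub>tot_chains A n\<^esub> c = (\<lambda>p\<in>{..n}. a \<odot>\<^bsub>hochschild_chains A (n - p)\<^esub> c p)"
  and tot_zero: "\<zero>\<^bsub>tot_chains A n\<^esub> = (\<lambda>p\<in>{..n}. \<zero>\<^bsub>hochschild_chains A (n - p)\<^esub>)"
  by (simp_all add: tot_chains_def direct_sum_module_def)

lemma tot_mem: "c \<in> carrier (tot_chains A n) \<Longrightarrow> p \<le> n \<Longrightarrow> c p \<in> carrier (hochschild_chains A (n - p))"
  by (auto simp: tot_carrier)

lemma tot_theta_add: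
  assumes "c \<in> carrier (tot_chains A n)" "e \<in> carrier (tot_chains A n)"
  shows "c \<oplus>\<^bsub>tot_chains A n\<^esub> e \<in> carrier (tot_chains A n)"
    "tot_theta n (c \<oplus>\<^bsub>tot_chains A n\<^esub> e) = (\<lambda>p. tot_theta n c p + tot_theta n e p)"
  using tot_mem[OF assms(1)] tot_mem[OF assms(2)]
  by (auto simp: tot_add tot_theta_def fun_eq_iff coords_add[OF theta_coords], simp add: tot_carrier coords_add[OF theta_coords])

lemma tot_theta_smult:
  assumes "c \<in> carrier (tot_chains A n)"
  shows "a \<odot>\<^bsub>tot_chains A n\<^esub> c \<in> carrier (tot_chains A n)"
    "tot_theta n (a \<odot>\<^bsub>tot_chains A n\<^esub> c) = (\<lambda>p. a *\<^sub>p tot_theta n c p)"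
  using tot_mem[OF assms(1)]
  by (auto simp: tot_smult tot_theta_def fun_eq_iff coords_smult[OF theta_coords], simp add: tot_carrier coords_smult[OF theta_coords])

lemma tot_theta_deg: "c \<in> carrier (tot_chains A n) \<Longrightarrow> tot_theta n c \<in> tot_deg n"
  using coords_fsupp[OF theta_coords tot_mem] by (auto simp: tot_deg_def tot_theta_def)

lemma tot_theta_inj:
  assumes "c \<in> carrier (tot_chains A n)" "e \<in> carrier (tot_chains A n)" "tot_theta n c = tot_theta n e"
  shows "c = e"
proof (rule PiE_ext)
  show "c \<in> (\<Pi>\<^sub>E p\<in>{..n}. carrier (hochschild_chains A (n - p)))" "e \<in> (\<Pi>\<^sub>E p\<in>{..n}. carrier (hochschild_chains A (n - p)))"
    using assms by (simp_all add: tot_carrier)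
  fix p assume p: "p \<in> {..n}"
  have "theta (c p) = theta (e p)" using fun_cong[OF assms(3), of p] p by (simp add: tot_theta_def)
  then show "c p = e p" using p assms tot_mem by (intro coords_inj[OF theta_coords]) auto
qed

lemma tot_theta_surj:
  assumes "c \<in> tot_deg n"
  shows "\<exists>u \<in> carrier (tot_chains A n). tot_theta n u = c"
proof -
  define u where "u = (\<lambda>p\<in>{..n}. SOME U. U \<in> carrier (hochschild_chains A (n - p)) \<and> theta U = c p)"
  have "u p \<in> carrier (hochschild_chains A (n - p)) \<and> theta (u p) = c p" if p: "p \<le> n" for p
  proof -
    have "\<exists>U. U \<in> carrier (hochschild_chains A (n - p)) \<and> theta U = c p"
      using coords_surj[OF theta_coords tot_deg_le[OF assms p]] by blast
    from someI_ex[OF this] show ?thesis using p by (simp add: u_def)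
  qed
  moreover have "u \<in> extensional {..n}" by (simp add: u_def)
  ultimately have "u \<in> carrier (tot_chains A n)" by (auto simp: tot_carrier PiE_def)
  moreover have "tot_theta n u = c"
    using \<open>\<And>p. p \<le> n \<Longrightarrow> _\<close> tot_deg_gt[OF assms] by (auto simp: tot_theta_def fun_eq_iff)
  ultimately show ?thesis by blast
qed

lemma tot_theta_boundary:
  assumes c: "c \<in> carrier (tot_chains A (Suc n))"
  shows "tot_boundary A n c \<in> carrier (tot_chains A n)"
    "tot_theta n (tot_boundary A n c) = tot_d n (tot_theta (Suc n) c)"
proof -
  have *: "tot_boundary A n c p \<in> carrier (hochschild_chains A (n - p)) \<and>
      theta (tot_boundary A n c p) = tot_d n (tot_theta (Suc n) c) p" if p: "p \<le> n" for p
  proof -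
    let ?k = "n - p"
    note k = theta_coords[of ?k]
    have u: "c p \<in> carrier (hochschild_chains A (Suc ?k))" using tot_mem[OF c, of p] p by (simp add: Suc_diff_le)
    have v: "c (Suc p) \<in> carrier (hochschild_chains A ?k)" using tot_mem[OF c, of "Suc p"] p by simp
    have V: "CC_vertical A p ?k (c p) \<in> carrier (hochschild_chains A ?k) \<and>
        theta (CC_vertical A p ?k (c p)) = (if even p then hoch (theta (c p)) else - bprime (theta (c p)))"
      unfolding CC_vertical_def using theta_hochschild_b[OF u] theta_bar_b[OF u] coords_minus[OF k] by simp
    have H: "CC_horizontal A p ?k (c (Suc p)) \<in> carrier (hochschild_chains A ?k) \<and>
        theta (CC_horizontal A p ?k (c (Suc p))) = (if even p then theta (c (Suc p)) - cyc (theta (c (Suc p)))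
          else norm_op (Suc ?k) (theta (c (Suc p))))"
      unfolding CC_horizontal_def using theta_cyclic_t[OF v] theta_cyclic_N[OF v] coords_diff[OF k v] by simp
    show ?thesis
      using p V H by (simp add: tot_boundary_def tot_d_def tot_theta_def coords_add[OF k])
  qed
  have "tot_boundary A n c \<in> extensional {..n}" by (simp add: tot_boundary_def)
  with * show "tot_boundary A n c \<in> carrier (tot_chains A n)" by (auto simp: tot_carrier PiE_def)
  show "tot_theta n (tot_boundary A n c) = tot_d n (tot_theta (Suc n) c)"
    using * by (auto simp: fun_eq_iff tot_theta_def) (simp add: tot_d_def)
qed

lemma tot_cycle_add: "tot_cycle n c \<Longrightarrow> tot_cycle n e \<Longrightarrow> tot_cycle n (\<lambda>p. c p + e p)"
  and tot_cycle_scale: "tot_cycle n c \<Longrightarrow> tot_cycle n (\<lambda>p. a *\<^sub>p c p)"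
  by (simp_all add: tot_cycle_def tot_d_add tot_d_scale)

theorem HC_coords: "\<exists>G. coords (HC A n) (hc_index n) G"
proof -
  let ?C = "tot_chains A"
  let ?Z = "cycles ?C (tot_boundary A) n"
  have zero: "tot_theta k \<zero>\<^bsub>?C k\<^esub> = (\<lambda>_. 0)" "\<zero>\<^bsub>?C k\<^esub> \<in> carrier (?C k)" for k
    by (auto simp: tot_zero tot_theta_def fun_eq_iff coords_zero[OF theta_coords] tot_carrier)
  have Z: "?Z = {c \<in> carrier (?C n). tot_cycle n (tot_theta n c)}"
  proof (cases n)
    case 0
    then show ?thesis by (simp add: cycles_def tot_cycle_def)
  next
    case (Suc k)
    have "tot_boundary A k c = \<zero>\<^bsub>?C k\<^esub> \<longleftrightarrow> (\<forall>p. tot_d k (tot_theta (Suc k) c) p = 0)"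
      if c: "c \<in> carrier (?C (Suc k))" for c
    proof
      assume "tot_boundary A k c = \<zero>\<^bsub>?C k\<^esub>"
      then have "tot_d k (tot_theta (Suc k) c) = (\<lambda>_. 0)" using tot_theta_boundary(2)[OF c] zero by simp
      then show "\<forall>p. tot_d k (tot_theta (Suc k) c) p = 0" by simp
    next
      assume "\<forall>p. tot_d k (tot_theta (Suc k) c) p = 0"
      then have "tot_d k (tot_theta (Suc k) c) = (\<lambda>_. 0)" by (simp add: fun_eq_iff)
      then show "tot_boundary A k c = \<zero>\<^bsub>?C k\<^esub>"
        by (intro tot_theta_inj[OF tot_theta_boundary(1)[OF c] zero(2)])
          (simp only: tot_theta_boundary(2)[OF c] zero(1))
    qed
    then show ?thesis using Suc by (auto simp: cycles_def tot_cycle_def)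
  qed
  have B: "boundaries ?C (tot_boundary A) n = {c \<in> ?Z. hc_coords n (tot_theta n c) = 0}"
  proof (intro equalityI subsetI)
    fix c assume "c \<in> boundaries ?C (tot_boundary A) n"
    then obtain e where e: "e \<in> carrier (?C (Suc n))" "c = tot_boundary A n e" by (auto simp: boundaries_def)
    note d = tot_theta_deg[OF e(1)]
    have "tot_cycle n (tot_d n (tot_theta (Suc n) e))"
      using d by (auto simp: tot_cycle_def tot_d_tot_d)
    then show "c \<in> {c \<in> ?Z. hc_coords n (tot_theta n c) = 0}"
      using e hc_coords_boundary[OF d] by (simp add: Z tot_theta_boundary)
  next
    fix c assume c: "c \<in> {c \<in> ?Z. hc_coords n (tot_theta n c) = 0}"
    then have cc: "c \<in> carrier (?C n)" by (simp add: Z)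
    obtain e where e: "e \<in> tot_deg (Suc n)" "\<forall>p. tot_d n e p = tot_theta n c p"
      using hc_coords_kernel[OF tot_theta_deg[OF cc]] c by (auto simp: Z)
    obtain u where u: "u \<in> carrier (?C (Suc n))" "tot_theta (Suc n) u = e" using tot_theta_surj[OF e(1)] by blast
    have "tot_theta n c = tot_d n (tot_theta (Suc n) u)"
      unfolding u(2) by (rule ext) (simp add: e(2))
    then have "c = tot_boundary A n u"
      using tot_theta_boundary[OF u(1)] by (intro tot_theta_inj[OF cc]) simp_all
    then show "c \<in> boundaries ?C (tot_boundary A) n" using u by (auto simp: boundaries_def)
  qed
  have "coords (quotient_module ((?C n)\<lparr>carrier := ?Z\<rparr>) (boundaries ?C (tot_boundary A) n))
      (hc_index n) (\<lambda>U. the_elem ((\<lambda>c. hc_coords n (tot_theta n c)) ` U))"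
  proof (rule quotient_coords(1))
    show "\<exists>z\<in>carrier ((?C n)\<lparr>carrier := ?Z\<rparr>). z \<oplus>\<^bsub>(?C n)\<lparr>carrier := ?Z\<rparr>\<^esub> x = y"
      if "x \<in> carrier ((?C n)\<lparr>carrier := ?Z\<rparr>)" "y \<in> carrier ((?C n)\<lparr>carrier := ?Z\<rparr>)" for x y
    proof -
      have x: "x \<in> carrier (?C n)" "tot_cycle n (tot_theta n x)" "y \<in> carrier (?C n)" "tot_cycle n (tot_theta n y)"
        using that by (simp_all add: Z)
      obtain z where z: "z \<in> carrier (?C n)" "tot_theta n z = (\<lambda>p. tot_theta n y p - tot_theta n x p)"
        using tot_theta_surj[OF tot_deg_diff[OF tot_theta_deg[OF x(3)] tot_theta_deg[OF x(1)]]] by blast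
      have "z \<oplus>\<^bsub>?C n\<^esub> x = y"
        by (rule tot_theta_inj[where n = n]) (simp_all add: tot_theta_add x z)
      moreover have "tot_cycle n (tot_theta n z)" using x z by (simp add: tot_cycle_def tot_d_diff)
      ultimately show ?thesis using z by (auto simp: Z)
    qed
    show "(\<lambda>c. hc_coords n (tot_theta n c)) ` carrier ((?C n)\<lparr>carrier := ?Z\<rparr>) = fsupp (hc_index n)"
    proof (intro equalityI subsetI)
      fix v assume "v \<in> (\<lambda>c. hc_coords n (tot_theta n c)) ` carrier ((?C n)\<lparr>carrier := ?Z\<rparr>)"
      then show "v \<in> fsupp (hc_index n)" using hc_coords_deg[OF tot_theta_deg] by (auto simp: Z)
    next
      fix v :: "nat \<times> 'g \<times> nat set \<Rightarrow>\<^sub>0 'k" assume "v \<in> fsupp (hc_index n)"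
      then obtain c where c: "c \<in> tot_deg n" "tot_cycle n c" "hc_coords n c = v" using hc_coords_surj by blast
      obtain u where "u \<in> carrier (?C n)" "tot_theta n u = c" using tot_theta_surj[OF c(1)] by blast
      then show "v \<in> (\<lambda>c. hc_coords n (tot_theta n c)) ` carrier ((?C n)\<lparr>carrier := ?Z\<rparr>)"
        using c by (intro image_eqI[of _ _ u]) (simp_all add: Z)
    qed
    show "x \<oplus>\<^bsub>(?C n)\<lparr>carrier := ?Z\<rparr>\<^esub> y \<in> carrier ((?C n)\<lparr>carrier := ?Z\<rparr>) \<and>
        hc_coords n (tot_theta n (x \<oplus>\<^bsub>(?C n)\<lparr>carrier := ?Z\<rparr>\<^esub> y)) = hc_coords n (tot_theta n x) + hc_coords n (tot_theta n y)"
      if "x \<in> carrier ((?C n)\<lparr>carrier := ?Z\<rparr>)" "y \<in> carrier ((?C n)\<lparr>carrier := ?Z\<rparr>)" for x y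
      using that by (simp add: Z tot_theta_add hc_coords_add tot_cycle_add)
    show "a \<odot>\<^bsub>(?C n)\<lparr>carrier := ?Z\<rparr>\<^esub> x \<in> carrier ((?C n)\<lparr>carrier := ?Z\<rparr>) \<and>
        hc_coords n (tot_theta n (a \<odot>\<^bsub>(?C n)\<lparr>carrier := ?Z\<rparr>\<^esub> x)) = a *\<^sub>p hc_coords n (tot_theta n x)"
      if "x \<in> carrier ((?C n)\<lparr>carrier := ?Z\<rparr>)" for a x
      using that by (simp add: Z tot_theta_smult hc_coords_scale tot_cycle_scale)
  qed (simp add: B)
  then show ?thesis unfolding HC_def homology_def by blast
qed

lemma exterior_power_int_coords:
  "\<exists>F. coords (exterior_power_int (std_space m :: ('k, nat \<Rightarrow>\<^sub>0 'k) module) (int n - 2 * int i))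
    (if 2 * i \<le> n then nsets m (n - 2 * i) else {}) F"
proof (cases "2 * i \<le> n")
  case True
  then have "\<not> int n - 2 * int i < 0" "nat (int n - 2 * int i) = n - 2 * i" by simp_all
  then show ?thesis using True exterior_power_coords[of m "n - 2 * i"] by (simp add: exterior_power_int_def)
next
  case False
  let ?E = "exterior_power (std_space m :: ('k, nat \<Rightarrow>\<^sub>0 'k) module) 0"
  obtain F where F: "coords ?E (nsets m 0) F" using exterior_power_coords by blast
  have z: "\<zero>\<^bsub>?E\<^esub> \<oplus>\<^bsub>?E\<^esub> \<zero>\<^bsub>?E\<^esub> = \<zero>\<^bsub>?E\<^esub>" "a \<odot>\<^bsub>?E\<^esub> \<zero>\<^bsub>?E\<^esub> = \<zero>\<^bsub>?E\<^esub>" for a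
    by (rule coords_inj[OF F]; simp add: coords_zero[OF F] coords_add[OF F] coords_smult[OF F])+
  have "coords (?E\<lparr>carrier := {\<zero>\<^bsub>?E\<^esub>}\<rparr>) ({} :: nat set set) (\<lambda>_. 0)"
    by (rule coordsI) (auto simp: z bij_betw_def fsupp_def)
  then show ?thesis using False by (auto simp: exterior_power_int_def)
qed

theorem HH_exterior:
  "HH A n \<simeq>\<^sub>k copies (exterior_power (std_space m :: ('k, nat \<Rightarrow>\<^sub>0 'k) module) n) (X_lambda \<omega>)"
proof -
  obtain F where F: "coords (exterior_power (std_space m :: ('k, nat \<Rightarrow>\<^sub>0 'k) module) n) (nsets m n) F"
    using exterior_power_coords by blast
  obtain G where "coords (copies (exterior_power (std_space m :: ('k, nat \<Rightarrow>\<^sub>0 'k) module) n) (X_lambda \<omega>))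
      (X_lambda \<omega> \<times> nsets m n) G"
    unfolding copies_def using direct_sum_coords[OF F] by blast
  then show ?thesis using HH_coords coords_isomorphic by blast
qed

text \<open>
  For \<open>x \<noteq> 0\<close> the monomials of degree \<open>n\<close> avoiding the pivot of \<open>x\<close> are as many as the monomials
  of degree \<open>n\<close> in \<open>m - 1\<close> variables, so the basis of the cokernels can be reindexed.
\<close>

theorem HC_exterior:
  "HC A n \<simeq>\<^sub>k direct_sum_module (UNIV :: nat set)
        (\<lambda>i. exterior_power_int (std_space m :: ('k, nat \<Rightarrow>\<^sub>0 'k) module) (int n - 2 * int i))
      \<oplus>\<^sub>k copies (exterior_power (std_space (m - 1) :: ('k, nat \<Rightarrow>\<^sub>0 'k) module) n) (X_lambda \<omega> - {0})"
proof -
  let ?B = "\<lambda>i. if 2 * i \<le> n then nsets m (n - 2 * i) else {}"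
  have "\<forall>i. \<exists>F. coords (exterior_power_int (std_space m :: ('k, nat \<Rightarrow>\<^sub>0 'k) module) (int n - 2 * int i)) (?B i) F"
    using exterior_power_int_coords by blast
  then obtain F where "\<forall>i. coords (exterior_power_int (std_space m :: ('k, nat \<Rightarrow>\<^sub>0 'k) module) (int n - 2 * int i)) (?B i) (F i)"
    by (rule choice[THEN exE])
  then obtain G1 where G1: "coords (direct_sum_module (UNIV :: nat set)
        (\<lambda>i. exterior_power_int (std_space m :: ('k, nat \<Rightarrow>\<^sub>0 'k) module) (int n - 2 * int i)))
      (SIGMA i:UNIV. ?B i) G1"
    using direct_sum_coords[of UNIV
        "\<lambda>i. exterior_power_int (std_space m :: ('k, nat \<Rightarrow>\<^sub>0 'k) module) (int n - 2 * int i)" ?B F]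
    by blast
  let ?S = "{(i, x, S). x = (0 :: 'g) \<and> 2 * i \<le> n \<and> S \<in> nsets m (n - 2 * i)}"
  have "bij_betw (\<lambda>(i, S). (i, 0 :: 'g, S)) (SIGMA i:UNIV. ?B i) ?S"
    by (rule bij_betw_byWitness[where f' = "\<lambda>(i, x, S). (i, S)"]) (auto split: if_splits)
  note G1' = coords_reindex[OF G1 this]
  obtain F' where F': "coords (exterior_power (std_space (m - 1) :: ('k, nat \<Rightarrow>\<^sub>0 'k) module) n) (nsets (m - 1) n) F'"
    using exterior_power_coords by blast
  obtain G2 where G2: "coords (copies (exterior_power (std_space (m - 1) :: ('k, nat \<Rightarrow>\<^sub>0 'k) module) n) (X_lambda \<omega> - {0}))
      ((X_lambda \<omega> - {0}) \<times> nsets (m - 1) n) G2"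
    unfolding copies_def using direct_sum_coords[OF F'] by blast
  let ?N = "\<lambda>x. {S \<in> nsets m n. pivot x \<notin> S}"
  have "\<forall>x. \<exists>h. x \<noteq> 0 \<longrightarrow> bij_betw h (nsets (m - 1) n) (?N x)"
  proof
    fix x :: 'g
    show "\<exists>h. x \<noteq> 0 \<longrightarrow> bij_betw h (nsets (m - 1) n) (?N x)"
    proof (cases "x = 0")
      case False
      let ?M = "{..<m} - {pivot x}"
      have N: "?N x = {S. S \<subseteq> ?M \<and> card S = n}" by (auto simp: nsets_def)
      have "finite (nsets (m - 1) n)" "finite (?N x)"
        unfolding N unfolding nsets_def by (auto intro: finite_subset[of _ "Pow {..<m - 1}"] finite_subset[of _ "Pow ?M"])
      moreover have "card (nsets (m - 1) n) = card (?N x)"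
      proof -
        have "card {S. S \<subseteq> ?M \<and> card S = n} = card ?M choose n" by (rule n_subsets) simp
        moreover have "card ?M = m - 1" using pivot[OF False] by simp
        moreover have "card {S. S \<subseteq> {..<m - 1} \<and> card S = n} = (m - 1) choose n"
          using n_subsets[of "{..<m - 1}" n] by simp
        ultimately show ?thesis unfolding N unfolding nsets_def by (simp only:)
      qed
      ultimately show ?thesis by (meson finite_same_card_bij)
    qed simp
  qed
  then obtain h where h: "\<forall>x. x \<noteq> 0 \<longrightarrow> bij_betw (h x) (nsets (m - 1) n) (?N x)"
    by (rule choice[THEN exE])
  let ?T = "{(i, x, S). i = (0 :: nat) \<and> x \<in> central - {0} \<and> S \<in> nsets m n \<and> pivot x \<notin> S}"
  have "bij_betw (\<lambda>(x, S). (0 :: nat, x, h x S)) ((X_lambda \<omega> - {0}) \<times> nsets (m - 1) n) ?T"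
  proof (rule bij_betw_imageI)
    show "inj_on (\<lambda>(x, S). (0 :: nat, x, h x S)) ((X_lambda \<omega> - {0}) \<times> nsets (m - 1) n)"
      using h by (auto simp: inj_on_def bij_betw_def)
    show "(\<lambda>(x, S). (0 :: nat, x, h x S)) ` ((X_lambda \<omega> - {0}) \<times> nsets (m - 1) n) = ?T"
    proof (intro equalityI subsetI)
      fix a assume "a \<in> (\<lambda>(x, S). (0 :: nat, x, h x S)) ` ((X_lambda \<omega> - {0}) \<times> nsets (m - 1) n)"
      then obtain x S where a: "a = (0, x, h x S)" "x \<in> X_lambda \<omega> - {0}" "S \<in> nsets (m - 1) n" by auto
      then have "h x S \<in> ?N x" using h bij_betwE by blast
      then show "a \<in> ?T" using a by (simp add: central_eq)
    next
      fix a assume "a \<in> ?T"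
      then obtain x S where a: "a = (0, x, S)" "x \<in> X_lambda \<omega> - {0}" "S \<in> ?N x" by (auto simp: central_eq)
      then obtain S' where "S' \<in> nsets (m - 1) n" "h x S' = S"
        using h bij_betw_imp_surj_on by (metis (no_types, lifting) DiffD2 imageE insertI1)
      then show "a \<in> (\<lambda>(x, S). (0 :: nat, x, h x S)) ` ((X_lambda \<omega> - {0}) \<times> nsets (m - 1) n)"
        using a by force
    qed
  qed
  note G2' = coords_reindex[OF G2 this]
  have "?S \<inter> ?T = {}" by auto
  from direct_sum2_coords[OF G1' G2' this] show ?thesis
    using HC_coords[of n] unfolding hc_index_def using coords_isomorphic by blast
qed

end


section \<open>The homology of a twisted group algebra of the integer lattice\<close>

theorem theorem5p23:
  fixes \<omega> :: "int ^ 'r \<Rightarrow> int ^ 'r \<Rightarrow> 'k::field_char_0" and n :: nat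
  assumes "normalized_2_cocycle \<omega>"
  shows "(HH (twisted_group_algebra \<omega>) n
           \<simeq>\<^sub>k copies (exterior_power (std_space CARD('r) :: ('k, nat \<Rightarrow>\<^sub>0 'k) module) n) (X_lambda \<omega>))
    \<and> (HC (twisted_group_algebra \<omega>) n
           \<simeq>\<^sub>k direct_sum_module (UNIV :: nat set)
                (\<lambda>i. exterior_power_int (std_space CARD('r) :: ('k, nat \<Rightarrow>\<^sub>0 'k) module)
                       (int n - 2 * int i))
              \<oplus>\<^sub>k copies (exterior_power (std_space (CARD('r) - 1) :: ('k, nat \<Rightarrow>\<^sub>0 'k) module) n)
                   (X_lambda \<omega> - {0}))"
proof -
  obtain \<beta> :: "nat \<Rightarrow> 'r" where \<beta>: "bij_betw \<beta> {..<CARD('r)} UNIV"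
    using ex_bij_betw_nat_finite[of "UNIV :: 'r set"] by (auto simp: atLeast0LessThan)
  interpret twisted_algebra "CARD('r)" "\<lambda>i g. g $ \<beta> i" "\<lambda>i. axis (\<beta> i) 1" \<omega>
  proof
    fix g :: "int ^ 'r"
    assume g: "\<And>i. i < CARD('r) \<Longrightarrow> g $ \<beta> i = 0"
    have "g $ j = 0" for j
    proof -
      obtain i where "i < CARD('r)" "\<beta> i = j" using \<beta> by (metis UNIV_I bij_betw_imp_surj_on imageE lessThan_iff)
      then show ?thesis using g by blast
    qed
    then show "g = 0" by (simp add: vec_eq_iff)
  next
    fix i j assume "i < CARD('r)" "j < CARD('r)"
    then show "axis (\<beta> j) (1 :: int) $ \<beta> i = (if i = j then 1 else 0)"
      using \<beta> by (auto simp: axis_def bij_betw_def inj_on_def)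
  qed (simp_all add: assms)
  show ?thesis using HH_exterior HC_exterior by blast
qed

end
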